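(* Let $\theta\in(0,1)$ and let $J\ge1$ be the smallest integer for which $\psi_{\mathbf A^{-1}}(J,\bar\eta_L)\le\sqrt{\frac{1-\theta^2}{\alpha_*\alpha^*}}$. Suppose that $u\in\mathcal A^{\eta,t}_G$ for some $\eta>0$ and $t\in(0,d]$. Then there exists a constant $C>1$ such that the cardinality of the set $\Lambda_n$ of the active degrees of freedom produced by PC-ADFOUR satisfies the bound $$|\Lambda_n|\le\kappa\,\frac{\omega_d}{\eta^{d/t}}\left(\log\frac{\|u\|_{\mathcal A^{\eta,t}_G}}{\|u-u_n\|}+\log C\right)^{d/t}\qquad\forall\,n\ge0.$$ If, in addition, $\mathbf A\in\mathcal D_e(\eta_L)$ and $\mathbf A^{-1}\in\mathcal D_e(\bar\eta_L)$ with $\eta_L>0$, $\bar\eta_L\in(0,\eta_L]$, $1\le d\le10$, and $\eta<\omega_d^{\,t/(d(1+2t))}\bar\eta_L$, then the cardinality of the intermediate sets $\widehat\Lambda_{n+1}$ activated in the predictor step can be estimated as $$|\widehat\Lambda_{n+1}|\le|\Lambda_n|+\kappa J^d\,\frac{\omega_d^2}{\bar\eta^{\,d/\bar t}}\left(\log\frac{\|u\|_{\mathcal A^{\eta,t}_G}}{\|u-u_n\|}+\big|\log\sqrt{1-\theta^2}\,\big|+\log C\right)^{d/\bar t}\qquad\forall\,n\ge0,$$ where $\bar\eta\le\eta$ and $\bar t\le t$ are positive constants such that $r(u_\Lambda)\in\mathcal A^{\bar\eta,\bar t}_G$ for every finite index set $\Lambda\subset\mathbb Z^d$, with $\|r(u_\Lambda)\|_{\mathcal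 A^{\bar\eta,\bar t}_G}\lesssim\|u\|_{\mathcal A^{\eta,t}_G}$ uniformly in $\Lambda$ (such constants exist under these assumptions).
   Context: Let $d\ge1$, $\Omega=(0,2\pi)^d$, $\phi_k(x)=(2\pi)^{-d/2}e^{ik\cdot x}$ for $k\in\mathbb Z^d$, $\hat v_k=(v,\phi_k)_{L^2(\Omega)}$. $V=H^1_p(\Omega)$: $H^1$ functions $2\pi$-periodic in each direction, norm $\|v\|^2=\sum_k(1+|k|^2)|\hat v_k|^2$ ($|k|$ Euclidean). $H^{-1}_p(\Omega)$ is its (anti)dual, $\hat f_k=\langle f,\phi_k\rangle$, $\|f\|^2=\sum_k(1+|k|^2)^{-1}|\hat f_k|^2$ (same symbol for both norms). For $\Lambda\subset\mathbb Z^d$, $P_\Lambda$ keeps only the Fourier coefficients with index in $\Lambda$; $V_\Lambda=\mathrm{span}\{\phi_k:k\in\Lambda\}$; $|\Lambda|$ is the cardinality. $Lu=-\nabla\cdot(\nu\nabla u)+\sigma u$ with sufficiently smooth real ($2\pi$-periodic) coefficients, $0<\nu_*\le\nu\le\nu^*<\infty$, $0<\sigma_*\le\sigma\le\sigma^*<\infty$; $\alpha_*=\min(\nu_*,\sigma_* )$, $\alpha^*=\max(\nu^*,\sigma^* )$; $a(u,v)=\int_\Omega\nu\nabla u\cdot\nabla\bar v+\int_\Omega\sigma u\bar v$; $f\in H^{-1}_p(\Omega)$; $u\in V$ solves $a(u,v)=\langle f,v\rangle$ for all $v\in V$. For finite $\Lambda$, $u_\Lambda\in V_\Lambda$ solves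 $a(u_\Lambda,v)=\langle f,v\rangle$ for all $v\in V_\Lambda$. Residual: $r(w)=f-Lw$. Stiffness matrix: $\mathbf A=(a_{\ell,k})_{\ell,k\in\mathbb Z^d}$, $a_{\ell,k}=\frac{a(\phi_k,\phi_\ell)}{c_\ell c_k}$, $c_k=\sqrt{1+|k|^2}$. A matrix is in $\mathcal D_a(\eta_L)$ (resp. $\mathcal D_e(\eta_L)$) if for some $c_L>0$ its entries satisfy $|a_{\ell,k}|\le c_L(1+|\ell-k|)^{-\eta_L}$ (resp. $|a_{\ell,k}|\le c_Le^{-\eta_L|\ell-k|}$) for all $\ell,k$. For a matrix $\mathbf B$ and integer $J\ge0$, $(\mathbf B_J)_{\ell,k}=b_{\ell,k}$ if $|\ell-k|\le J$ and $0$ otherwise. Standing assumption for PC-ADFOUR (so that $J$ is defined): either (a) $\mathbf A\in\mathcal D_a(\eta_L)$ with $\eta_L>d$ and $\mathbf A$ invertible in $\ell^2(\mathbb Z^d)$, in which case $\bar\eta_L=\eta_L$ and $\psi_{\mathbf A^{-1}}(J,\bar\eta_L)=C_{\mathbf A^{-1}}(J+1)^{-(\bar\eta_L-d)}$; or (b) $\mathbf A\in\mathcal D_e(\eta_L)$ with $c_L<\frac12(e^{\eta_L}-1)\min_\ell a_{\ell,\ell}$, in which case $\bar\eta_L\in(0,\eta_L]$ is such that $e^{-\bar\eta_L}$ is the unique zero in $(0,1)$ of $z^2-\frac{e^{2\eta_L}+2c_L+1}{e^{\eta_L}(c_L+1)}z+1$ and $\psi_{\mathbf A^{-1}}(J,\bar\eta_L)=C_{\mathbf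 A^{-1}}(J+1)^{d-1}e^{-\bar\eta_LJ}$. Here $C_{\mathbf A^{-1}}$ is a constant such that $\|\mathbf A^{-1}-(\mathbf A^{-1})_J\|_{\ell^2\to\ell^2}\le\psi_{\mathbf A^{-1}}(J,\bar\eta_L)$ for all $J\ge0$. DÖRFLER$(r,\theta)$ returns a finite set $\Lambda^*\subset\mathbb Z^d$ of minimal cardinality with $\|P_{\Lambda^*}r\|\ge\theta\|r\|$. ENRICH$(\Lambda,J)=\{k\in\mathbb Z^d:\exists\,\ell\in\Lambda,\ |k-\ell|\le J\}$. E-DÖRFLER$(r,\theta,J)=$ ENRICH(DÖRFLER$(r,\theta),J)$. COARSE$(w,\epsilon)$, for $w\in V_{\Lambda^*}$ with $\Lambda^*$ finite, returns a set $\Lambda\subseteq\Lambda^*$ of minimal cardinality such that $\|w-P_\Lambda w\|\le2\epsilon$ (it is used with $\epsilon$ known to satisfy $\|u-w\|\le\epsilon$). Algorithm PC-ADFOUR$(\theta,tol,J)$, $tol\in[0,1)$: set $\Lambda_0=\emptyset$, $u_0=0$, $r_0=f$. For $n=0,1,2,\dots$: $\widehat{\partial\Lambda}_n=$ E-DÖRFLER$(r_n,\theta,J)$; $\widehat\Lambda_{n+1}=\Lambda_n\cup\widehat{\partial\Lambda}_n$; $\widehat u_{n+1}=u_{\widehat\Lambda_{n+1}}$; $\Lambda_{n+1}=$ COARSE$\big(\widehat u_{n+1},\frac1{\alpha_*}\sqrt{1-\theta^2}\,\|r_n\|\big)$; $u_{n+1}=u_{\Lambda_{n+1}}$; $r_{n+1}=r(u_{n+1})$;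 continue while $\|r_{n+1}\|>tol$. $\omega_d$ is the measure of the Euclidean unit ball in $\mathbb R^d$; $E_N(v)=\inf_{|\Lambda|=N}\|v-P_\Lambda v\|$ ($E_0(v)=\|v\|$). Exponential class: $\mathcal A^{\eta,t}_G=\{v\in V:\ \|v\|_{\mathcal A^{\eta,t}_G}:=\sup_{N\ge0}E_N(v)\exp(\eta\,\omega_d^{-t/d}N^{t/d})<\infty\}$; the same notation is used for forms in $H^{-1}_p(\Omega)$, with $V$ and its norm replaced by $H^{-1}_p(\Omega)$ and its norm. $\kappa>1$ denotes a fixed constant used to absorb lower-order additive terms. If $u_n=u$ the right-hand sides are read as $+\infty$. *)

theory Defs
  imports "HOL-Analysis.Analysis"
begin

text \<open>Throughout, the dimension is \<open>d = CARD('d)\<close>; \<open>int ^ 'd\<close> is the index set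
  \<open>Z^d\<close> and \<open>real ^ 'd\<close> is \<open>R^d\<close>.\<close>

section \<open>Periodic functions and Fourier coefficients\<close>

definition Omega :: "(real ^ 'd::finite) set" where
  "Omega = box 0 (vec (2 * pi))"

definition omega :: "'d::finite itself \<Rightarrow> real" where
  "omega _ = measure lborel (ball (0 :: real ^ 'd) 1)"

definition rvec :: "int ^ 'd::finite \<Rightarrow> real ^ 'd" where
  "rvec k = (\<chi> i. real_of_int (k $ i))"

abbreviation idx_norm :: "int ^ 'd::finite \<Rightarrow> real" where
  "idx_norm k \<equiv> norm (rvec k)"

definition phi :: "int ^ 'd::finite \<Rightarrow> real ^ 'd \<Rightarrow> complex" where
  "phi k x = complex_of_real ((2 * pi) powr (- real CARD('d) / 2)) * cis (rvec k \<bullet> x)"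

definition periodic :: "(real ^ 'd::finite \<Rightarrow> 'b) \<Rightarrow> bool" where
  "periodic v \<longleftrightarrow> (\<forall>x i. v (x + axis i (2 * pi)) = v x)"

definition C1_fun :: "(real ^ 'd::finite \<Rightarrow> 'b::real_normed_vector) \<Rightarrow> bool" where
  "C1_fun g \<longleftrightarrow> (\<exists>g' :: real ^ 'd \<Rightarrow> ((real ^ 'd) \<Rightarrow>\<^sub>L 'b).
     (\<forall>x. (g has_derivative blinfun_apply (g' x)) (at x)) \<and> continuous_on UNIV g')"

definition partial :: "'d::finite \<Rightarrow> (real ^ 'd \<Rightarrow> complex) \<Rightarrow> real ^ 'd \<Rightarrow> complex" where
  "partial j g x = frechet_derivative g (at x) (axis j 1)"

definition L2p :: "(real ^ 'd::finite \<Rightarrow> complex) set" where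
  "L2p = {v. v \<in> borel_measurable borel \<and> periodic v \<and>
             set_integrable lborel Omega (\<lambda>x. (cmod (v x))\<^sup>2)}"

definition fcoeff :: "(real ^ 'd::finite \<Rightarrow> complex) \<Rightarrow> int ^ 'd \<Rightarrow> complex" where
  "fcoeff v k = (LINT x:Omega|lborel. v x * cnj (phi k x))"

section \<open>The space V, its antidual, and projections\<close>

text \<open>Weak derivatives are taken on the torus: the test functions are periodic, so that no
  boundary term appears and periodicity of the traces is built in. Functions are representatives;
  all notions below are invariant under modification on null sets.\<close>

definition weak_partial ::
    "'d::finite \<Rightarrow> (real ^ 'd \<Rightarrow> complex) \<Rightarrow> (real ^ 'd \<Rightarrow> complex) \<Rightarrow> bool" where
  "weak_partial j v g \<longleftrightarrow> g \<in> L2p \<and>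
     (\<forall>p. C1_fun p \<and> periodic p \<longrightarrow>
        (LINT x:Omega|lborel. v x * partial j p x) = - (LINT x:Omega|lborel. g x * p x))"

definition H1p :: "(real ^ 'd::finite \<Rightarrow> complex) set" where
  "H1p = {v \<in> L2p. \<forall>j. \<exists>g. weak_partial j v g}"

definition wderiv :: "'d::finite \<Rightarrow> (real ^ 'd \<Rightarrow> complex) \<Rightarrow> real ^ 'd \<Rightarrow> complex" where
  "wderiv j v = (SOME g. weak_partial j v g)"

definition H1_norm :: "(real ^ 'd::finite \<Rightarrow> complex) \<Rightarrow> real" where
  "H1_norm v = sqrt (\<Sum>\<^sub>\<infinity>k. (1 + (idx_norm k)\<^sup>2) * (cmod (fcoeff v k))\<^sup>2)"

text \<open>Only the values on \<^const>\<open>H1p\<close> of a form are meaningful.\<close>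

type_synonym 'd form = "(real ^ 'd \<Rightarrow> complex) \<Rightarrow> complex"

definition Hm1p :: "'d::finite form set" where
  "Hm1p = {f. (\<forall>v\<in>H1p. \<forall>w\<in>H1p. f (\<lambda>x. v x + w x) = f v + f w) \<and>
              (\<forall>c. \<forall>v\<in>H1p. f (\<lambda>x. c * v x) = cnj c * f v) \<and>
              (\<exists>K. \<forall>v\<in>H1p. cmod (f v) \<le> K * H1_norm v)}"

definition dual_norm :: "'d::finite form \<Rightarrow> real" where
  "dual_norm f = sqrt (\<Sum>\<^sub>\<infinity>k. (cmod (f (phi k)))\<^sup>2 / (1 + (idx_norm k)\<^sup>2))"

text \<open>The projections are only used for finite index sets. On forms, the conjugate accounts for
  antilinearity: \<open>proj_dual S f (phi k)\<close> is \<open>f (phi k)\<close> for \<open>k \<in> S\<close> and \<open>0\<close> otherwise.\<close>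

definition proj :: "(int ^ 'd::finite) set \<Rightarrow> (real ^ 'd \<Rightarrow> complex) \<Rightarrow> real ^ 'd \<Rightarrow> complex" where
  "proj S v = (\<lambda>x. \<Sum>k\<in>S. fcoeff v k * phi k x)"

definition proj_dual :: "(int ^ 'd::finite) set \<Rightarrow> 'd form \<Rightarrow> 'd form" where
  "proj_dual S f = (\<lambda>v. \<Sum>k\<in>S. f (phi k) * cnj (fcoeff v k))"

definition trial_space :: "(int ^ 'd::finite) set \<Rightarrow> (real ^ 'd \<Rightarrow> complex) set" where
  "trial_space S = {w. \<exists>c. w = (\<lambda>x. \<Sum>k\<in>S. c k * phi k x)}"

section \<open>The elliptic problem and its Galerkin approximation\<close>

text \<open>Continuous differentiability is all the smoothness imposed on the coefficients.\<close>

definition elliptic_coeffs ::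
    "(real ^ 'd::finite \<Rightarrow> real) \<Rightarrow> (real ^ 'd \<Rightarrow> real) \<Rightarrow> real \<Rightarrow> real \<Rightarrow> real \<Rightarrow> real \<Rightarrow> bool" where
  "elliptic_coeffs \<nu> \<sigma> \<nu>\<^sub>l \<nu>\<^sub>u \<sigma>\<^sub>l \<sigma>\<^sub>u \<longleftrightarrow>
     C1_fun \<nu> \<and> periodic \<nu> \<and> C1_fun \<sigma> \<and> periodic \<sigma> \<and>
     0 < \<nu>\<^sub>l \<and> (\<forall>x. \<nu>\<^sub>l \<le> \<nu> x \<and> \<nu> x \<le> \<nu>\<^sub>u) \<and>
     0 < \<sigma>\<^sub>l \<and> (\<forall>x. \<sigma>\<^sub>l \<le> \<sigma> x \<and> \<sigma> x \<le> \<sigma>\<^sub>u)"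

definition bilin ::
    "(real ^ 'd::finite \<Rightarrow> real) \<Rightarrow> (real ^ 'd \<Rightarrow> real) \<Rightarrow>
     (real ^ 'd \<Rightarrow> complex) \<Rightarrow> (real ^ 'd \<Rightarrow> complex) \<Rightarrow> complex" where
  "bilin \<nu> \<sigma> u v =
     (LINT x:Omega|lborel. complex_of_real (\<nu> x) * (\<Sum>j\<in>UNIV. wderiv j u x * cnj (wderiv j v x))) +
     (LINT x:Omega|lborel. complex_of_real (\<sigma> x) * u x * cnj (v x))"

definition weak_solution ::
    "(real ^ 'd::finite \<Rightarrow> real) \<Rightarrow> (real ^ 'd \<Rightarrow> real) \<Rightarrow> 'd form \<Rightarrow> (real ^ 'd \<Rightarrow> complex) \<Rightarrow> bool" where
  "weak_solution \<nu> \<sigma> f u \<longleftrightarrow> u \<in> H1p \<and> (\<forall>v\<in>H1p. bilin \<nu> \<sigma> u v = f v)"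

definition galerkin ::
    "(real ^ 'd::finite \<Rightarrow> real) \<Rightarrow> (real ^ 'd \<Rightarrow> real) \<Rightarrow> 'd form \<Rightarrow> (int ^ 'd) set \<Rightarrow>
     real ^ 'd \<Rightarrow> complex" where
  "galerkin \<nu> \<sigma> f S =
     (THE w. w \<in> trial_space S \<and> (\<forall>v\<in>trial_space S. bilin \<nu> \<sigma> w v = f v))"

definition residual ::
    "(real ^ 'd::finite \<Rightarrow> real) \<Rightarrow> (real ^ 'd \<Rightarrow> real) \<Rightarrow> 'd form \<Rightarrow> (real ^ 'd \<Rightarrow> complex) \<Rightarrow> 'd form" where
  "residual \<nu> \<sigma> f w = (\<lambda>v. f v - bilin \<nu> \<sigma> w v)"

section \<open>Infinite matrices on square-summable sequences\<close>

type_synonym 'd imatrix = "int ^ 'd \<Rightarrow> int ^ 'd \<Rightarrow> complex"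

definition ell2 :: "(int ^ 'd::finite \<Rightarrow> complex) set" where
  "ell2 = {x. (\<lambda>k. (cmod (x k))\<^sup>2) summable_on UNIV}"

definition ell2_norm :: "(int ^ 'd::finite \<Rightarrow> complex) \<Rightarrow> real" where
  "ell2_norm x = sqrt (\<Sum>\<^sub>\<infinity>k. (cmod (x k))\<^sup>2)"

definition mat_app :: "'d::finite imatrix \<Rightarrow> (int ^ 'd \<Rightarrow> complex) \<Rightarrow> int ^ 'd \<Rightarrow> complex" where
  "mat_app M x = (\<lambda>l. \<Sum>\<^sub>\<infinity>k. M l k * x k)"

definition ell2_bound :: "'d::finite imatrix \<Rightarrow> real \<Rightarrow> bool" where
  "ell2_bound M c \<longleftrightarrow> 0 \<le> c \<and>
     (\<forall>x\<in>ell2. (\<forall>l. (\<lambda>k. M l k * x k) summable_on UNIV) \<and> mat_app M x \<in> ell2 \<and>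
               ell2_norm (mat_app M x) \<le> c * ell2_norm x)"

text \<open>Infinite if the matrix does not define a bounded operator.\<close>

definition ell2_opnorm :: "'d::finite imatrix \<Rightarrow> ereal" where
  "ell2_opnorm M = (INF c\<in>{c. ell2_bound M c}. ereal c)"

definition ell2_inverse_of :: "'d::finite imatrix \<Rightarrow> 'd imatrix \<Rightarrow> bool" where
  "ell2_inverse_of M B \<longleftrightarrow> ell2_opnorm M < \<infinity> \<and> ell2_opnorm B < \<infinity> \<and>
     (\<forall>x\<in>ell2. mat_app M (mat_app B x) = x \<and> mat_app B (mat_app M x) = x)"

definition ell2_invertible :: "'d::finite imatrix \<Rightarrow> bool" where
  "ell2_invertible M \<longleftrightarrow> (\<exists>B. ell2_inverse_of M B)"

definition mat_inverse :: "'d::finite imatrix \<Rightarrow> 'd imatrix" where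
  "mat_inverse M = (THE B. ell2_inverse_of M B)"

definition mat_trunc :: "nat \<Rightarrow> 'd::finite imatrix \<Rightarrow> 'd imatrix" where
  "mat_trunc J M = (\<lambda>l k. if idx_norm (l - k) \<le> real J then M l k else 0)"

definition alg_decay :: "real \<Rightarrow> 'd::finite imatrix set" where
  "alg_decay \<eta> = {M. \<exists>c>0. \<forall>l k. cmod (M l k) \<le> c * (1 + idx_norm (l - k)) powr (- \<eta>)}"

definition exp_decay_const :: "real \<Rightarrow> real \<Rightarrow> 'd::finite imatrix set" where
  "exp_decay_const c \<eta> = {M. 0 < c \<and> (\<forall>l k. cmod (M l k) \<le> c * exp (- \<eta> * idx_norm (l - k)))}"

definition exp_decay :: "real \<Rightarrow> 'd::finite imatrix set" where
  "exp_decay \<eta> = {M. \<exists>c. M \<in> exp_decay_const c \<eta>}"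

definition stiffness ::
    "(real ^ 'd::finite \<Rightarrow> real) \<Rightarrow> (real ^ 'd \<Rightarrow> real) \<Rightarrow> 'd imatrix" where
  "stiffness \<nu> \<sigma> = (\<lambda>l k. bilin \<nu> \<sigma> (phi k) (phi l) /
     complex_of_real (sqrt (1 + (idx_norm l)\<^sup>2) * sqrt (1 + (idx_norm k)\<^sup>2)))"

text \<open>The (real) diagonal entries need not attain a minimum, hence the infimum.\<close>

definition decay_assumption ::
    "'d::finite imatrix \<Rightarrow> real \<Rightarrow> real \<Rightarrow> real \<Rightarrow> (nat \<Rightarrow> real) \<Rightarrow> bool" where
  "decay_assumption A \<eta>\<^sub>L \<eta>\<^sub>L' C\<^sub>A \<psi> \<longleftrightarrow>
     ((A \<in> alg_decay \<eta>\<^sub>L \<and> real CARD('d) < \<eta>\<^sub>L \<and> ell2_invertible A \<and> \<eta>\<^sub>L' = \<eta>\<^sub>L \<and>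
       \<psi> = (\<lambda>J. C\<^sub>A * (real J + 1) powr (- (\<eta>\<^sub>L' - real CARD('d))))) \<or>
      (\<exists>c\<^sub>L. A \<in> exp_decay_const c\<^sub>L \<eta>\<^sub>L \<and>
         c\<^sub>L < 1 / 2 * (exp \<eta>\<^sub>L - 1) * (INF l. Re (A l l)) \<and>
         0 < \<eta>\<^sub>L' \<and> \<eta>\<^sub>L' \<le> \<eta>\<^sub>L \<and>
         (\<forall>z. 0 < z \<and> z < 1 \<longrightarrow>
            (z\<^sup>2 - (exp (2 * \<eta>\<^sub>L) + 2 * c\<^sub>L + 1) / (exp \<eta>\<^sub>L * (c\<^sub>L + 1)) * z + 1 = 0
             \<longleftrightarrow> z = exp (- \<eta>\<^sub>L'))) \<and>
         \<psi> = (\<lambda>J. C\<^sub>A * (real J + 1) ^ (CARD('d) - 1) * exp (- \<eta>\<^sub>L' * real J)))) \<and>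
     (\<forall>J. ell2_opnorm (\<lambda>l k. mat_inverse A l k - mat_trunc J (mat_inverse A) l k) \<le> ereal (\<psi> J))"

section \<open>Exponential approximation classes\<close>

definition best_err :: "nat \<Rightarrow> (real ^ 'd::finite \<Rightarrow> complex) \<Rightarrow> real" where
  "best_err N v = (INF S\<in>{S. finite S \<and> card S = N}. H1_norm (\<lambda>x. v x - proj S v x))"

definition best_err_dual :: "nat \<Rightarrow> 'd::finite form \<Rightarrow> real" where
  "best_err_dual N f = (INF S\<in>{S. finite S \<and> card S = N}. dual_norm (\<lambda>v. f v - proj_dual S f v))"

definition exp_weight :: "'d::finite itself \<Rightarrow> real \<Rightarrow> real \<Rightarrow> nat \<Rightarrow> real" where
  "exp_weight D \<eta> t N =
     exp (\<eta> * omega D powr (- t / real CARD('d)) * real N powr (t / real CARD('d)))"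

definition AG :: "real \<Rightarrow> real \<Rightarrow> (real ^ 'd::finite \<Rightarrow> complex) set" where
  "AG \<eta> t = {v \<in> H1p. bdd_above (range (\<lambda>N. best_err N v * exp_weight TYPE('d) \<eta> t N))}"

definition AG_norm :: "real \<Rightarrow> real \<Rightarrow> (real ^ 'd::finite \<Rightarrow> complex) \<Rightarrow> real" where
  "AG_norm \<eta> t v = (SUP N. best_err N v * exp_weight TYPE('d) \<eta> t N)"

definition AG_dual :: "real \<Rightarrow> real \<Rightarrow> 'd::finite form set" where
  "AG_dual \<eta> t = {f \<in> Hm1p. bdd_above (range (\<lambda>N. best_err_dual N f * exp_weight TYPE('d) \<eta> t N))}"

definition AG_dual_norm :: "real \<Rightarrow> real \<Rightarrow> 'd::finite form \<Rightarrow> real" where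
  "AG_dual_norm \<eta> t f = (SUP N. best_err_dual N f * exp_weight TYPE('d) \<eta> t N)"

section \<open>The algorithm\<close>

text \<open>The outputs of the marking and coarsening procedures need not be unique, so these are
  relations between inputs and admissible outputs.\<close>

definition dorfler :: "'d::finite form \<Rightarrow> real \<Rightarrow> (int ^ 'd) set \<Rightarrow> bool" where
  "dorfler r \<theta> S \<longleftrightarrow> finite S \<and> \<theta> * dual_norm r \<le> dual_norm (proj_dual S r) \<and>
     (\<forall>T. finite T \<and> \<theta> * dual_norm r \<le> dual_norm (proj_dual T r) \<longrightarrow> card S \<le> card T)"

definition enrich :: "(int ^ 'd::finite) set \<Rightarrow> nat \<Rightarrow> (int ^ 'd) set" where
  "enrich S J = {k. \<exists>l\<in>S. idx_norm (k - l) \<le> real J}"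

definition e_dorfler :: "'d::finite form \<Rightarrow> real \<Rightarrow> nat \<Rightarrow> (int ^ 'd) set \<Rightarrow> bool" where
  "e_dorfler r \<theta> J T \<longleftrightarrow> (\<exists>S. dorfler r \<theta> S \<and> T = enrich S J)"

text \<open>\<open>coarse w \<epsilon> S T\<close>: \<open>T\<close> is an admissible output for \<open>w\<close> in the trial space of \<open>S\<close>.\<close>

definition coarse ::
    "(real ^ 'd::finite \<Rightarrow> complex) \<Rightarrow> real \<Rightarrow> (int ^ 'd) set \<Rightarrow> (int ^ 'd) set \<Rightarrow> bool" where
  "coarse w \<epsilon> S T \<longleftrightarrow> T \<subseteq> S \<and> H1_norm (\<lambda>x. w x - proj T w x) \<le> 2 * \<epsilon> \<and>
     (\<forall>T'. T' \<subseteq> S \<and> H1_norm (\<lambda>x. w x - proj T' w x) \<le> 2 * \<epsilon> \<longrightarrow> card T \<le> card T')"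

text \<open>\<open>N\<close> iterations have been executed, so that \<open>\<Lambda> n\<close>, \<open>U n\<close>, \<open>R n\<close> are produced for \<open>n \<le> N\<close>
  and \<open>\<Lambda>h (n + 1)\<close> for \<open>n < N\<close>. The stopping test is made at the end of an iteration, so the
  first iteration is unconditional. The sequences are irrelevant beyond these ranges; a run that
  never stops corresponds to arbitrarily large \<open>N\<close>.\<close>

definition pc_adfour_run ::
    "(real ^ 'd::finite \<Rightarrow> real) \<Rightarrow> (real ^ 'd \<Rightarrow> real) \<Rightarrow> real \<Rightarrow> 'd form \<Rightarrow>
     real \<Rightarrow> real \<Rightarrow> nat \<Rightarrow> nat \<Rightarrow>
     (nat \<Rightarrow> (int ^ 'd) set) \<Rightarrow> (nat \<Rightarrow> (int ^ 'd) set) \<Rightarrow>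
     (nat \<Rightarrow> real ^ 'd \<Rightarrow> complex) \<Rightarrow> (nat \<Rightarrow> 'd form) \<Rightarrow> bool" where
  "pc_adfour_run \<nu> \<sigma> \<alpha>\<^sub>l f \<theta> tol J N \<Lambda> \<Lambda>h U R \<longleftrightarrow>
     \<Lambda> 0 = {} \<and> U 0 = (\<lambda>_. 0) \<and> R 0 = f \<and>
     (\<forall>n<N.
        (0 < n \<longrightarrow> tol < dual_norm (R n)) \<and>
        (\<exists>T. e_dorfler (R n) \<theta> J T \<and> \<Lambda>h (n + 1) = \<Lambda> n \<union> T) \<and>
        coarse (galerkin \<nu> \<sigma> f (\<Lambda>h (n + 1)))
               (1 / \<alpha>\<^sub>l * sqrt (1 - \<theta>\<^sup>2) * dual_norm (R n)) (\<Lambda>h (n + 1)) (\<Lambda> (n + 1)) \<and>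
        U (n + 1) = galerkin \<nu> \<sigma> f (\<Lambda> (n + 1)) \<and>
        R (n + 1) = residual \<nu> \<sigma> f (U (n + 1)))"

text \<open>The residuals of all Galerkin solutions lie in one sparsity class, with norms controlled by
  that of the solution, uniformly in the finite index set.\<close>

definition residual_sparsity ::
    "(real ^ 'd::finite \<Rightarrow> real) \<Rightarrow> (real ^ 'd \<Rightarrow> real) \<Rightarrow> 'd form \<Rightarrow> (real ^ 'd \<Rightarrow> complex) \<Rightarrow>
     real \<Rightarrow> real \<Rightarrow> real \<Rightarrow> real \<Rightarrow> bool" where
  "residual_sparsity \<nu> \<sigma> f u \<eta> t \<eta>' t' \<longleftrightarrow>
     (\<exists>K. \<forall>S. finite S \<longrightarrow>
        residual \<nu> \<sigma> f (galerkin \<nu> \<sigma> f S) \<in> AG_dual \<eta>' t' \<and>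
        AG_dual_norm \<eta>' t' (residual \<nu> \<sigma> f (galerkin \<nu> \<sigma> f S)) \<le> K * AG_norm \<eta> t u)"

end

theory Submission
  imports Defs
begin

text \<open>
  Weight the \<open>k\<close>-th Fourier coefficient by \<open>wt k = sqrt (1 + |k|^2)\<close>
  (and that of a form by the inverse weight). Norms in \<open>V\<close> and in its antidual become
  the norm of the Hilbert space \<open>l2\<close>, the operator becomes the stiffness matrix
  \<open>T\<close>, Galerkin problems become finite sections, and both projections become the
  restriction of a vector to an index set. The matrix is Hermitian, bounded by
  \<open>\<alpha>\<^sub>u\<close> and coercive with constant \<open>\<alpha>\<^sub>l\<close>, and
  the theorem turns into a statement about such operators.

  \<^bold>\<open>Predictor.\<close> Let \<open>r\<close> be the current residual and
  \<open>s\<close> the fraction of its norm that is captured by the marked set \<open>D\<close>.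
  The new Galerkin solution is compared with the old one plus \<open>B\<^sub>J\<close> applied to
  the marked part of \<open>r\<close>, where \<open>B\<^sub>J\<close> is the inverse matrix
  truncated to bandwidth \<open>J\<close>; enrichment by \<open>J\<close> makes this competitor
  admissible. With \<open>c = sqrt (1 - \<theta>^2)\<close> the choice of \<open>J\<close> bounds
  the error by \<open>(sqrt (1 - s^2) + s * c) * norm r / \<alpha>\<^sub>l\<close> (lemma
  \<open>predictor_error\<close>). As \<open>\<theta> \<le> s \<le> 1\<close>, this is at most
  \<open>(2 - g) * \<epsilon>\<close> where \<open>\<epsilon> = c * norm r /
  \<alpha>\<^sub>l\<close> and \<open>g > 0\<close> depends on \<open>\<theta>\<close> only (lemma
  \<open>marking_gap\<close>).

  \<^bold>\<open>Corrector.\<close> The coarsening tolerance \<open>2 * \<epsilon>\<close> exceeds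
  the predictor error by \<open>g * \<epsilon>\<close>. Every set that approximates the exact
  solution up to \<open>g * \<epsilon>\<close> is therefore at least as large as the coarsened set
  (lemma \<open>corrector_card\<close>), while the new error is at most a constant times
  \<open>\<epsilon>\<close> (lemma \<open>corrector_error\<close>). The exponential class provides
  such a set whose cardinality is, up to rounding, the right-hand side of the first bound; the
  rounding and all constants are moved under the logarithm (lemmas
  \<open>exists_small_error_index\<close> and \<open>absorb_additive_terms\<close>). The marked
  set is counted in the same way from the sparsity of the residual, and enrichment multiplies its
  cardinality by at most \<open>3 ^ d * J ^ d\<close>; the comparison with \<open>omega * J ^
  d\<close> gives the dimensional constant \<open>\<kappa>\<close>.

  \<^bold>\<open>Sparsity of residuals.\<close> The Galerkin projection of a vector
  \<open>v\<close> with \<open>N\<close> active indices is computed by \<open>m\<close> steps of a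
  projected Richardson iteration in which \<open>T\<close> is truncated to bandwidth
  \<open>m\<close>. Contraction and exponential decay of \<open>T\<close> make the error
  exponentially small in \<open>m\<close>, whatever the index set of the Galerkin problem, and the
  residual is approximated on at most \<open>N * (5 * m^2) ^ d\<close> indices. Balancing
  \<open>m\<close> against \<open>N powr (t / d)\<close> yields a class with exponent \<open>t /
  (1 + 2 * t)\<close> (lemma \<open>residual_sparsity_class\<close>).

  \<^bold>\<open>Fourier analysis.\<close> What remains is to identify the sesquilinear form with
  the matrix. Weak derivatives are determined almost everywhere because trigonometric polynomials
  are complete (lemma \<open>L2p_fcoeff_zero_AE\<close>). Whenever the form is expressed by
  Fourier coefficients, one of its arguments is a trigonometric polynomial; multiplied by the
  continuous coefficients of the operator it gives a continuous periodic factor in each integral.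
  Parseval's identity for pairs with such a factor (lemma \<open>parseval\<close>) is a
  consequence of uniform approximation by trigonometric polynomials, and it represents the form by
  the matrix.
\<close>

section \<open>The Hilbert space of square-summable families\<close>

text \<open>Complex families, but with the real inner product: all energy arguments below use only real
  parts, and the type then belongs to the classes of real inner product and of Banach spaces.\<close>

typedef 'a l2 = "{x :: 'a \<Rightarrow> complex. (\<lambda>k. (cmod (x k))\<^sup>2) summable_on UNIV}"
  morphisms seq mk
  by (rule exI[of _ "\<lambda>_. 0"]) simp

setup_lifting type_definition_l2

lemma seq_summable: "(\<lambda>k. (cmod (seq x k))\<^sup>2) summable_on UNIV"
  using seq[of x] by simp

lemma seq_mk: "(\<lambda>k. (cmod (x k))\<^sup>2) summable_on UNIV \<Longrightarrow> seq (mk x) = x"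
  by (simp add: mk_inverse)

lemma l2_eqI: "(\<And>k. seq x k = seq y k) \<Longrightarrow> x = y"
  by (simp add: seq_inject[symmetric] ext)

lemma square_summableI:
  fixes x :: "'a \<Rightarrow> complex"
  assumes "\<And>F. finite F \<Longrightarrow> (\<Sum>k\<in>F. (cmod (x k))\<^sup>2) \<le> b"
  shows "(\<lambda>k. (cmod (x k))\<^sup>2) summable_on UNIV"
  by (rule nonneg_bdd_above_summable_on) (auto intro!: bdd_aboveI2[where M=b] assms)

lemma product_summable:
  fixes x y :: "'a \<Rightarrow> complex"
  assumes "(\<lambda>k. (cmod (x k))\<^sup>2) summable_on UNIV" "(\<lambda>k. (cmod (y k))\<^sup>2) summable_on UNIV"
  shows "(\<lambda>k. cmod (x k) * cmod (y k)) summable_on UNIV"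
proof (rule summable_on_comparison_test)
  show "(\<lambda>k. (cmod (x k))\<^sup>2 + (cmod (y k))\<^sup>2) summable_on UNIV"
    using assms by (rule summable_on_add)
  show "cmod (x k) * cmod (y k) \<le> (cmod (x k))\<^sup>2 + (cmod (y k))\<^sup>2" for k
  proof -
    have "0 \<le> cmod (x k) * cmod (y k)" by simp
    then show ?thesis using sum_squares_bound[of "cmod (x k)" "cmod (y k)"] by linarith
  qed
qed simp

lemma square_summable_add:
  fixes x y :: "'a \<Rightarrow> complex"
  assumes "(\<lambda>k. (cmod (x k))\<^sup>2) summable_on UNIV" "(\<lambda>k. (cmod (y k))\<^sup>2) summable_on UNIV"
  shows "(\<lambda>k. (cmod (x k + y k))\<^sup>2) summable_on UNIV"
proof (rule summable_on_comparison_test)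
  show "(\<lambda>k. 2 * (cmod (x k))\<^sup>2 + 2 * (cmod (y k))\<^sup>2) summable_on UNIV"
    using assms by (intro summable_on_add summable_on_cmult_right)
  show "(cmod (x k + y k))\<^sup>2 \<le> 2 * (cmod (x k))\<^sup>2 + 2 * (cmod (y k))\<^sup>2" for k
  proof -
    have "(cmod (x k + y k))\<^sup>2 \<le> (cmod (x k) + cmod (y k))\<^sup>2"
      by (intro power_mono norm_triangle_ineq) auto
    also have "\<dots> \<le> 2 * (cmod (x k))\<^sup>2 + 2 * (cmod (y k))\<^sup>2"
      using sum_squares_bound[of "cmod (x k)" "cmod (y k)"] by (simp add: power2_sum)
    finally show ?thesis .
  qed
qed simp

instantiation l2 :: (type) real_vector
begin
lift_definition zero_l2 :: "'a l2" is "\<lambda>_. 0" by simp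
lift_definition plus_l2 :: "'a l2 \<Rightarrow> 'a l2 \<Rightarrow> 'a l2" is "\<lambda>x y k. x k + y k"
  by (rule square_summable_add)
lift_definition uminus_l2 :: "'a l2 \<Rightarrow> 'a l2" is "\<lambda>x k. - x k" by simp
lift_definition minus_l2 :: "'a l2 \<Rightarrow> 'a l2 \<Rightarrow> 'a l2" is "\<lambda>x y k. x k - y k"
proof -
  fix x y :: "'a \<Rightarrow> complex"
  assume x: "(\<lambda>k. (cmod (x k))\<^sup>2) summable_on UNIV" and y: "(\<lambda>k. (cmod (y k))\<^sup>2) summable_on UNIV"
  have "(\<lambda>k. (cmod (x k + - y k))\<^sup>2) summable_on UNIV"
    by (rule square_summable_add[OF x]) (use y in simp)
  then show "(\<lambda>k. (cmod (x k - y k))\<^sup>2) summable_on UNIV" by simp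
qed
lift_definition scaleR_l2 :: "real \<Rightarrow> 'a l2 \<Rightarrow> 'a l2" is "\<lambda>c x k. c *\<^sub>R x k"
  by (simp add: power_mult_distrib summable_on_cmult_right)
instance
  by standard (rule l2_eqI, simp add: zero_l2.rep_eq plus_l2.rep_eq uminus_l2.rep_eq minus_l2.rep_eq
    scaleR_l2.rep_eq algebra_simps)+
end

lemmas seq_zero [simp] = zero_l2.rep_eq
lemmas seq_add [simp] = plus_l2.rep_eq
lemmas seq_uminus [simp] = uminus_l2.rep_eq
lemmas seq_diff [simp] = minus_l2.rep_eq
lemmas seq_scaleR [simp] = scaleR_l2.rep_eq

lemma seq_sum [simp]: "seq (sum f A) k = (\<Sum>i\<in>A. seq (f i) k)"
  by (induction A rule: infinite_finite_induct) auto

lemma inner_seq_summable: "(\<lambda>k. seq x k \<bullet> seq y k) summable_on UNIV"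
proof (rule abs_summable_summable)
  have "norm (seq x k \<bullet> seq y k) \<le> cmod (seq x k) * cmod (seq y k)" for k
    using Cauchy_Schwarz_ineq2[of "seq x k" "seq y k"] by simp
  then show "(\<lambda>k. norm (seq x k \<bullet> seq y k)) summable_on UNIV"
    by (intro summable_on_comparison_test[OF product_summable[OF seq_summable[of x] seq_summable[of y]]]) auto
qed

instantiation l2 :: (type) real_inner
begin
definition inner_l2 :: "'a l2 \<Rightarrow> 'a l2 \<Rightarrow> real" where
  "inner_l2 x y = (\<Sum>\<^sub>\<infinity>k. seq x k \<bullet> seq y k)"
definition norm_l2 :: "'a l2 \<Rightarrow> real" where "norm_l2 x = sqrt (inner x x)"
definition sgn_l2 :: "'a l2 \<Rightarrow> 'a l2" where "sgn_l2 x = x /\<^sub>R norm x"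
definition dist_l2 :: "'a l2 \<Rightarrow> 'a l2 \<Rightarrow> real" where "dist_l2 x y = norm (x - y)"
definition uniformity_l2 :: "('a l2 \<times> 'a l2) filter" where
  "uniformity_l2 = (INF e\<in>{0 <..}. principal {(x, y). dist x y < e})"
definition open_l2 :: "'a l2 set \<Rightarrow> bool" where
  "open_l2 U \<longleftrightarrow> (\<forall>x\<in>U. \<forall>\<^sub>F (x', y) in uniformity. x' = x \<longrightarrow> y \<in> U)"
instance
proof
  fix x y z :: "'a l2" and r :: real
  show "inner x y = inner y x"
    by (simp add: inner_l2_def inner_commute)
  show "inner (x + y) z = inner x z + inner y z"
    by (simp add: inner_l2_def inner_add_left infsum_add inner_seq_summable)
  show "inner (r *\<^sub>R x) y = r * inner x y"
    by (simp add: inner_l2_def infsum_cmult_right')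
  show "0 \<le> inner x x"
    by (simp add: inner_l2_def infsum_nonneg)
  show "inner x x = 0 \<longleftrightarrow> x = 0"
  proof
    assume "inner x x = 0"
    then have "(\<Sum>\<^sub>\<infinity>k. seq x k \<bullet> seq x k) \<le> 0" by (simp add: inner_l2_def)
    then have "seq x k \<bullet> seq x k = 0" for k
      by (rule nonneg_infsum_le_0D) (auto simp: inner_seq_summable)
    then show "x = 0" by (intro l2_eqI) simp
  qed (simp add: inner_l2_def)
qed (simp_all add: sgn_l2_def dist_l2_def uniformity_l2_def open_l2_def norm_l2_def)
end

lemma norm_l2_eq: "norm x = sqrt (\<Sum>\<^sub>\<infinity>k. (cmod (seq x k))\<^sup>2)"
  by (simp add: norm_eq_sqrt_inner inner_l2_def power2_norm_eq_inner)

lemma norm_l2_sq: "(norm x)\<^sup>2 = (\<Sum>\<^sub>\<infinity>k. (cmod (seq x k))\<^sup>2)"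
  by (simp add: norm_l2_eq infsum_nonneg)

lemma sum_le_norm_l2_sq: "finite F \<Longrightarrow> (\<Sum>k\<in>F. (cmod (seq x k))\<^sup>2) \<le> (norm x)\<^sup>2"
  unfolding norm_l2_sq by (rule finite_sum_le_infsum[OF seq_summable]) auto

lemma norm_l2_sq_leI:
  "(\<And>F. finite F \<Longrightarrow> (\<Sum>k\<in>F. (cmod (seq x k))\<^sup>2) \<le> b) \<Longrightarrow> (norm x)\<^sup>2 \<le> b"
  unfolding norm_l2_sq by (rule infsum_le_finite_sums[OF seq_summable]) auto

lemma cmod_seq_le_norm: "cmod (seq x k) \<le> norm x"
  using sum_le_norm_l2_sq[of "{k}" x] by (intro power2_le_imp_le[where x="cmod (seq x k)" and y="norm x", OF _ norm_ge_zero]) auto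

instance l2 :: (type) banach
proof
  fix X :: "nat \<Rightarrow> 'a l2" assume C: "Cauchy X"
  have co: "\<exists>l. (\<lambda>n. seq (X n) k) \<longlonglongrightarrow> l" for k
  proof -
    have "Cauchy (\<lambda>n. seq (X n) k)"
    proof (rule metric_CauchyI)
      fix e :: real assume "0 < e"
      then obtain M where M: "\<And>m n. m \<ge> M \<Longrightarrow> n \<ge> M \<Longrightarrow> dist (X m) (X n) < e"
        using metric_CauchyD[OF C] by metis
      have "dist (seq (X m) k) (seq (X n) k) \<le> dist (X m) (X n)" for m n
        using cmod_seq_le_norm[of "X m - X n" k] by (simp add: dist_norm)
      then show "\<exists>M. \<forall>m\<ge>M. \<forall>n\<ge>M. dist (seq (X m) k) (seq (X n) k) < e"
        using M by (meson order_le_less_trans)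
    qed
    then show ?thesis by (simp add: Cauchy_convergent_iff convergent_def)
  qed
  then obtain l where l: "\<And>k. (\<lambda>n. seq (X n) k) \<longlonglongrightarrow> l k" by metis
  \<comment> \<open>Fatou's lemma for counting measure: bounds on finite index sets pass to the coordinatewise limit.\<close>
  have fat: "(\<Sum>k\<in>F. (cmod (seq (X m) k - l k))\<^sup>2) \<le> e\<^sup>2"
    if "finite F" "0 \<le> e" "\<And>n. n \<ge> N \<Longrightarrow> norm (X m - X n) \<le> e" for F m N e
  proof (rule LIMSEQ_le_const2)
    show "(\<lambda>n. \<Sum>k\<in>F. (cmod (seq (X m) k - seq (X n) k))\<^sup>2) \<longlonglongrightarrow> (\<Sum>k\<in>F. (cmod (seq (X m) k - l k))\<^sup>2)"
      by (intro tendsto_intros l)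
    have "(\<Sum>k\<in>F. (cmod (seq (X m) k - seq (X n) k))\<^sup>2) \<le> e\<^sup>2" if "n \<ge> N" for n
    proof -
      have "(\<Sum>k\<in>F. (cmod (seq (X m) k - seq (X n) k))\<^sup>2) \<le> (norm (X m - X n))\<^sup>2"
        using sum_le_norm_l2_sq[OF \<open>finite F\<close>, of "X m - X n"] by simp
      also have "\<dots> \<le> e\<^sup>2" using that \<open>\<And>n. n \<ge> N \<Longrightarrow> norm (X m - X n) \<le> e\<close> by (intro power_mono) auto
      finally show ?thesis .
    qed
    then show "\<exists>N. \<forall>n\<ge>N. (\<Sum>k\<in>F. (cmod (seq (X m) k - seq (X n) k))\<^sup>2) \<le> e\<^sup>2" by blast
  qed
  obtain M where M: "\<And>m n. m \<ge> M \<Longrightarrow> n \<ge> M \<Longrightarrow> dist (X m) (X n) < 1"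
    using metric_CauchyD[OF C, of 1] by auto
  have sm: "(\<lambda>k. (cmod (seq (X M) k - l k))\<^sup>2) summable_on UNIV"
    by (rule square_summableI[of _ "1\<^sup>2"], rule fat[of _ 1 M M]) (use M in \<open>auto simp: dist_norm less_imp_le\<close>)
  have "(\<lambda>k. (cmod (seq (X M) k + - (seq (X M) k - l k)))\<^sup>2) summable_on UNIV"
    by (rule square_summable_add[OF seq_summable]) (use sm in \<open>simp only: norm_minus_cancel\<close>)
  then have lsum: "(\<lambda>k. (cmod (l k))\<^sup>2) summable_on UNIV" by simp
  have "X \<longlonglongrightarrow> mk l"
  proof (rule metric_LIMSEQ_I)
    fix e :: real assume e: "0 < e"
    then obtain N where N: "\<And>m n. m \<ge> N \<Longrightarrow> n \<ge> N \<Longrightarrow> dist (X m) (X n) < e/2"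
      using metric_CauchyD[OF C, of "e/2"] by (metis half_gt_zero)
    have "norm (X m - mk l) \<le> e/2" if "m \<ge> N" for m
    proof (rule power2_le_imp_le)
      show "(norm (X m - mk l))\<^sup>2 \<le> (e/2)\<^sup>2"
        by (rule norm_l2_sq_leI, simp only: seq_diff seq_mk[OF lsum], rule fat[of _ _ N])
           (use N that e in \<open>auto simp: dist_norm less_imp_le\<close>)
    qed (use e in simp)
    then show "\<exists>N. \<forall>n\<ge>N. dist (X n) (mk l) < e"
      using e by (intro exI[of _ N]) (force simp: dist_norm)
  qed
  then show "convergent X" by (auto simp: convergent_def)
qed

lift_definition restr :: "'a set \<Rightarrow> 'a l2 \<Rightarrow> 'a l2" is "\<lambda>S x k. if k \<in> S then x k else 0"
  by (erule summable_on_comparison_test) auto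

lemmas seq_restr [simp] = restr.rep_eq

lemma restr_add [simp]: "restr S (x + y) = restr S x + restr S y"
  and restr_diff [simp]: "restr S (x - y) = restr S x - restr S y"
  and restr_scaleR [simp]: "restr S (c *\<^sub>R x) = c *\<^sub>R restr S x"
  and restr_zero [simp]: "restr S 0 = 0"
  and restr_restr [simp]: "restr S (restr T x) = restr (S \<inter> T) x"
  and restr_empty [simp]: "restr {} x = 0"
  and restr_UNIV [simp]: "restr UNIV x = x"
  by (rule l2_eqI, auto)+

lemma inner_restr_left: "restr S x \<bullet> y = restr S x \<bullet> restr S y"
  unfolding inner_l2_def by (rule infsum_cong) auto

lemma inner_restr_swap: "restr S x \<bullet> y = x \<bullet> restr S y"
  by (metis inner_restr_left inner_commute)

lemma norm_restr_pythagoras: "(norm x)\<^sup>2 = (norm (restr S x))\<^sup>2 + (norm (x - restr S x))\<^sup>2"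
proof -
  have "restr S x \<bullet> (x - restr S x) = 0"
    by (subst inner_restr_left) simp
  then have "(norm (restr S x + (x - restr S x)))\<^sup>2 = (norm (restr S x))\<^sup>2 + (norm (x - restr S x))\<^sup>2"
    by (simp only: power2_norm_eq_inner inner_add_left inner_add_right inner_commute)
  then show ?thesis by simp
qed

lemma norm_restr_le: "norm (restr S x) \<le> norm x"
  by (rule power2_le_imp_le) (use norm_restr_pythagoras[of x S] in auto)

lemma norm_restr_compl_le: "norm (x - restr S x) \<le> norm x"
  by (rule power2_le_imp_le) (use norm_restr_pythagoras[of x S] in auto)

text \<open>Restriction to an index set is the orthogonal projection onto the vectors supported
  there; it beats every competitor \<open>z\<close> with the same support.\<close>

lemma norm_diff_restr_le:
  assumes "restr S z = z"
  shows "norm (x - restr S x) \<le> norm (x - z)"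
proof -
  have "x - restr S x = (x - z) - restr S (x - z)" using assms by (simp add: algebra_simps)
  then show ?thesis using norm_restr_compl_le by metis
qed

lemma restr_idem_iff: "restr S x = x \<longleftrightarrow> (\<forall>k. k \<notin> S \<longrightarrow> seq x k = 0)"
proof
  assume "restr S x = x"
  then show "\<forall>k. k \<notin> S \<longrightarrow> seq x k = 0" by (metis seq_restr)
qed (auto intro!: l2_eqI)

lemma restr_mono: "restr S x = x \<Longrightarrow> S \<subseteq> S' \<Longrightarrow> restr S' x = x"
  by (auto simp: restr_idem_iff)

text \<open>This is how identities and inequalities pass from finitely supported vectors to the
  whole space.\<close>

lemma restr_finite_tendsto: "((\<lambda>F. restr F x) \<longlongrightarrow> x) (finite_subsets_at_top UNIV)"
proof (rule tendstoI)
  fix e :: real assume e: "0 < e"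
  have "((\<lambda>k. (cmod (seq x k))\<^sup>2) has_sum (norm x)\<^sup>2) UNIV"
    unfolding norm_l2_sq using seq_summable by (rule has_sum_infsum)
  then have "eventually (\<lambda>F. dist (\<Sum>k\<in>F. (cmod (seq x k))\<^sup>2) ((norm x)\<^sup>2) < e\<^sup>2) (finite_subsets_at_top UNIV)"
    unfolding has_sum_def using e by (intro tendstoD) auto
  moreover have "eventually (\<lambda>F::'a set. finite F) (finite_subsets_at_top UNIV)"
    by (simp add: eventually_finite_subsets_at_top_weakI)
  ultimately show "eventually (\<lambda>F. dist (restr F x) x < e) (finite_subsets_at_top UNIV)"
  proof eventually_elim
    case (elim F)
    have "(norm (restr F x))\<^sup>2 = (\<Sum>\<^sub>\<infinity>k. if k \<in> F then (cmod (seq x k))\<^sup>2 else 0)"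
      unfolding norm_l2_sq by (rule infsum_cong) auto
    also have "\<dots> = (\<Sum>\<^sub>\<infinity>k\<in>F. (cmod (seq x k))\<^sup>2)"
      by (rule infsum_cong_neutral) auto
    also have "\<dots> = (\<Sum>k\<in>F. (cmod (seq x k))\<^sup>2)" using elim by simp
    finally have "(norm (x - restr F x))\<^sup>2 < e\<^sup>2"
      using elim norm_restr_pythagoras[of x F] by (simp add: dist_real_def)
    then show ?case using e power_less_imp_less_base[of "norm (x - restr F x)" 2 e]
      by (simp add: dist_norm norm_minus_commute)
  qed
qed

lift_definition single :: "'a \<Rightarrow> complex \<Rightarrow> 'a l2" is "\<lambda>i c k. if k = i then c else 0"
proof -
  fix i :: 'a and c
  show "(\<lambda>k. (cmod (if k = i then c else 0))\<^sup>2) summable_on UNIV"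
    by (rule finite_nonzero_values_imp_summable_on) (rule finite_subset[of _ "{i}"], auto)
qed

lemmas seq_single = single.rep_eq

lemma inner_single: "single i c \<bullet> x = c \<bullet> seq x i"
proof -
  have "single i c \<bullet> x = (\<Sum>\<^sub>\<infinity>k\<in>{i}. c \<bullet> seq x i)"
    unfolding inner_l2_def by (rule infsum_cong_neutral) (auto simp: seq_single)
  then show ?thesis by simp
qed

lemma norm_single: "norm (single i c) = cmod c"
  by (simp add: norm_eq_sqrt_inner inner_single seq_single)

lemma restr_finite_eq_sum: "finite F \<Longrightarrow> restr F x = (\<Sum>k\<in>F. single k (seq x k))"
  by (rule l2_eqI) (simp add: seq_single sum.delta)

section \<open>Galerkin approximation for coercive operators\<close>

text \<open>In weighted Fourier coordinates the stiffness matrix is such an operator, and \<open>\<alpha>\<close> and \<open>M\<close> are the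
  bounds of the coefficients.\<close>

locale coercive_operator =
  fixes T :: "'a l2 \<Rightarrow> 'a l2" and \<alpha> M :: real
  assumes linear_T: "linear T"
    and symmetric: "T x \<bullet> y = x \<bullet> T y"
    and bounded: "norm (T x) \<le> M * norm x"
    and coercive: "\<alpha> * (norm x)\<^sup>2 \<le> T x \<bullet> x"
    and alpha_pos: "0 < \<alpha>"
begin

lemma T_add [simp]: "T (x + y) = T x + T y"
  and T_diff [simp]: "T (x - y) = T x - T y"
  and T_scaleR [simp]: "T (c *\<^sub>R x) = c *\<^sub>R T x"
  and T_zero [simp]: "T 0 = 0"
  using linear_T by (simp_all add: linear_add linear_diff linear_scale linear_0)

lemma alpha_le_M: "\<alpha> \<le> M"
proof -
  define e :: "'a l2" where "e = single undefined 1"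
  have e: "norm e = 1" by (simp add: e_def norm_single)
  have "\<alpha> \<le> T e \<bullet> e" using coercive[of e] e by simp
  also have "\<dots> \<le> norm (T e) * norm e" by (rule norm_cauchy_schwarz)
  also have "\<dots> \<le> M" using bounded[of e] e by simp
  finally show ?thesis .
qed

lemma M_pos: "0 < M" using alpha_pos alpha_le_M by linarith

lemma energy_nonneg: "0 \<le> T x \<bullet> x"
  using coercive[of x] alpha_pos by (smt (verit) mult_nonneg_nonneg zero_le_power2)

text \<open>The squared norm of \<open>x - s *\<^sub>R T x\<close> is at most \<open>1 - 2 * s *
  \<alpha> + s^2 * M^2\<close> times that of \<open>x\<close>. The damping parameter
  \<open>step\<close> minimizes this factor, and \<open>rate\<close> is the square root of its
  minimum.\<close>

definition step :: real where "step = \<alpha> / M\<^sup>2"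
definition rate :: real where "rate = sqrt (1 - \<alpha>\<^sup>2 / M\<^sup>2)"

lemma step_pos: "0 < step" using alpha_pos M_pos by (simp add: step_def)

lemma rate_nonneg: "0 \<le> rate"
  using alpha_le_M alpha_pos M_pos by (auto simp: rate_def power_mono)

lemma rate_less_1: "rate < 1"
  using alpha_pos M_pos by (simp add: rate_def real_less_lsqrt)

lemma richardson_contraction: "norm (x - step *\<^sub>R T x) \<le> rate * norm x"
proof (rule power2_le_imp_le)
  have "(norm (x - step *\<^sub>R T x))\<^sup>2 = (norm x)\<^sup>2 - 2 * step * (T x \<bullet> x) + step\<^sup>2 * (norm (T x))\<^sup>2"
    by (simp add: power2_norm_eq_inner inner_diff_left inner_diff_right inner_commute[of x "T x"])
       (simp add: power2_eq_square algebra_simps)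
  also have "\<dots> \<le> (norm x)\<^sup>2 - 2 * step * (\<alpha> * (norm x)\<^sup>2) + step\<^sup>2 * (M * norm x)\<^sup>2"
  proof -
    have "2 * step * (\<alpha> * (norm x)\<^sup>2) \<le> 2 * step * (T x \<bullet> x)"
      using step_pos by (intro mult_left_mono coercive) auto
    moreover have "step\<^sup>2 * (norm (T x))\<^sup>2 \<le> step\<^sup>2 * (M * norm x)\<^sup>2"
      by (intro mult_left_mono power_mono bounded) auto
    ultimately show ?thesis by linarith
  qed
  also have "\<dots> = (1 - \<alpha>\<^sup>2 / M\<^sup>2) * (norm x)\<^sup>2"
    using M_pos by (simp add: step_def field_simps power2_eq_square)
  also have "\<dots> = (rate * norm x)\<^sup>2"
    using alpha_le_M alpha_pos M_pos by (simp add: rate_def power_mult_distrib power_mono)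
  finally show "(norm (x - step *\<^sub>R T x))\<^sup>2 \<le> (rate * norm x)\<^sup>2" .
qed (simp add: rate_nonneg)

text \<open>The Lax-Milgram lemma by Banach's fixed point theorem: solutions are the fixed points of
  the projected Richardson map. For finite \<open>S\<close> this is the Galerkin problem, and
  \<open>S = UNIV\<close> shows that the operator is invertible.\<close>

lemma galerkin_ex1: "\<exists>!x. restr S x = x \<and> restr S (T x) = restr S y"
proof -
  define \<Phi> where "\<Phi> x = restr S (x - step *\<^sub>R (T x - y))" for x
  have diff: "\<Phi> x - \<Phi> x' = restr S ((x - x') - step *\<^sub>R T (x - x'))" for x x'
    by (simp add: \<Phi>_def algebra_simps)
  have fix_iff: "\<Phi> x = x \<longleftrightarrow> restr S x = x \<and> restr S (T x) = restr S y" for x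
  proof
    assume f: "\<Phi> x = x"
    have "restr S (\<Phi> x) = \<Phi> x" unfolding \<Phi>_def restr_restr by simp
    with f have r: "restr S x = x" by simp
    with f have "step *\<^sub>R (restr S (T x) - restr S y) = 0" unfolding \<Phi>_def by simp
    then show "restr S x = x \<and> restr S (T x) = restr S y" using r step_pos by simp
  qed (simp add: \<Phi>_def)
  have "dist (\<Phi> x) (\<Phi> x') \<le> rate * dist x x'" for x x'
    using order_trans[OF norm_restr_le richardson_contraction, of S "x - x'"]
    by (simp only: dist_norm diff)
  then have "\<exists>!x. \<Phi> x = x"
    by (intro banach_fix_type[OF rate_nonneg rate_less_1]) blast
  then show ?thesis by (simp add: fix_iff)
qed

definition gal :: "'a set \<Rightarrow> 'a l2 \<Rightarrow> 'a l2" where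
  "gal S y = (THE x. restr S x = x \<and> restr S (T x) = restr S y)"

lemma restr_gal: "restr S (gal S y) = gal S y"
  and restr_T_gal: "restr S (T (gal S y)) = restr S y"
  using theI'[OF galerkin_ex1[of S y]] by (simp_all add: gal_def)

lemma gal_unique: "restr S x = x \<Longrightarrow> restr S (T x) = restr S y \<Longrightarrow> gal S y = x"
  using galerkin_ex1[of S y] restr_gal[of S y] restr_T_gal[of S y] by blast

lemma T_gal_UNIV: "T (gal UNIV y) = y"
  using restr_T_gal[of UNIV y] by simp

lemma gal_UNIV_T: "gal UNIV (T x) = x"
  by (rule gal_unique) auto

lemma gal_diff: "gal S (x - y) = gal S x - gal S y"
  by (rule gal_unique) (simp_all add: restr_gal restr_T_gal)

lemma galerkin_orthogonal:
  assumes "restr S z = z"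
  shows "T (u - gal S (T u)) \<bullet> z = 0"
proof -
  have "T (u - gal S (T u)) \<bullet> z = T (u - gal S (T u)) \<bullet> restr S z" using assms by simp
  also have "\<dots> = restr S (T (u - gal S (T u))) \<bullet> z" by (rule inner_restr_swap[symmetric])
  also have "\<dots> = 0" by (simp add: restr_T_gal)
  finally show ?thesis .
qed

lemma energy_cauchy_schwarz: "T x \<bullet> y \<le> sqrt (T x \<bullet> x) * sqrt (T y \<bullet> y)"
proof (cases "T y \<bullet> y = 0")
  case True
  then have "y = 0" using coercive[of y] alpha_pos by (simp add: mult_le_0_iff)
  then show ?thesis by simp
next
  case False
  then have b: "0 < T y \<bullet> y" using energy_nonneg[of y] by simp
  define s where "s = (T x \<bullet> y) / (T y \<bullet> y)"
  have "0 \<le> T (x - s *\<^sub>R y) \<bullet> (x - s *\<^sub>R y)" by (rule energy_nonneg)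
  also have "\<dots> = T x \<bullet> x - 2 * s * (T x \<bullet> y) + s\<^sup>2 * (T y \<bullet> y)"
    using symmetric[of y x] by (simp add: inner_diff_left inner_diff_right inner_commute power2_eq_square algebra_simps)
  also have "\<dots> = T x \<bullet> x - (T x \<bullet> y)\<^sup>2 / (T y \<bullet> y)"
    using b by (simp add: s_def field_simps power2_eq_square)
  finally have "(T x \<bullet> y)\<^sup>2 \<le> (T x \<bullet> x) * (T y \<bullet> y)"
    using b by (simp add: field_simps)
  then have "T x \<bullet> y \<le> sqrt ((T x \<bullet> x) * (T y \<bullet> y))" by (rule real_le_rsqrt)
  then show ?thesis by (simp add: real_sqrt_mult)
qed

lemma norm_le_energy: "norm x \<le> sqrt (T x \<bullet> x) / sqrt \<alpha>"
proof -
  have "sqrt (\<alpha> * (norm x)\<^sup>2) \<le> sqrt (T x \<bullet> x)" using coercive by (rule real_sqrt_le_mono)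
  then show ?thesis using alpha_pos by (simp add: real_sqrt_mult field_simps)
qed

lemma energy_le_norm: "sqrt (T x \<bullet> x) \<le> sqrt M * norm x"
proof -
  have "T x \<bullet> x \<le> norm (T x) * norm x" by (rule norm_cauchy_schwarz)
  also have "\<dots> \<le> M * (norm x)\<^sup>2"
    using mult_right_mono[OF bounded[of x], of "norm x"] by (simp add: power2_eq_square mult.assoc)
  finally have "sqrt (T x \<bullet> x) \<le> sqrt (M * (norm x)\<^sup>2)" by (rule real_sqrt_le_mono)
  then show ?thesis by (simp add: real_sqrt_mult)
qed

lemma norm_le_norm_T: "\<alpha> * norm x \<le> norm (T x)"
proof (cases "x = 0")
  case False
  have "\<alpha> * (norm x)\<^sup>2 \<le> norm (T x) * norm x"
    using coercive[of x] norm_cauchy_schwarz[of "T x" x] by linarith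
  then show ?thesis using False by (simp add: power2_eq_square)
qed simp

text \<open>By Galerkin orthogonality the squared energy of the error \<open>e\<close> equals
  \<open>T e \<bullet> (p + q)\<close>. By symmetry the first part is \<open>e \<bullet> T
  p\<close>, so only the residual \<open>T p\<close> is needed; the second part is estimated by the
  Cauchy-Schwarz inequality in the energy. For the predictor, \<open>p\<close> comes from the
  unmarked part of the residual and \<open>q\<close> from the truncation of the inverse.\<close>

lemma galerkin_error_split:
  assumes z: "restr S z = z" and split: "u - z = p + q"
  shows "norm (u - gal S (T u)) \<le> norm (T p) / \<alpha> + sqrt (M / \<alpha>) * norm q"
proof -
  define e where "e = u - gal S (T u)"
  define E where "E = sqrt (T e \<bullet> e)"
  have E0: "0 \<le> E" and E2: "E\<^sup>2 = T e \<bullet> e" by (simp_all add: E_def energy_nonneg)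
  have sa: "0 < sqrt \<alpha>" using alpha_pos by simp
  have "T e \<bullet> e = T e \<bullet> u" using galerkin_orthogonal[OF restr_gal, of u S]
    by (simp add: e_def inner_diff_right)
  also have "\<dots> = T e \<bullet> (u - z)" using galerkin_orthogonal[OF z, of u] by (simp add: e_def inner_diff_right)
  also have "\<dots> = e \<bullet> T p + T e \<bullet> q" by (simp add: split inner_add_right symmetric)
  also have "\<dots> \<le> norm e * norm (T p) + E * sqrt (T q \<bullet> q)"
    unfolding E_def by (intro add_mono norm_cauchy_schwarz energy_cauchy_schwarz)
  also have "\<dots> \<le> (E / sqrt \<alpha>) * norm (T p) + E * (sqrt M * norm q)"
    using norm_le_energy[of e] E0 unfolding E_def
    by (intro add_mono mult_right_mono mult_left_mono energy_le_norm) auto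
  finally have "E * E \<le> E * (norm (T p) / sqrt \<alpha> + sqrt M * norm q)"
    using E2 by (simp add: power2_eq_square algebra_simps)
  then have "E \<le> norm (T p) / sqrt \<alpha> + sqrt M * norm q"
    using E0 M_pos alpha_pos by (cases "E = 0") auto
  then have "E / sqrt \<alpha> \<le> (norm (T p) / sqrt \<alpha> + sqrt M * norm q) / sqrt \<alpha>"
    using sa by (intro divide_right_mono) auto
  also have "\<dots> = norm (T p) / \<alpha> + sqrt (M / \<alpha>) * norm q"
    using alpha_pos by (simp add: add_divide_distrib real_sqrt_divide)
  finally show ?thesis using norm_le_energy[of e] by (simp add: E_def e_def)
qed

corollary galerkin_quasi_optimal:
  assumes "restr S z = z"
  shows "norm (u - gal S (T u)) \<le> sqrt (M / \<alpha>) * norm (u - z)"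
  using galerkin_error_split[OF assms, of u 0 "u - z"] by simp

corollary galerkin_stable: "norm (u - gal S (T u)) \<le> sqrt (M / \<alpha>) * norm u"
  using galerkin_quasi_optimal[of S 0 u] by simp

end

text \<open>With \<open>c = sqrt (1 - \<theta>^2)\<close>, the sum \<open>sqrt (1 - s^2) + s *
  c\<close> stays below \<open>2 * c\<close> on \<open>\<theta> \<le> s \<le> 1\<close>, since its
  first summand reaches \<open>c\<close> only at \<open>s = \<theta>\<close> and the second only at
  \<open>s = 1\<close>. The gap is quantified by splitting at \<open>s = (1 + \<theta>) / 2\<close>:
  to the left the second summand is small, to the right the first.\<close>

definition marking_gap :: "real \<Rightarrow> real" where
  "marking_gap \<theta> = Min {(1 - \<theta>) / 2, 1 - sqrt (1 - ((1 + \<theta>) / 2)\<^sup>2) / sqrt (1 - \<theta>\<^sup>2)}"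

lemma marking_gap:
  assumes \<theta>: "0 < \<theta>" "\<theta> < 1"
  shows "0 < marking_gap \<theta>"
    and "\<theta> \<le> s \<Longrightarrow> s \<le> 1 \<Longrightarrow>
      sqrt (1 - s\<^sup>2) + s * sqrt (1 - \<theta>\<^sup>2) \<le> (2 - marking_gap \<theta>) * sqrt (1 - \<theta>\<^sup>2)"
proof -
  define c where "c = sqrt (1 - \<theta>\<^sup>2)"
  define m where "m = (1 + \<theta>) / 2"
  have t2: "\<theta>\<^sup>2 < 1" using \<theta> by (simp add: power_less_one_iff)
  have c: "0 < c" using t2 by (simp add: c_def)
  have "\<theta>\<^sup>2 < m\<^sup>2" using \<theta> by (intro power_strict_mono) (auto simp: m_def)
  then have mc: "sqrt (1 - m\<^sup>2) < c" by (simp add: c_def)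
  have g: "marking_gap \<theta> = min ((1 - \<theta>) / 2) (1 - sqrt (1 - m\<^sup>2) / c)"
    by (simp add: marking_gap_def m_def c_def)
  show "0 < marking_gap \<theta>" using \<theta> mc c by (simp add: g)
  have g1: "marking_gap \<theta> * c \<le> (1 - \<theta>) / 2 * c"
    unfolding g by (rule mult_right_mono[OF min.cobounded1 less_imp_le[OF c]])
  have g2: "marking_gap \<theta> * c \<le> (1 - sqrt (1 - m\<^sup>2) / c) * c"
    unfolding g by (rule mult_right_mono[OF min.cobounded2 less_imp_le[OF c]])
  assume s: "\<theta> \<le> s" "s \<le> 1"
  have "sqrt (1 - s\<^sup>2) + s * c \<le> (2 - marking_gap \<theta>) * c"
  proof (cases "s \<le> m")
    case True
    have "sqrt (1 - s\<^sup>2) \<le> c" using s \<theta> unfolding c_def by (simp add: power_mono)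
    moreover have "s * c \<le> m * c" using True c by (intro mult_right_mono) auto
    ultimately show ?thesis using g1 by (simp add: m_def field_simps)
  next
    case False
    have "sqrt (1 - s\<^sup>2) \<le> sqrt (1 - m\<^sup>2)" using False \<theta> by (simp add: power_mono m_def)
    moreover have "s * c \<le> 1 * c" using s c by (intro mult_right_mono) auto
    moreover have "marking_gap \<theta> * c \<le> c - sqrt (1 - m\<^sup>2)" using g2 c by (simp add: left_diff_distrib)
    ultimately show ?thesis by (simp only: left_diff_distrib)
  qed
  then show "sqrt (1 - s\<^sup>2) + s * sqrt (1 - \<theta>\<^sup>2) \<le> (2 - marking_gap \<theta>) * sqrt (1 - \<theta>\<^sup>2)"
    by (simp add: c_def)
qed

context coercive_operator
begin

text \<open>Here \<open>x\<close> is the current Galerkin solution and \<open>D\<close> the marked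
  set. The competitor is \<open>x + b\<close>, where \<open>b\<close> approximates the inverse of
  the operator applied to the marked part of the residual \<open>r\<close>. Since the inverse
  applied to \<open>r\<close> is \<open>u - x\<close>, the error of the competitor splits into the
  contribution of the unmarked part of \<open>r\<close> and the truncation error. The threshold for
  \<open>\<psi>\<close> is chosen such that the latter, multiplied by \<open>sqrt (M /
  \<alpha>)\<close>, is at most \<open>sqrt (1 - \<theta>^2) / \<alpha>\<close> times the norm of
  the marked part.\<close>

lemma predictor_error:
  assumes \<theta>: "0 < \<theta>" "\<theta> < 1"
    and r: "r = T (u - x)" and x: "restr S x = x" and D: "D \<subseteq> S"
    and marked: "\<theta> * norm r \<le> norm (restr D r)"
    and approx: "restr S b = b"
      "norm (gal UNIV (restr D r) - b) \<le> \<psi> * norm (restr D r)"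
    and psi: "\<psi> \<le> sqrt ((1 - \<theta>\<^sup>2) / (\<alpha> * M))"
  shows "norm (u - gal S (T u)) \<le> (2 - marking_gap \<theta>) * (1 / \<alpha> * sqrt (1 - \<theta>\<^sup>2) * norm r)"
proof (cases "r = 0")
  case True
  then have "\<alpha> * norm (u - x) \<le> 0" using norm_le_norm_T[of "u - x"] r by simp
  then have "u = x" using alpha_pos by (simp add: mult_le_0_iff)
  then have "gal S (T u) = u" using x by (intro gal_unique) auto
  then show ?thesis using True by simp
next
  case False
  define p where "p = gal UNIV (r - restr D r)"
  define q where "q = gal UNIV (restr D r) - b"
  define s where "s = norm (restr D r) / norm r"
  define c where "c = sqrt (1 - \<theta>\<^sup>2)"
  have nr: "0 < norm r" using False by simp
  have s: "\<theta> \<le> s" "s \<le> 1"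
    using marked norm_restr_le[of D r] nr by (simp_all add: s_def field_simps)
  have sr: "norm (restr D r) = s * norm r" using nr by (simp add: s_def)
  have "gal UNIV r = u - x" unfolding r by (rule gal_UNIV_T)
  then have "u - (x + b) = p + q" by (simp add: p_def q_def gal_diff)
  moreover have "restr S (x + b) = x + b" using x approx by simp
  ultimately have "norm (u - gal S (T u)) \<le> norm (T p) / \<alpha> + sqrt (M / \<alpha>) * norm q"
    by (intro galerkin_error_split)
  also have "norm (T p) = sqrt (1 - s\<^sup>2) * norm r"
  proof -
    have "(norm (T p))\<^sup>2 = (1 - s\<^sup>2) * (norm r)\<^sup>2"
      using norm_restr_pythagoras[of r D] by (simp add: p_def T_gal_UNIV sr power_mult_distrib algebra_simps)
    then have "norm (T p) = sqrt ((1 - s\<^sup>2) * (norm r)\<^sup>2)" by (metis norm_ge_zero real_sqrt_unique)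
    then show ?thesis by (simp add: real_sqrt_mult)
  qed
  also have "norm q \<le> c / sqrt (\<alpha> * M) * (s * norm r)"
  proof -
    have "norm q \<le> \<psi> * (s * norm r)" using approx sr by (simp add: q_def)
    also have "\<dots> \<le> sqrt ((1 - \<theta>\<^sup>2) / (\<alpha> * M)) * (s * norm r)"
      using psi s \<theta> by (intro mult_right_mono) auto
    finally show ?thesis by (simp add: c_def real_sqrt_divide)
  qed
  also have "sqrt (M / \<alpha>) * (c / sqrt (\<alpha> * M) * (s * norm r)) = s * c * norm r / \<alpha>"
    using alpha_pos M_pos by (simp add: real_sqrt_divide real_sqrt_mult field_simps)
  finally have "norm (u - gal S (T u)) \<le> (sqrt (1 - s\<^sup>2) + s * c) * norm r / \<alpha>"
    using alpha_pos M_pos by (simp add: algebra_simps add_divide_distrib mult_left_mono)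
  also have "\<dots> \<le> ((2 - marking_gap \<theta>) * c) * norm r / \<alpha>"
    unfolding c_def using alpha_pos
    by (intro divide_right_mono mult_right_mono marking_gap \<theta> s) auto
  finally show ?thesis by (simp add: c_def)
qed

text \<open>The predictor error uses up \<open>(2 - g) * \<epsilon>\<close> of the coarsening
  tolerance; the rest suffices for any \<open>Z\<close> that approximates \<open>u\<close> up to
  \<open>g * \<epsilon>\<close>. Intersecting \<open>Z\<close> with \<open>S\<close> changes nothing
  because \<open>w\<close> is supported in \<open>S\<close>.\<close>

lemma corrector_card:
  assumes err: "norm (u - w) \<le> (2 - g) * \<epsilon>" and w: "restr S w = w"
    and minimal: "\<And>T'. T' \<subseteq> S \<Longrightarrow> norm (w - restr T' w) \<le> 2 * \<epsilon> \<Longrightarrow> card K \<le> card T'"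
    and Z: "finite Z" "norm (u - restr Z u) \<le> g * \<epsilon>"
  shows "card K \<le> card Z"
proof -
  have "restr (S \<inter> Z) w = restr Z w" using w by (metis restr_restr inf_commute)
  then have "w - restr (S \<inter> Z) w = (u - restr Z u) - ((u - w) - restr Z (u - w))"
    by (simp add: algebra_simps)
  then have "norm (w - restr (S \<inter> Z) w) \<le> norm (u - restr Z u) + norm ((u - w) - restr Z (u - w))"
    by (metis norm_triangle_ineq4)
  also have "\<dots> \<le> g * \<epsilon> + (2 - g) * \<epsilon>"
    using Z err norm_restr_compl_le[of "u - w" Z] by linarith
  finally have "card K \<le> card (S \<inter> Z)"
    by (intro minimal) (auto simp: algebra_simps)
  also have "\<dots> \<le> card Z" using Z by (intro card_mono) auto
  finally show ?thesis .
qed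

text \<open>The coarsened predictor is an admissible competitor, and Galerkin solutions are
  quasi-optimal.\<close>

lemma corrector_error:
  assumes err: "norm (u - w) \<le> (2 - g) * \<epsilon>" and g: "0 \<le> g" "0 \<le> \<epsilon>"
    and K: "norm (w - restr K w) \<le> 2 * \<epsilon>"
  shows "norm (u - gal K (T u)) \<le> 4 * sqrt (M / \<alpha>) * \<epsilon>"
proof -
  have "norm (u - restr K w) \<le> norm (u - w) + norm (w - restr K w)"
    using norm_triangle_ineq[of "u - w" "w - restr K w"] by simp
  also have "\<dots> \<le> (2 - g) * \<epsilon> + 2 * \<epsilon>" using err K by linarith
  also have "\<dots> \<le> 4 * \<epsilon>" using g by (simp add: algebra_simps)
  finally have "sqrt (M / \<alpha>) * norm (u - restr K w) \<le> sqrt (M / \<alpha>) * (4 * \<epsilon>)"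
    using alpha_pos M_pos by (intro mult_left_mono) auto
  then show ?thesis using galerkin_quasi_optimal[of K "restr K w" u] by simp
qed

end

section \<open>Best approximation errors and cardinalities\<close>

text \<open>Best errors of functions and of forms are both of this shape in weighted coordinates.\<close>

definition best_l2_err :: "nat \<Rightarrow> 'a l2 \<Rightarrow> real" where
  "best_l2_err N x = (INF S\<in>{S. finite S \<and> card S = N}. norm (x - restr S x))"

lemma bdd_below_best_l2_err: "bdd_below ((\<lambda>S. norm (x - restr S x)) ` {S. finite S \<and> card S = N})"
  by (rule bdd_belowI2[where m=0]) auto

lemma best_l2_err_le: "finite S \<Longrightarrow> card S = N \<Longrightarrow> best_l2_err N x \<le> norm (x - restr S x)"
  unfolding best_l2_err_def by (rule cINF_lower[OF bdd_below_best_l2_err]) auto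

lemma best_l2_err_0: "best_l2_err 0 x = norm x"
proof -
  have "{S. finite S \<and> card S = 0} = {{} :: 'a set}" by auto
  then show ?thesis by (simp add: best_l2_err_def)
qed

lemma card_sets_nonempty: "infinite (UNIV :: 'a set) \<Longrightarrow> {S :: 'a set. finite S \<and> card S = N} \<noteq> {}"
  using infinite_arbitrarily_large[of UNIV N] by auto

lemma best_l2_err_less_obtain:
  fixes x :: "'a l2"
  assumes "infinite (UNIV :: 'a set)" "best_l2_err N x < b"
  obtains S where "finite S" "card S = N" "norm (x - restr S x) < b"
  using assms cINF_less_iff[OF card_sets_nonempty bdd_below_best_l2_err] unfolding best_l2_err_def
  by blast

lemma best_l2_err_nonneg: "infinite (UNIV :: 'a set) \<Longrightarrow> 0 \<le> best_l2_err N (x :: 'a l2)"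
  unfolding best_l2_err_def by (rule cINF_greatest[OF card_sets_nonempty]) auto

text \<open>The best error with exactly \<open>N\<close> indices is also a lower bound for
  approximations with fewer indices: the support may be filled up, since the index set is
  infinite.\<close>

lemma best_l2_err_le_supp:
  fixes x :: "'a l2"
  assumes inf: "infinite (UNIV :: 'a set)" and S: "finite S" "card S \<le> N" "restr S z = z"
  shows "best_l2_err N x \<le> norm (x - z)"
proof -
  obtain B where B: "finite B" "card B = N - card S" "B \<subseteq> - S"
    using infinite_arbitrarily_large[of "- S" "N - card S"] inf S
    by (metis finite_compl)
  have "card (S \<union> B) = N" using B S by (subst card_Un_disjoint) auto
  then have "best_l2_err N x \<le> norm (x - restr (S \<union> B) x)" using S B by (intro best_l2_err_le) auto
  also have "\<dots> \<le> norm (x - z)"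
    by (rule norm_diff_restr_le[OF restr_mono[OF S(3)]]) simp
  finally show ?thesis .
qed

text \<open>If \<open>W < \<delta>\<close>, no index is needed. Otherwise take the least integer
  above the solution \<open>X\<close> of \<open>W * exp (- b * X powr s) = \<delta>\<close>.\<close>

lemma exists_small_error_index:
  fixes E :: "nat \<Rightarrow> real"
  assumes E: "\<And>N. E N * exp (b * real N powr s) \<le> W" and b: "0 < b" and s: "0 < s" and d: "0 < \<delta>"
  shows "\<exists>N. E N < \<delta> \<and> (N = 0 \<or> \<delta> \<le> W \<and> real N \<le> 1 + (ln (W / \<delta>) / b) powr (1 / s))"
proof (cases "W < \<delta>")
  case True
  then show ?thesis using E[of 0] by (intro exI[of _ 0]) auto
next
  case False
  define X where "X = (ln (W / \<delta>) / b) powr (1 / s)"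
  have L: "0 \<le> ln (W / \<delta>)" and W: "0 < W" using False d by auto
  define N where "N = nat \<lfloor>X\<rfloor> + 1"
  have X0: "0 \<le> X" by (simp add: X_def)
  have NX: "X < real N" "real N \<le> 1 + X" using X0 unfolding N_def by linarith+
  have "ln (W / \<delta>) / b = X powr s" using L b s by (simp add: X_def powr_powr)
  also have "\<dots> < real N powr s" using NX X0 s by (intro powr_less_mono2) auto
  finally have "ln (W / \<delta>) < b * real N powr s" using b by (simp add: field_simps)
  then have "W / \<delta> < exp (b * real N powr s)"
    using W d exp_ln[of "W / \<delta>"] by (metis exp_less_cancel_iff divide_pos_pos)
  then have "W < \<delta> * exp (b * real N powr s)" using d by (simp add: field_simps)
  then have "E N * exp (b * real N powr s) < \<delta> * exp (b * real N powr s)" using E[of N] by linarith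
  then have "E N < \<delta>" by simp
  then show ?thesis using False NX by (intro exI[of _ N]) (auto simp: X_def)
qed

text \<open>Bound one factor of each power by the corresponding power of \<open>x +
  y\<close>.\<close>

lemma powr_superadditive:
  fixes x y p :: real
  assumes "0 \<le> x" "0 \<le> y" "1 \<le> p"
  shows "x powr p + y powr p \<le> (x + y) powr p"
proof (cases "x + y = 0")
  case True
  then have "x = 0" "y = 0" using assms by auto
  then show ?thesis using assms by simp
next
  case False
  then have p: "0 < x + y" using assms by simp
  have *: "z powr p \<le> z * (x + y) powr (p - 1)" if "0 \<le> z" "z \<le> x + y" for z
  proof (cases "z = 0")
    case False
    then have "z powr p = z * z powr (p - 1)"
      using that by (simp add: powr_mult_base)
    also have "\<dots> \<le> z * (x + y) powr (p - 1)"
      using that assms by (intro mult_left_mono powr_mono2) auto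
    finally show ?thesis .
  qed simp
  have "x powr p + y powr p \<le> (x + y) * (x + y) powr (p - 1)"
    using *[of x] *[of y] assms by (simp add: algebra_simps)
  also have "\<dots> = (x + y) powr p" using p by (simp add: powr_mult_base)
  finally show ?thesis .
qed

text \<open>The rounding term \<open>1\<close> and the constant \<open>D\<close> disappear in
  \<open>ln C\<close>, which is at least \<open>ln D + b\<close>: the first summand pays for
  replacing \<open>\<delta>\<close> by the actual error \<open>e\<close>, and the second raises the
  base by \<open>1\<close>, hence by superadditivity the power by at least \<open>1\<close>. The
  sign of the base is recorded since real powers of negative numbers do not have the homogeneity
  that is used later.\<close>

lemma absorb_additive_terms:
  assumes b: "0 < b" and s: "0 < s" "s \<le> 1" and D: "1 \<le> D" and e: "0 < e" "e \<le> D * \<delta>"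
    and m: "m = 0 \<or> \<delta> \<le> W \<and> real m \<le> 1 + (ln (W / \<delta>) / b) powr (1 / s)"
    and C: "D * exp b \<le> C"
  shows "m = 0 \<or> 0 \<le> ln (W / e) + ln C \<and> real m \<le> ((ln (W / e) + ln C) / b) powr (1 / s)"
proof (cases "m = 0")
  case False
  then have m': "\<delta> \<le> W" "real m \<le> 1 + (ln (W / \<delta>) / b) powr (1 / s)" using m by auto
  have d: "0 < \<delta>" using D e by (smt (verit) zero_less_mult_iff)
  have W: "0 < W" using d m' by linarith
  have L: "0 \<le> ln (W / \<delta>)" using m' d by simp
  have "ln e \<le> ln (D * \<delta>)" using e D d by simp
  then have "ln e \<le> ln D + ln \<delta>" using D d by (simp add: ln_mult)
  moreover have "ln (D * exp b) \<le> ln C" using C D by (intro ln_mono) auto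
  then have "ln D + b \<le> ln C" using D by (simp add: ln_mult)
  ultimately have "ln (W / \<delta>) + b \<le> ln (W / e) + ln C" using W d e by (simp add: ln_div)
  then have le: "ln (W / \<delta>) / b + 1 \<le> (ln (W / e) + ln C) / b"
    using b divide_right_mono[of "ln (W / \<delta>) + b" "ln (W / e) + ln C" b] by (simp add: add_divide_distrib)
  have "real m \<le> (ln (W / \<delta>) / b) powr (1 / s) + 1 powr (1 / s)" using m' by simp
  also have "\<dots> \<le> (ln (W / \<delta>) / b + 1) powr (1 / s)"
    using L b s by (intro powr_superadditive) auto
  also have "\<dots> \<le> ((ln (W / e) + ln C) / b) powr (1 / s)"
    using le L b s by (intro powr_mono2) auto
  finally have "real m \<le> ((ln (W / e) + ln C) / b) powr (1 / s)" .
  moreover have "0 \<le> ln (W / e) + ln C" using \<open>ln (W / \<delta>) + b \<le> ln (W / e) + ln C\<close> L b by linarith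
  ultimately show ?thesis by blast
qed simp

text \<open>The vectors \<open>single k c\<close> span a dense subspace.\<close>

lemma l2_bounded_linear_eqI:
  fixes f g :: "'a l2 \<Rightarrow> 'b::real_normed_vector"
  assumes f: "bounded_linear f" and g: "bounded_linear g"
    and eq: "\<And>k c. f (single k c) = g (single k c)"
  shows "f x = g x"
proof -
  have fin: "f (restr F x) = g (restr F x)" if "finite F" for F
    unfolding restr_finite_eq_sum[OF that] linear_sum[OF bounded_linear.linear[OF f]]
      linear_sum[OF bounded_linear.linear[OF g]] eq ..
  have "((\<lambda>F. f (restr F x)) \<longlongrightarrow> f x) (finite_subsets_at_top UNIV)"
    by (rule bounded_linear.tendsto[OF f restr_finite_tendsto])
  moreover have "((\<lambda>F. g (restr F x)) \<longlongrightarrow> g x) (finite_subsets_at_top UNIV)"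
    by (rule bounded_linear.tendsto[OF g restr_finite_tendsto])
  then have "((\<lambda>F. f (restr F x)) \<longlongrightarrow> g x) (finite_subsets_at_top UNIV)"
    by (rule Lim_transform_eventually)
       (auto simp: fin intro!: eventually_finite_subsets_at_top_weakI)
  ultimately show ?thesis
    by (rule tendsto_unique[OF finite_subsets_at_top_neq_bot])
qed

text \<open>The inner product sees only real parts; imaginary parts are recovered by multiplying
  with \<open>- \<i>\<close>.\<close>

lift_definition cscale :: "complex \<Rightarrow> 'a l2 \<Rightarrow> 'a l2" is "\<lambda>c x k. c * x k"
  by (simp add: norm_mult power_mult_distrib summable_on_cmult_right)

lemmas seq_cscale [simp] = cscale.rep_eq

section \<open>Matrices with bounded sesquilinear form\<close>

text \<open>Integrals and row sums are naturally estimated by an arithmetic mean of squares. By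
  homogeneity such a bound is equivalent to one by the product of the norms.\<close>

definition form_bounded :: "real \<Rightarrow> ('a \<Rightarrow> 'a \<Rightarrow> complex) \<Rightarrow> bool" where
  "form_bounded K M \<longleftrightarrow> 0 \<le> K \<and> (\<forall>F G x y. finite F \<longrightarrow> finite G \<longrightarrow>
     cmod (\<Sum>l\<in>F. \<Sum>k\<in>G. cnj (y l) * M l k * x k)
       \<le> K * ((\<Sum>l\<in>F. (cmod (y l))\<^sup>2) + (\<Sum>k\<in>G. (cmod (x k))\<^sup>2)) / 2)"

lemma form_boundedD:
  assumes "form_bounded K M" "finite F" "finite G"
  shows "cmod (\<Sum>l\<in>F. \<Sum>k\<in>G. cnj (y l) * M l k * x k)
      \<le> K * ((\<Sum>l\<in>F. (cmod (y l))\<^sup>2) + (\<Sum>k\<in>G. (cmod (x k))\<^sup>2)) / 2"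
  using assms unfolding form_bounded_def by simp

text \<open>Apply the hypothesis to the normalized vectors.\<close>

lemma form_bounded_product:
  assumes "form_bounded K M" and fin: "finite F" "finite G"
  shows "cmod (\<Sum>l\<in>F. \<Sum>k\<in>G. cnj (y l) * M l k * x k)
      \<le> K * L2_set (\<lambda>l. cmod (y l)) F * L2_set (\<lambda>k. cmod (x k)) G"
proof -
  define a b where "a = L2_set (\<lambda>l. cmod (y l)) F" and "b = L2_set (\<lambda>k. cmod (x k)) G"
  have a2: "(\<Sum>l\<in>F. (cmod (y l))\<^sup>2) = a\<^sup>2" and b2: "(\<Sum>k\<in>G. (cmod (x k))\<^sup>2) = b\<^sup>2"
    by (simp_all add: a_def b_def L2_set_def sum_nonneg)
  have ab: "0 \<le> a" "0 \<le> b" by (simp_all add: a_def b_def)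
  show ?thesis
  proof (cases "a = 0 \<or> b = 0")
    case True
    then have "(\<Sum>l\<in>F. \<Sum>k\<in>G. cnj (y l) * M l k * x k) = 0"
      using fin by (auto simp: a_def b_def L2_set_eq_0_iff intro!: sum.neutral)
    moreover have "0 \<le> K * a * b" using True by auto
    ultimately show ?thesis by (simp add: a_def b_def)
  next
    case False
    then have p: "0 < a" "0 < b" using ab by auto
    define S where "S = (\<Sum>l\<in>F. \<Sum>k\<in>G. cnj (y l) * M l k * x k)"
    have "(\<Sum>l\<in>F. \<Sum>k\<in>G. cnj (y l / of_real a) * M l k * (x k / of_real b)) = S / of_real (a * b)"
      unfolding S_def by (simp add: sum_divide_distrib field_simps)
    moreover have "(\<Sum>l\<in>F. (cmod (y l / of_real a))\<^sup>2) = 1" "(\<Sum>k\<in>G. (cmod (x k / of_real b))\<^sup>2) = 1"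
      using p a2 b2 by (simp_all add: norm_divide power_divide sum_divide_distrib[symmetric])
    moreover have "cmod (\<Sum>l\<in>F. \<Sum>k\<in>G. cnj (y l / of_real a) * M l k * (x k / of_real b))
        \<le> K * ((\<Sum>l\<in>F. (cmod (y l / of_real a))\<^sup>2) + (\<Sum>k\<in>G. (cmod (x k / of_real b))\<^sup>2)) / 2"
      by (rule form_boundedD[OF assms])
    ultimately have "cmod (S / of_real (a * b)) \<le> K * (1 + 1) / 2" by simp
    then have "cmod S / (a * b) \<le> K" using p by (simp add: norm_divide norm_mult)
    then show ?thesis using p by (simp add: S_def a_def b_def field_simps)
  qed
qed

lemma L2_set_seq_le: "finite F \<Longrightarrow> L2_set (\<lambda>k. cmod (seq x k)) F \<le> norm x"
  unfolding L2_set_def by (rule real_le_lsqrt) (auto simp: sum_le_norm_l2_sq sum_nonneg)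

context
  fixes K :: real and M :: "'a \<Rightarrow> 'a \<Rightarrow> complex"
  assumes fb: "form_bounded K M"
begin

lemma form_bounded_nonneg: "0 \<le> K"
  using fb by (simp add: form_bounded_def)

text \<open>Test the form with a unit vector and the conjugated row.\<close>

lemma form_bounded_row: "(\<lambda>k. (cmod (M l k))\<^sup>2) summable_on UNIV"
proof (rule square_summableI)
  fix G :: "'a set" assume G: "finite G"
  define s where "s = (\<Sum>k\<in>G. (cmod (M l k))\<^sup>2)"
  have s0: "0 \<le> s" by (simp add: s_def sum_nonneg)
  have "cmod (\<Sum>l'\<in>{l}. \<Sum>k\<in>G. cnj 1 * M l' k * cnj (M l k))
      \<le> K * L2_set (\<lambda>l. cmod 1) {l} * L2_set (\<lambda>k. cmod (cnj (M l k))) G"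
    by (rule form_bounded_product[OF fb, of "{l}" G "\<lambda>_. 1" "\<lambda>k. cnj (M l k)"]) (use G in auto)
  also have "(\<Sum>l'\<in>{l}. \<Sum>k\<in>G. cnj 1 * M l' k * cnj (M l k)) = of_real s"
    unfolding s_def of_real_sum complex_norm_square by simp
  also have "L2_set (\<lambda>k. cmod (cnj (M l k))) G = sqrt s" by (simp add: s_def L2_set_def)
  finally have "s \<le> K * sqrt s" using s0 by simp
  then have "sqrt s * sqrt s \<le> K * sqrt s" using s0 by simp
  then have "sqrt s \<le> K"
    using s0 form_bounded_nonneg mult_right_le_imp_le[of "sqrt s" "sqrt s" K] by (cases "s = 0") auto
  then show "s \<le> K\<^sup>2" by (rule sqrt_le_D)
qed

lemma form_bounded_summable: "(\<lambda>k. M l k * seq x k) summable_on UNIV"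
  by (rule abs_summable_summable)
     (use product_summable[OF form_bounded_row seq_summable] in \<open>simp add: norm_mult\<close>)

text \<open>Test the form with the restriction to \<open>F\<close> of the image \<open>y\<close>:
  this bounds the squared norm \<open>a^2\<close> of \<open>y\<close> on \<open>F\<close> by
  \<open>K * a * norm x\<close>.\<close>

lemma form_bounded_apply: 
  assumes F: "finite F"
  shows "(\<Sum>l\<in>F. (cmod (\<Sum>\<^sub>\<infinity>k. M l k * seq x k))\<^sup>2) \<le> (K * norm x)\<^sup>2"
proof -
  define y where "y l = (\<Sum>\<^sub>\<infinity>k. M l k * seq x k)" for l
  define a where "a = L2_set (\<lambda>l. cmod (y l)) F"
  have a2: "(\<Sum>l\<in>F. (cmod (y l))\<^sup>2) = a\<^sup>2" and a0: "0 \<le> a"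
    by (simp_all add: a_def L2_set_def sum_nonneg)
  have "((\<lambda>k. M l k * seq x k) has_sum y l) UNIV" for l
    unfolding y_def using form_bounded_summable by (rule has_sum_infsum)
  then have "((\<lambda>G. \<Sum>l\<in>F. cnj (y l) * (\<Sum>k\<in>G. M l k * seq x k)) \<longlongrightarrow> (\<Sum>l\<in>F. cnj (y l) * y l))
      (finite_subsets_at_top UNIV)"
    unfolding has_sum_def by (intro tendsto_intros)
  then have lim: "((\<lambda>G. cmod (\<Sum>l\<in>F. \<Sum>k\<in>G. cnj (y l) * M l k * seq x k)) \<longlongrightarrow> cmod (\<Sum>l\<in>F. cnj (y l) * y l))
      (finite_subsets_at_top UNIV)"
    by (intro tendsto_norm) (simp add: sum_distrib_left mult.assoc)
  have "cmod (\<Sum>l\<in>F. cnj (y l) * y l) \<le> K * a * norm x"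
  proof (rule tendsto_upperbound[OF lim])
    show "\<forall>\<^sub>F G in finite_subsets_at_top UNIV.
        cmod (\<Sum>l\<in>F. \<Sum>k\<in>G. cnj (y l) * M l k * seq x k) \<le> K * a * norm x"
    proof (rule eventually_finite_subsets_at_top_weakI)
      fix G :: "'a set" assume G: "finite G"
      have "cmod (\<Sum>l\<in>F. \<Sum>k\<in>G. cnj (y l) * M l k * seq x k) \<le> K * a * L2_set (\<lambda>k. cmod (seq x k)) G"
        unfolding a_def by (rule form_bounded_product[OF fb F G])
      also have "\<dots> \<le> K * a * norm x"
        using a0 form_bounded_nonneg G by (intro mult_left_mono L2_set_seq_le) auto
      finally show "cmod (\<Sum>l\<in>F. \<Sum>k\<in>G. cnj (y l) * M l k * seq x k) \<le> K * a * norm x" .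
    qed
  qed simp
  also have "(\<Sum>l\<in>F. cnj (y l) * y l) = of_real (a\<^sup>2)"
    unfolding a2[symmetric] of_real_sum complex_norm_square by (simp add: mult.commute)
  finally have "a * a \<le> (K * norm x) * a" using a0 by (simp add: power2_eq_square mult_ac norm_mult)
  then have "a \<le> K * norm x" using a0 form_bounded_nonneg by (cases "a = 0") auto
  then show ?thesis using a2 a0 by (simp add: y_def power_mono)
qed

end

definition mat_op :: "('a \<Rightarrow> 'a \<Rightarrow> complex) \<Rightarrow> 'a l2 \<Rightarrow> 'a l2" where
  "mat_op M x = mk (\<lambda>l. \<Sum>\<^sub>\<infinity>k. M l k * seq x k)"

context
  fixes K :: real and M :: "'a \<Rightarrow> 'a \<Rightarrow> complex"
  assumes fb: "form_bounded K M"
begin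

lemma seq_mat_op: "seq (mat_op M x) l = (\<Sum>\<^sub>\<infinity>k. M l k * seq x k)"
  unfolding mat_op_def by (subst seq_mk) (auto intro: square_summableI form_bounded_apply[OF fb])

lemma norm_mat_op: "norm (mat_op M x) \<le> K * norm x"
  by (rule power2_le_imp_le[OF norm_l2_sq_leI])
     (simp_all add: seq_mat_op form_bounded_apply[OF fb] form_bounded_nonneg[OF fb])

lemma bounded_linear_mat_op: "bounded_linear (mat_op M)"
proof (rule bounded_linear_intro)
  show "mat_op M (x + y) = mat_op M x + mat_op M y" for x y
    by (rule l2_eqI) (simp add: seq_mat_op distrib_left infsum_add form_bounded_summable[OF fb])
  show "mat_op M (c *\<^sub>R x) = c *\<^sub>R mat_op M x" for c x
    by (rule l2_eqI)
       (simp add: seq_mat_op scaleR_conv_of_real mult.left_commute[of _ "of_real c"] infsum_cmult_right')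
  show "norm (mat_op M x) \<le> norm x * K" for x using norm_mat_op[of x] by (simp add: mult.commute)
qed

lemma mat_op_cscale: "mat_op M (cscale c x) = cscale c (mat_op M x)"
  by (rule l2_eqI) (simp add: seq_mat_op mult.left_commute[of _ c] infsum_cmult_right')

lemma seq_mat_op_finite:
  assumes "finite F" "restr F x = x"
  shows "seq (mat_op M x) l = (\<Sum>k\<in>F. M l k * seq x k)"
proof -
  have z: "seq x k = 0" if "k \<notin> F" for k using that assms by (metis seq_restr)
  have "(\<Sum>\<^sub>\<infinity>k. M l k * seq x k) = (\<Sum>\<^sub>\<infinity>k\<in>F. M l k * seq x k)"
    by (rule infsum_cong_neutral) (auto simp: z)
  then show ?thesis using assms by (simp add: seq_mat_op)
qed

lemma seq_mat_op_single: "seq (mat_op M (single k c)) l = M l k * c"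
proof -
  have "restr {k} (single k c) = single k c" by (rule l2_eqI) (simp add: seq_single)
  then show ?thesis by (subst seq_mat_op_finite[of "{k}"]) (auto simp: seq_single)
qed

end

text \<open>All properties are checked on single coordinates or on finite sections and extended by
  density.\<close>

lemma coercive_operator_mat_op:
  assumes fb: "form_bounded K A" and herm: "\<And>l k. A l k = cnj (A k l)" and \<alpha>: "0 < \<alpha>"
    and co: "\<And>F x. finite F \<Longrightarrow>
       \<alpha> * (\<Sum>k\<in>F. (cmod (x k))\<^sup>2) \<le> Re (\<Sum>l\<in>F. \<Sum>k\<in>F. cnj (x l) * A l k * x k)"
  shows "coercive_operator (mat_op A) \<alpha> K"
proof (rule coercive_operator.intro)
  note bl = bounded_linear_mat_op[OF fb]
  show "linear (mat_op A)" using bl by (rule bounded_linear.linear)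
  show "norm (mat_op A x) \<le> K * norm x" for x by (rule norm_mat_op[OF fb])
  have sym_single: "mat_op A (single k c) \<bullet> single l d = single k c \<bullet> mat_op A (single l d)" for k l c d
    using herm[of k l] by (simp add: inner_single inner_commute[of _ "single l d"] seq_mat_op_single[OF fb])
      (simp add: inner_complex_def algebra_simps)
  have sym1: "mat_op A (single k c) \<bullet> y = single k c \<bullet> mat_op A y" for k c y
    by (rule l2_bounded_linear_eqI[where f="\<lambda>y. mat_op A (single k c) \<bullet> y" and g="\<lambda>y. single k c \<bullet> mat_op A y"])
       (auto intro: bounded_linear_inner_right_comp[OF bl] bounded_linear_inner_right sym_single)
  show "mat_op A x \<bullet> y = x \<bullet> mat_op A y" for x y
    by (rule l2_bounded_linear_eqI[where f="\<lambda>x. mat_op A x \<bullet> y" and g="\<lambda>x. x \<bullet> mat_op A y"])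
       (auto intro: bounded_linear_inner_left_comp[OF bl] bounded_linear_inner_left sym1)
  show "0 < \<alpha>" by fact
  show "\<alpha> * (norm x)\<^sup>2 \<le> mat_op A x \<bullet> x" for x
  proof (rule tendsto_le[OF finite_subsets_at_top_neq_bot])
    show "((\<lambda>F. \<alpha> * (norm (restr F x))\<^sup>2) \<longlongrightarrow> \<alpha> * (norm x)\<^sup>2) (finite_subsets_at_top UNIV)"
      by (intro tendsto_intros restr_finite_tendsto)
    show "((\<lambda>F. mat_op A (restr F x) \<bullet> restr F x) \<longlongrightarrow> mat_op A x \<bullet> x) (finite_subsets_at_top UNIV)"
      by (intro tendsto_intros restr_finite_tendsto bounded_linear.tendsto[OF bl])
    show "\<forall>\<^sub>F F in finite_subsets_at_top UNIV. \<alpha> * (norm (restr F x))\<^sup>2 \<le> mat_op A (restr F x) \<bullet> restr F x"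
    proof (rule eventually_finite_subsets_at_top_weakI)
      fix F :: "'a set" assume F: "finite F"
      have "(norm (restr F x))\<^sup>2 \<le> (\<Sum>k\<in>F. (cmod (seq x k))\<^sup>2)"
      proof (rule norm_l2_sq_leI)
        fix G :: "'a set" assume "finite G"
        then have "(\<Sum>k\<in>G. (cmod (seq (restr F x) k))\<^sup>2) = (\<Sum>k\<in>G \<inter> F. (cmod (seq x k))\<^sup>2)"
          by (auto simp: sum.inter_restrict intro!: sum.cong)
        also have "\<dots> \<le> (\<Sum>k\<in>F. (cmod (seq x k))\<^sup>2)" using F by (intro sum_mono2) auto
        finally show "(\<Sum>k\<in>G. (cmod (seq (restr F x) k))\<^sup>2) \<le> (\<Sum>k\<in>F. (cmod (seq x k))\<^sup>2)" .
      qed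
      then have "\<alpha> * (norm (restr F x))\<^sup>2 \<le> \<alpha> * (\<Sum>k\<in>F. (cmod (seq x k))\<^sup>2)"
        using \<alpha> by (intro mult_left_mono) auto
      also have "\<dots> \<le> Re (\<Sum>l\<in>F. \<Sum>k\<in>F. cnj (seq x l) * A l k * seq x k)" by (rule co[OF F])
      also have "\<dots> = restr F x \<bullet> mat_op A (restr F x)"
      proof -
        have s: "seq (mat_op A (restr F x)) l = (\<Sum>k\<in>F. A l k * seq x k)" for l
          by (subst seq_mat_op_finite[OF fb F]) auto
        have "restr F x \<bullet> mat_op A (restr F x) = (\<Sum>l\<in>F. single l (seq x l) \<bullet> mat_op A (restr F x))"
          by (subst restr_finite_eq_sum[OF F, of x]) (simp add: inner_sum_left)
        also have "\<dots> = (\<Sum>l\<in>F. Re (cnj (seq x l) * (\<Sum>k\<in>F. A l k * seq x k)))"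
          by (simp add: inner_single s inner_complex_def)
        finally show ?thesis by (simp add: sum_distrib_left mult.assoc)
      qed
      finally show "\<alpha> * (norm (restr F x))\<^sup>2 \<le> mat_op A (restr F x) \<bullet> restr F x"
        by (simp add: inner_commute)
    qed
  qed
qed

section \<open>Schur test\<close>

text \<open>After the arithmetic-geometric inequality each of the two sums runs over translates or
  reflections of the kernel, whose total mass is at most \<open>K\<close>.\<close>

lemma schur_test:
  fixes M :: "'a::ab_group_add \<Rightarrow> 'a \<Rightarrow> complex"
  assumes ker: "\<And>l k. cmod (M l k) \<le> \<kappa> (l - k)"
    and K: "\<And>F. finite F \<Longrightarrow> sum \<kappa> F \<le> K"
  shows "form_bounded K M"
  unfolding form_bounded_def
proof (intro conjI allI impI)
  have k0: "0 \<le> \<kappa> m" for m using ker[of m 0] norm_ge_zero[of "M m 0"] by (simp del: norm_ge_zero)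
  show "0 \<le> K" using K[of "{}"] by simp
  fix F G :: "'a set" and x y :: "'a \<Rightarrow> complex" assume F: "finite F" and G: "finite G"
  have row: "(\<Sum>k\<in>G. \<kappa> (l - k)) \<le> K" for l
    using K[of "(\<lambda>k. l - k) ` G"] G by (simp add: sum.reindex inj_on_def)
  have col: "(\<Sum>l\<in>F. \<kappa> (l - k)) \<le> K" for k
    using K[of "(\<lambda>l. l - k) ` F"] F by (simp add: sum.reindex inj_on_def)
  have "cmod (\<Sum>l\<in>F. \<Sum>k\<in>G. cnj (y l) * M l k * x k) \<le> (\<Sum>l\<in>F. \<Sum>k\<in>G. cmod (cnj (y l) * M l k * x k))"
    by (intro order_trans[OF norm_sum] sum_mono norm_sum)
  also have "\<dots> \<le> (\<Sum>l\<in>F. \<Sum>k\<in>G. \<kappa> (l - k) * (((cmod (y l))\<^sup>2 + (cmod (x k))\<^sup>2) / 2))"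
  proof (intro sum_mono)
    fix l k
    have "cmod (cnj (y l) * M l k * x k) = cmod (M l k) * (cmod (y l) * cmod (x k))"
      by (simp add: norm_mult)
    also have "\<dots> \<le> \<kappa> (l - k) * (((cmod (y l))\<^sup>2 + (cmod (x k))\<^sup>2) / 2)"
      using sum_squares_bound[of "cmod (y l)" "cmod (x k)"] ker k0
      by (intro mult_mono) (auto simp: field_simps)
    finally show "cmod (cnj (y l) * M l k * x k) \<le> \<kappa> (l - k) * (((cmod (y l))\<^sup>2 + (cmod (x k))\<^sup>2) / 2)" .
  qed
  also have "\<dots> = ((\<Sum>l\<in>F. (\<Sum>k\<in>G. \<kappa> (l - k)) * (cmod (y l))\<^sup>2)
      + (\<Sum>k\<in>G. (\<Sum>l\<in>F. \<kappa> (l - k)) * (cmod (x k))\<^sup>2)) / 2"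
    by (simp add: sum_distrib_right sum.swap[of _ G F] sum.distrib[symmetric] sum_divide_distrib distrib_left add_divide_distrib)
  also have "\<dots> \<le> ((\<Sum>l\<in>F. K * (cmod (y l))\<^sup>2) + (\<Sum>k\<in>G. K * (cmod (x k))\<^sup>2)) / 2"
    by (intro divide_right_mono add_mono sum_mono mult_right_mono row col) auto
  finally show "cmod (\<Sum>l\<in>F. \<Sum>k\<in>G. cnj (y l) * M l k * x k)
       \<le> K * ((\<Sum>l\<in>F. (cmod (y l))\<^sup>2) + (\<Sum>k\<in>G. (cmod (x k))\<^sup>2)) / 2"
    by (simp add: sum_distrib_left distrib_left)
qed

section \<open>The inverse matrix\<close>

lemma ell2_iff_seq: "x \<in> ell2 \<longleftrightarrow> x \<in> range seq"
proof
  assume "x \<in> ell2"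
  then have "x = seq (mk x)" by (simp add: ell2_def seq_mk)
  then show "x \<in> range seq" by blast
qed (auto simp: ell2_def seq_summable)

lemma seq_in_ell2 [simp]: "seq x \<in> ell2"
  by (simp add: ell2_iff_seq)

lemma ell2_norm_seq [simp]: "ell2_norm (seq x) = norm x"
  by (simp add: ell2_norm_def norm_l2_eq)

lemma ell2_opnorm_finite: "ell2_opnorm M < \<infinity> \<longleftrightarrow> (\<exists>c. ell2_bound M c)"
  unfolding ell2_opnorm_def INF_less_iff by auto

text \<open>The operator norm is an infimum of bounds; every larger constant is a bound, and the
  claim follows in the limit.\<close>

lemma ell2_bound_apply_le:
  assumes "ell2_opnorm M \<le> ereal b" "x \<in> ell2"
  shows "mat_app M x \<in> ell2" "ell2_norm (mat_app M x) \<le> b * ell2_norm x"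
proof -
  have n: "0 \<le> ell2_norm x" by (simp add: ell2_norm_def infsum_nonneg)
  have ex: "\<exists>c. ell2_bound M c \<and> c < b + e" if "0 < e" for e
  proof -
    have "ell2_opnorm M < ereal (b + e)" using assms(1) that by (auto intro: le_less_trans)
    then show ?thesis unfolding ell2_opnorm_def INF_less_iff by auto
  qed
  from ex[of 1] show "mat_app M x \<in> ell2" using assms(2) by (auto simp: ell2_bound_def)
  show "ell2_norm (mat_app M x) \<le> b * ell2_norm x"
  proof (rule field_le_epsilon)
    fix e :: real assume e: "0 < e"
    define e' where "e' = e / (ell2_norm x + 1)"
    have e': "0 < e'" "e' * ell2_norm x \<le> e" using e n by (auto simp: e'_def field_simps)
    obtain c where c: "ell2_bound M c" "c < b + e'" using ex[OF e'(1)] by blast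
    have "ell2_norm (mat_app M x) \<le> c * ell2_norm x" using c assms(2) by (auto simp: ell2_bound_def)
    also have "\<dots> \<le> (b + e') * ell2_norm x" using c n by (intro mult_right_mono) auto
    also have "\<dots> \<le> b * ell2_norm x + e" using e' by (simp add: distrib_right)
    finally show "ell2_norm (mat_app M x) \<le> b * ell2_norm x + e" .
  qed
qed

lemma mat_app_seq:
  assumes "form_bounded K M"
  shows "mat_app M (seq x) = seq (mat_op M x)"
  by (rule ext) (simp add: mat_app_def seq_mat_op[OF assms])

lemma ell2_bound_mat_op:
  assumes "form_bounded K M"
  shows "ell2_bound M K"
  using form_bounded_nonneg[OF assms] form_bounded_summable[OF assms] norm_mat_op[OF assms]
  by (auto simp: ell2_bound_def ell2_iff_seq mat_app_seq[OF assms])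

lemma mat_app_single: "mat_app M (seq (single k 1)) l = M l k"
proof -
  have "mat_app M (seq (single k 1)) l = (\<Sum>\<^sub>\<infinity>j\<in>{k}. M l j)"
    unfolding mat_app_def by (rule infsum_cong_neutral) (auto simp: seq_single)
  then show ?thesis by simp
qed

locale coercive_matrix =
  fixes A :: "'d::finite imatrix" and \<alpha> M :: real
  assumes form: "form_bounded M A"
    and operator: "coercive_operator (mat_op A) \<alpha> M"

sublocale coercive_matrix \<subseteq> coercive_operator "mat_op A" \<alpha> M
  by (rule operator)

context coercive_matrix
begin

lemma gal_UNIV_cscale: "gal UNIV (cscale c x) = cscale c (gal UNIV x)"
proof -
  have "mat_op A (cscale c (gal UNIV x)) = cscale c x"
    by (simp add: mat_op_cscale[OF form] T_gal_UNIV)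
  then show ?thesis by (metis gal_UNIV_T)
qed

lemma norm_gal_UNIV: "norm (gal UNIV x) \<le> (1 / \<alpha>) * norm x"
  using norm_le_norm_T[of "gal UNIV x"] alpha_pos by (simp add: T_gal_UNIV field_simps)

text \<open>Since the matrix is Hermitian, the \<open>l\<close>-th row of its inverse consists of
  the conjugates of the \<open>l\<close>-th column, which is the solution for the
  \<open>l\<close>-th unit vector.\<close>

definition inv_mat :: "'d imatrix" where
  "inv_mat l k = cnj (seq (gal UNIV (single l 1)) k)"

text \<open>Symmetry moves the operator from the solution for \<open>x\<close> to the solution
  \<open>w\<close> for the unit vector. The imaginary part follows from the real part for \<open>-
  \<i> * x\<close>.\<close>

lemma seq_gal_UNIV: "((\<lambda>k. inv_mat l k * seq x k) has_sum seq (gal UNIV x) l) UNIV"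
proof -
  define w where "w = gal UNIV (single l (1::complex))"
  have re: "Re (seq (gal UNIV y) l) = (\<Sum>\<^sub>\<infinity>k. Re (inv_mat l k * seq y k))" for y
  proof -
    have "Re (seq (gal UNIV y) l) = single l 1 \<bullet> gal UNIV y"
      by (simp add: inner_single inner_complex_def)
    also have "\<dots> = mat_op A w \<bullet> gal UNIV y" by (simp add: w_def T_gal_UNIV)
    also have "\<dots> = w \<bullet> y" by (simp add: symmetric T_gal_UNIV)
    also have "\<dots> = (\<Sum>\<^sub>\<infinity>k. Re (inv_mat l k * seq y k))"
      by (simp add: inner_l2_def inv_mat_def w_def inner_complex_def)
    finally show ?thesis .
  qed
  have sm: "(\<lambda>k. inv_mat l k * seq x k) summable_on UNIV"
    by (rule abs_summable_summable)
       (use product_summable[OF seq_summable[of w] seq_summable[of x]] in \<open>simp add: norm_mult inv_mat_def w_def\<close>)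
  define s where "s = (\<Sum>\<^sub>\<infinity>k. inv_mat l k * seq x k)"
  have "Re s = Re (seq (gal UNIV x) l)" unfolding s_def re by (rule infsum_Re[OF sm, symmetric])
  moreover have "Im s = Im (seq (gal UNIV x) l)"
  proof -
    have "Im (seq (gal UNIV x) l) = Re (seq (gal UNIV (cscale (- \<i>) x)) l)"
      by (simp add: gal_UNIV_cscale)
    also have "\<dots> = (\<Sum>\<^sub>\<infinity>k. Im (inv_mat l k * seq x k))"
      unfolding re by (simp add: algebra_simps)
    finally show ?thesis unfolding s_def by (simp only: infsum_Im[OF sm])
  qed
  ultimately have "s = seq (gal UNIV x) l" by (simp add: complex_eq_iff)
  then show ?thesis using sm by (simp add: s_def has_sum_iff)
qed

lemma mat_app_inv_mat: "mat_app inv_mat (seq x) = seq (gal UNIV x)"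
  unfolding mat_app_def using seq_gal_UNIV by (auto intro!: infsumI)

lemma ell2_bound_inv_mat: "ell2_bound inv_mat (1 / \<alpha>)"
  unfolding ell2_bound_def
  using alpha_pos norm_gal_UNIV
  by (auto simp: ell2_iff_seq mat_app_inv_mat intro: has_sum_imp_summable[OF seq_gal_UNIV])

lemma ell2_inverse_of_inv_mat: "ell2_inverse_of A inv_mat"
proof -
  have "ell2_opnorm A < \<infinity>" "ell2_opnorm inv_mat < \<infinity>"
    unfolding ell2_opnorm_finite using ell2_bound_mat_op[OF form] ell2_bound_inv_mat by blast+
  then show ?thesis
    by (auto simp: ell2_inverse_of_def ell2_iff_seq mat_app_inv_mat mat_app_seq[OF form] T_gal_UNIV gal_UNIV_T)
qed

lemma mat_inverse_eq: "mat_inverse A = inv_mat"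
  unfolding mat_inverse_def
proof (rule the_equality, rule ell2_inverse_of_inv_mat)
  fix B :: "'d imatrix" assume B: "ell2_inverse_of A B"
  show "B = inv_mat"
  proof (intro ext)
    fix l k :: "int ^ 'd"
    define e where "e = seq (single k 1)"
    have e: "e \<in> ell2" by (simp add: e_def)
    obtain c where "ell2_bound B c" using B unfolding ell2_inverse_of_def ell2_opnorm_finite by blast
    then have "mat_app B e \<in> ell2" using e unfolding ell2_bound_def by blast
    then obtain y where y: "mat_app B e = seq y" by (auto simp: ell2_iff_seq)
    have "mat_app A (mat_app B e) = e" using B e unfolding ell2_inverse_of_def by blast
    then have "mat_app A (seq y) = e" by (simp only: y)
    then have "seq (mat_op A y) = seq (single k 1)" by (simp add: mat_app_seq[OF form] e_def)
    then have "y = gal UNIV (single k 1)" by (metis seq_inject gal_UNIV_T)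
    then have "mat_app B e = mat_app inv_mat e" unfolding y by (simp add: e_def mat_app_inv_mat)
    then show "B l k = inv_mat l k" unfolding e_def by (metis mat_app_single)
  qed
qed

text \<open>The truncated inverse spreads the support of \<open>y\<close> by at most
  \<open>J\<close>.\<close>

lemma truncated_inverse_approximation:
  assumes D: "finite D" "restr D y = y"
    and bound: "ell2_opnorm (\<lambda>l k. mat_inverse A l k - mat_trunc J (mat_inverse A) l k) \<le> ereal \<psi>"
  obtains b where "restr (enrich D J) b = b" "norm (gal UNIV y - b) \<le> \<psi> * norm y"
proof -
  define E where "E l k = inv_mat l k - mat_trunc J inv_mat l k" for l k
  have bd: "ell2_opnorm E \<le> ereal \<psi>" using bound by (simp add: E_def[abs_def] mat_inverse_eq)
  have "mat_app E (seq y) \<in> ell2" by (rule ell2_bound_apply_le[OF bd]) simp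
  then obtain z where z: "mat_app E (seq y) = seq z" by (auto simp: ell2_iff_seq)
  have yz: "seq y k = 0" if "k \<notin> D" for k using that D by (metis seq_restr)
  have fin: "(\<Sum>\<^sub>\<infinity>k. N l k * seq y k) = (\<Sum>k\<in>D. N l k * seq y k)" for l and N :: "'d imatrix"
  proof -
    have "(\<Sum>\<^sub>\<infinity>k. N l k * seq y k) = (\<Sum>\<^sub>\<infinity>k\<in>D. N l k * seq y k)"
      by (rule infsum_cong_neutral) (auto simp: yz)
    then show ?thesis using D by simp
  qed
  have "seq (gal UNIV y - z) l = (\<Sum>k\<in>D. mat_trunc J inv_mat l k * seq y k)" for l
  proof -
    have "seq (gal UNIV y - z) l = mat_app inv_mat (seq y) l - mat_app E (seq y) l"
      by (simp add: z mat_app_inv_mat)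
    also have "\<dots> = (\<Sum>k\<in>D. inv_mat l k * seq y k) - (\<Sum>k\<in>D. E l k * seq y k)"
      by (simp only: mat_app_def fin)
    also have "\<dots> = (\<Sum>k\<in>D. mat_trunc J inv_mat l k * seq y k)"
      by (simp add: E_def sum_subtractf[symmetric] algebra_simps)
    finally show ?thesis .
  qed
  then have "seq (gal UNIV y - z) l = 0" if "l \<notin> enrich D J" for l
    using that by (force simp: mat_trunc_def enrich_def intro!: sum.neutral)
  then have "restr (enrich D J) (gal UNIV y - z) = gal UNIV y - z"
    by (intro l2_eqI) auto
  moreover have "norm (gal UNIV y - (gal UNIV y - z)) \<le> \<psi> * norm y"
    using ell2_bound_apply_le(2)[OF bd seq_in_ell2, of y] by (simp add: z)
  ultimately show ?thesis by (rule that)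
qed

end

section \<open>Lattice points and exponentially decaying kernels\<close>

lemma rvec_add: "rvec (k + l) = rvec k + rvec l"
  and rvec_diff: "rvec (k - l) = rvec k - rvec l"
  by (simp_all add: rvec_def vec_eq_iff)

lemma component_le_idx_norm: "\<bar>real_of_int (k $ i)\<bar> \<le> idx_norm k"
  using component_le_norm_cart[of "rvec k" i] by (simp add: rvec_def)

text \<open>Integer vectors in a cube are functions into an interval, for which products of sums
  expand.\<close>

lemma vec_box_eq: "{k :: int ^ 'd::finite. \<forall>i. k $ i \<in> B} = vec_lambda ` (UNIV \<rightarrow>\<^sub>E B)"
proof (intro equalityI subsetI)
  fix k :: "int ^ 'd" assume "k \<in> {k. \<forall>i. k $ i \<in> B}"
  then have "vec_nth k \<in> UNIV \<rightarrow>\<^sub>E B" by auto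
  then show "k \<in> vec_lambda ` (UNIV \<rightarrow>\<^sub>E B)" by (metis imageI vec_nth_inverse)
qed auto

lemma inj_vec_lambda: "inj_on vec_lambda X"
  by (auto simp: inj_on_def vec_lambda_inject)

lemma finite_vec_box: "finite B \<Longrightarrow> finite {k :: int ^ 'd::finite. \<forall>i. k $ i \<in> B}"
  unfolding vec_box_eq by (intro finite_imageI finite_PiE) auto

lemma card_vec_box: "finite B \<Longrightarrow> card {k :: int ^ 'd::finite. \<forall>i. k $ i \<in> B} = card B ^ CARD('d)"
  unfolding vec_box_eq by (simp add: card_image inj_vec_lambda card_PiE)

lemma sum_prod_vec_box:
  fixes g :: "int \<Rightarrow> real"
  assumes "finite B"
  shows "(\<Sum>k\<in>{k :: int ^ 'd::finite. \<forall>i. k $ i \<in> B}. \<Prod>i\<in>UNIV. g (k $ i)) = (sum g B) ^ CARD('d)"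
proof -
  have "(\<Prod>i\<in>(UNIV :: 'd set). sum g B) = (\<Sum>h\<in>UNIV \<rightarrow>\<^sub>E B. \<Prod>i\<in>(UNIV :: 'd set). g (h i))"
    using assms by (intro prod_sum_PiE) auto
  then show ?thesis unfolding vec_box_eq by (simp add: sum.reindex inj_vec_lambda)
qed

lemma ball_subset_box:
  "{k :: int ^ 'd::finite. idx_norm k \<le> real J} \<subseteq> {k. \<forall>i. k $ i \<in> {- int J..int J}}"
proof clarsimp
  fix k :: "int ^ 'd" and i assume "idx_norm k \<le> real J"
  then have "\<bar>real_of_int (k $ i)\<bar> \<le> real J" using component_le_idx_norm[of k i] by linarith
  then show "- int J \<le> k $ i \<and> k $ i \<le> int J" by linarith
qed

lemma finite_lattice_ball: "finite {k :: int ^ 'd::finite. idx_norm k \<le> real J}"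
  by (rule finite_subset[OF ball_subset_box finite_vec_box]) simp

lemma card_lattice_ball: "card {k :: int ^ 'd::finite. idx_norm k \<le> real J} \<le> (2 * J + 1) ^ CARD('d)"
proof -
  have "card {k :: int ^ 'd. idx_norm k \<le> real J} \<le> card {k :: int ^ 'd. \<forall>i. k $ i \<in> {- int J..int J}}"
    by (rule card_mono[OF finite_vec_box ball_subset_box]) simp
  also have "\<dots> = (2 * J + 1) ^ CARD('d)"
    by (subst card_vec_box) (auto simp: nat_add_distrib nat_mult_distrib intro!: arg_cong[where f="\<lambda>n. n ^ _"])
  finally show ?thesis .
qed

lemma enrich_eq_UN: "enrich D J = (\<Union>l\<in>D. (\<lambda>k. k + l) ` {k. idx_norm k \<le> real J})"
  unfolding enrich_def by (force simp: image_iff intro: exI[of _ "_ - _"])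

lemma finite_enrich: "finite D \<Longrightarrow> finite (enrich D J)"
  unfolding enrich_eq_UN by (intro finite_UN_I finite_imageI finite_lattice_ball)

lemma card_enrich:
  fixes D :: "(int ^ 'd::finite) set"
  assumes "finite D"
  shows "card (enrich D J) \<le> card D * (2 * J + 1) ^ CARD('d)"
proof -
  have "card (enrich D J) \<le> (\<Sum>l\<in>D. card ((\<lambda>k. k + l) ` {k :: int ^ 'd. idx_norm k \<le> real J}))"
    unfolding enrich_eq_UN using assms by (rule card_UN_le)
  also have "\<dots> \<le> (\<Sum>l\<in>D. (2 * J + 1) ^ CARD('d))"
    by (intro sum_mono) (use card_lattice_ball[where 'd='d, of J] in \<open>simp add: card_image inj_on_def\<close>)
  finally show ?thesis by simp
qed

lemma subset_enrich: "D \<subseteq> enrich D J"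
  by (force simp: enrich_def rvec_diff)

lemma enrich_enrich: "enrich (enrich D I) J \<subseteq> enrich D (I + J)"
proof
  fix k assume "k \<in> enrich (enrich D I) J"
  then obtain l m where lm: "m \<in> D" "idx_norm (l - m) \<le> real I" "idx_norm (k - l) \<le> real J"
    by (auto simp: enrich_def)
  have "idx_norm (k - m) \<le> idx_norm (k - l) + idx_norm (l - m)"
    using norm_triangle_ineq[of "rvec (k - l)" "rvec (l - m)"] by (simp add: rvec_diff)
  then have "idx_norm (k - m) \<le> real (I + J)" using lm by simp
  then show "k \<in> enrich D (I + J)" using lm unfolding enrich_def by blast
qed

lemma infinite_lattice: "infinite (UNIV :: (int ^ 'd::finite) set)"
proof -
  have "inj (\<lambda>n::int. (vec n :: int ^ 'd))" by (auto simp: inj_on_def vec_eq_iff)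
  then show ?thesis using infinite_UNIV_int by (metis finite_subset[OF subset_UNIV] finite_imageD)
qed

text \<open>As \<open>idx_norm k\<close> is at least the mean of the \<open>|k $ i|\<close>, the
  summand is dominated by a product over the coordinates, and the sum by a power of a geometric
  series.\<close>

lemma exponential_lattice_sum_bounded:
  assumes \<mu>: "0 < \<mu>"
  obtains K where "\<And>F :: (int ^ 'd::finite) set. finite F \<Longrightarrow> (\<Sum>k\<in>F. exp (- \<mu> * idx_norm k)) \<le> K"
proof
  define q where "q = exp (- \<mu> / real CARD('d))"
  have q: "0 < q" "q < 1" using \<mu> by (simp_all add: q_def)
  define g where "g j = q ^ nat \<bar>j\<bar>" for j :: int
  fix F :: "(int ^ 'd) set" assume F: "finite F"
  have "\<exists>n::nat. \<forall>k\<in>F. idx_norm k \<le> real n"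
  proof -
    obtain n :: nat where "Max (insert 0 (idx_norm ` F)) \<le> real n" using real_arch_simple by blast
    then show ?thesis using F by (intro exI[of _ n]) auto
  qed
  then obtain n where n: "\<And>k. k \<in> F \<Longrightarrow> idx_norm k \<le> real n" by blast
  define B where "B = {- int n..int n}"
  have FB: "F \<subseteq> {k. \<forall>i. k $ i \<in> B}" using n ball_subset_box[of n] by (auto simp: B_def)
  have term_le: "exp (- \<mu> * idx_norm k) \<le> (\<Prod>i\<in>UNIV. g (k $ i))" for k :: "int ^ 'd"
  proof -
    have "(\<Sum>i\<in>(UNIV::'d set). \<bar>real_of_int (k $ i)\<bar>) \<le> (\<Sum>i\<in>(UNIV::'d set). idx_norm k)"
      by (intro sum_mono component_le_idx_norm)
    then have "(\<mu> / real CARD('d)) * (\<Sum>i\<in>(UNIV::'d set). \<bar>real_of_int (k $ i)\<bar>) \<le> \<mu> / real CARD('d) * (real CARD('d) * idx_norm k)"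
      using \<mu> by (intro mult_left_mono) auto
    also have "\<dots> = \<mu> * idx_norm k" by simp
    finally have "exp (- \<mu> * idx_norm k) \<le> exp (\<Sum>i\<in>(UNIV::'d set). - \<mu> / real CARD('d) * \<bar>real_of_int (k $ i)\<bar>)"
      by (simp add: sum_distrib_left sum_negf)
    also have "\<dots> = (\<Prod>i\<in>UNIV. exp (- \<mu> / real CARD('d) * \<bar>real_of_int (k $ i)\<bar>))"
      by (rule exp_sum) simp
    also have "\<dots> = (\<Prod>i\<in>UNIV. g (k $ i))"
      by (simp add: g_def q_def exp_of_nat_mult[symmetric] mult.commute)
    finally show ?thesis .
  qed
  have g0: "0 \<le> g j" for j using q by (simp add: g_def)
  have "(\<Sum>k\<in>F. exp (- \<mu> * idx_norm k)) \<le> (\<Sum>k\<in>F. \<Prod>i\<in>UNIV. g (k $ i))"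
    by (intro sum_mono term_le)
  also have "\<dots> \<le> (\<Sum>k\<in>{k :: int ^ 'd. \<forall>i. k $ i \<in> B}. \<Prod>i\<in>UNIV. g (k $ i))"
    using FB by (intro sum_mono2 finite_vec_box) (auto simp: B_def prod_nonneg g0)
  also have "\<dots> = (sum g B) ^ CARD('d)"
    by (rule sum_prod_vec_box) (simp add: B_def)
  also have "\<dots> \<le> (2 / (1 - q)) ^ CARD('d)"
  proof (rule power_mono)
    have geo: "(\<Sum>j\<le>n. q ^ j) \<le> 1 / (1 - q)"
      using q by (simp add: sum_gp0 field_simps)
    have "B \<subseteq> int ` {..n} \<union> (\<lambda>j. - int j) ` {..n}"
    proof
      fix j assume "j \<in> B"
      then have "j = int (nat j) \<and> nat j \<le> n \<or> j = - int (nat (- j)) \<and> nat (- j) \<le> n"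
        by (auto simp: B_def)
      then show "j \<in> int ` {..n} \<union> (\<lambda>j. - int j) ` {..n}"
        by (metis (no_types, lifting) UnI1 UnI2 atMost_iff image_eqI)
    qed
    then have "sum g B \<le> sum g (int ` {..n} \<union> (\<lambda>j. - int j) ` {..n})"
      by (intro sum_mono2) (auto simp: g0)
    also have "\<dots> \<le> sum g (int ` {..n}) + sum g ((\<lambda>j. - int j) ` {..n})"
      using sum.union_inter[of "int ` {..n}" "(\<lambda>j. - int j) ` {..n}" g]
        sum_nonneg[of "int ` {..n} \<inter> (\<lambda>j. - int j) ` {..n}" g] g0 by simp
    also have "\<dots> = 2 * (\<Sum>j\<le>n. q ^ j)"
      by (simp add: sum.reindex inj_on_def g_def)
    finally show "sum g B \<le> 2 / (1 - q)" using geo by simp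
  qed (auto intro: sum_nonneg g0)
  finally show "(\<Sum>k\<in>F. exp (- \<mu> * idx_norm k)) \<le> (2 / (1 - q)) ^ CARD('d)" .
qed

text \<open>Half of the decay rate makes the kernel summable, so that the Schur test applies; the
  other half yields the exponentially small factor outside the band.\<close>

lemma exp_decay_banded_approximation:
  fixes A :: "'d::finite imatrix"
  assumes A: "A \<in> exp_decay \<mu>" and \<mu>: "0 < \<mu>"
  obtains c \<beta> where "0 < c" "0 < \<beta>" "form_bounded c A"
    "\<And>J. form_bounded (c * exp (- \<beta> * real J)) (\<lambda>l k. A l k - mat_trunc J A l k)"
    "\<And>J. form_bounded (2 * c) (mat_trunc J A)"
proof -
  obtain c0 where c0: "0 < c0" "\<And>l k. cmod (A l k) \<le> c0 * exp (- \<mu> * idx_norm (l - k))"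
    using A by (auto simp: exp_decay_def exp_decay_const_def)
  obtain K where K: "\<And>F :: (int ^ 'd) set. finite F \<Longrightarrow> (\<Sum>k\<in>F. exp (- (\<mu> / 2) * idx_norm k)) \<le> K"
    using exponential_lattice_sum_bounded[of "\<mu> / 2"] \<mu> by auto
  have K0: "0 < K" using K[of "{0}"] by (simp add: rvec_def zero_vec_def[symmetric])
  have half: "exp (- \<mu> * idx_norm m) \<le> exp (- (\<mu> / 2) * idx_norm m)" for m :: "int ^ 'd"
    using \<mu> by simp
  have c: "0 < c0 * K" using c0 K0 by simp
  have sm: "finite F \<Longrightarrow> (\<Sum>m\<in>F. e * c0 * exp (- (\<mu> / 2) * idx_norm m)) \<le> c0 * K * e"
    if "0 \<le> e" for F :: "(int ^ 'd) set" and e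
    using mult_left_mono[OF K[of F], of "e * c0"] that c0 by (simp add: sum_distrib_left mult_ac)
  have fA: "form_bounded (c0 * K * 1) A"
    by (rule schur_test[where \<kappa>="\<lambda>m. 1 * c0 * exp (- (\<mu> / 2) * idx_norm m)"])
       (use c0 half sm[of 1] in \<open>auto intro: order_trans[OF c0(2)]\<close>)
  have fT: "form_bounded (c0 * K * 1) (mat_trunc J A)" for J
    by (rule schur_test[where \<kappa>="\<lambda>m. 1 * c0 * exp (- (\<mu> / 2) * idx_norm m)"])
       (use c0 half sm[of 1] in \<open>auto simp: mat_trunc_def intro: order_trans[OF c0(2)]\<close>)
  have fD: "form_bounded (c0 * K * exp (- (\<mu> / 2) * real J)) (\<lambda>l k. A l k - mat_trunc J A l k)" for J
  proof (rule schur_test[where \<kappa>="\<lambda>m. exp (- (\<mu> / 2) * real J) * c0 * exp (- (\<mu> / 2) * idx_norm m)"])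
    fix l k
    show "cmod (A l k - mat_trunc J A l k) \<le> exp (- (\<mu> / 2) * real J) * c0 * exp (- (\<mu> / 2) * idx_norm (l - k))"
    proof (cases "idx_norm (l - k) \<le> real J")
      case False
      have "cmod (A l k) \<le> c0 * exp (- \<mu> * idx_norm (l - k))" by (rule c0)
      also have "- \<mu> * idx_norm (l - k) = - (\<mu> / 2) * idx_norm (l - k) + - (\<mu> / 2) * idx_norm (l - k)" by simp
      also have "exp \<dots> \<le> exp (- (\<mu> / 2) * real J) * exp (- (\<mu> / 2) * idx_norm (l - k))"
        unfolding exp_add using False \<mu> by (intro mult_right_mono) auto
      finally show ?thesis using False c0 by (simp add: mat_trunc_def mult_ac)
    qed (use c0 in \<open>simp add: mat_trunc_def\<close>)
  qed (rule sm, auto)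
  have fT2: "form_bounded (2 * (c0 * K)) (mat_trunc J A)" for J
    using fT[of J] c unfolding form_bounded_def
    by (smt (verit, ccfv_SIG) divide_right_mono mult_right_mono sum_nonneg zero_le_power2)
  show ?thesis by (rule that[of "c0 * K" "\<mu> / 2"]) (use c \<mu> fA fD fT2 in auto)
qed

section \<open>Sparse approximation of Galerkin residuals\<close>

context coercive_operator
begin

lemma gal_error_bound: "norm (T (u - gal S (T u))) \<le> M * sqrt (M / \<alpha>) * norm u"
proof -
  have "norm (T (u - gal S (T u))) \<le> M * norm (u - gal S (T u))" by (rule bounded)
  also have "\<dots> \<le> M * (sqrt (M / \<alpha>) * norm u)"
    using M_pos by (intro mult_left_mono galerkin_stable) auto
  finally show ?thesis by simp
qed

text \<open>Projected Richardson iteration for the Galerkin problem with datum \<open>T v\<close>,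
  in which \<open>T\<close> is replaced by an approximation \<open>B\<close>. If \<open>B\<close> is
  banded, each step enlarges the support by a fixed amount only.\<close>

fun richardson :: "'a set \<Rightarrow> ('a l2 \<Rightarrow> 'a l2) \<Rightarrow> 'a l2 \<Rightarrow> nat \<Rightarrow> 'a l2" where
  "richardson S B v 0 = 0"
| "richardson S B v (Suc i) = richardson S B v i + step *\<^sub>R restr S (B (v - richardson S B v i))"

lemma restr_richardson: "restr S (richardson S B v i) = richardson S B v i"
  by (induction i) simp_all

text \<open>One step contracts the error by \<open>rate\<close> and adds a perturbation of size
  \<open>step * \<delta>\<close> times the distance of the iterate from \<open>v\<close>. That
  distance contains the error itself; for small \<open>\<delta>\<close> this part only worsens the
  factor \<open>rate\<close> to \<open>q\<close>, half way to \<open>1\<close>.\<close>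

lemma richardson_error:
  assumes B: "\<And>x. norm (T x - B x) \<le> \<delta> * norm x" and \<delta>: "0 \<le> \<delta>" "step * \<delta> \<le> (1 - rate) / 2"
  defines "q \<equiv> (1 + rate) / 2"
  shows "norm (gal S (T v) - richardson S B v i)
    \<le> q ^ i * norm (gal S (T v)) + 2 * step * \<delta> * norm (v - gal S (T v)) / (1 - rate)"
proof (induction i)
  case 0
  show ?case using step_pos \<delta> rate_less_1 by simp
next
  case (Suc i)
  define x where "x = gal S (T v)"
  define y where "y = richardson S B v i"
  define c where "c = 2 * step * \<delta> * norm (v - x) / (1 - rate)"
  have q0: "0 \<le> q" using rate_nonneg by (simp add: q_def)
  have rx: "restr S x = x" "restr S (T x) = restr S (T v)" by (simp_all add: x_def restr_gal restr_T_gal)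
  have ry: "restr S y = y" by (simp add: y_def restr_richardson)
  have "x - richardson S B v (Suc i)
      = restr S ((x - y) - step *\<^sub>R T (x - y)) + step *\<^sub>R restr S (T (v - y) - B (v - y))"
    by (simp add: y_def[symmetric] rx ry algebra_simps)
  then have "norm (x - richardson S B v (Suc i))
      \<le> norm (restr S ((x - y) - step *\<^sub>R T (x - y))) + norm (step *\<^sub>R restr S (T (v - y) - B (v - y)))"
    by (metis norm_triangle_ineq)
  also have "\<dots> \<le> rate * norm (x - y) + step * (\<delta> * norm (v - y))"
  proof (rule add_mono)
    show "norm (restr S ((x - y) - step *\<^sub>R T (x - y))) \<le> rate * norm (x - y)"
      by (rule order_trans[OF norm_restr_le richardson_contraction])
    have "norm (step *\<^sub>R restr S (T (v - y) - B (v - y))) = step * norm (restr S (T (v - y) - B (v - y)))"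
      using step_pos by (simp only: norm_scaleR abs_of_pos)
    also have "\<dots> \<le> step * (\<delta> * norm (v - y))"
      using step_pos by (intro mult_left_mono order_trans[OF norm_restr_le B]) auto
    finally show "norm (step *\<^sub>R restr S (T (v - y) - B (v - y))) \<le> step * (\<delta> * norm (v - y))" .
  qed
  also have "\<dots> \<le> rate * norm (x - y) + step * (\<delta> * (norm (v - x) + norm (x - y)))"
    using step_pos \<delta> norm_triangle_ineq[of "v - x" "x - y"]
    by (intro add_left_mono mult_left_mono) auto
  also have "\<dots> = (rate + step * \<delta>) * norm (x - y) + step * \<delta> * norm (v - x)"
    by (simp add: algebra_simps)
  also have "\<dots> \<le> q * norm (x - y) + step * \<delta> * norm (v - x)"
    using \<delta> by (intro add_right_mono mult_right_mono) (auto simp: q_def field_simps)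
  also have "\<dots> \<le> q * (q ^ i * norm x + c) + (1 - q) * c"
  proof -
    have "step * \<delta> * norm (v - x) = (1 - q) * c"
      using rate_less_1 by (simp add: q_def c_def field_simps)
    moreover have "q * norm (x - y) \<le> q * (q ^ i * norm x + c)"
      using Suc q0 by (intro mult_left_mono) (auto simp: x_def y_def c_def)
    ultimately show ?thesis by linarith
  qed
  also have "\<dots> = q ^ Suc i * norm x + c" by (simp add: algebra_simps)
  finally show ?case by (simp add: x_def c_def)
qed

end

definition banded :: "nat \<Rightarrow> ((int ^ 'd::finite) l2 \<Rightarrow> (int ^ 'd) l2) \<Rightarrow> bool" where
  "banded J B \<longleftrightarrow> (\<forall>S x. restr S x = x \<longrightarrow> restr (enrich S J) (B x) = B x)"

lemma banded_mat_op_trunc: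
  fixes A :: "'d::finite imatrix"
  assumes "form_bounded K (mat_trunc J A)"
  shows "banded J (mat_op (mat_trunc J A))"
  unfolding banded_def restr_idem_iff
proof (intro allI impI)
  fix S x and k :: "int ^ 'd" assume x: "\<forall>k. k \<notin> S \<longrightarrow> seq x k = 0" and k: "k \<notin> enrich S J"
  have "mat_trunc J A k j * seq x j = 0" for j
    using x k by (auto simp: mat_trunc_def enrich_def)
  then show "seq (mat_op (mat_trunc J A) x) k = 0" unfolding seq_mat_op[OF assms] by (intro infsum_0) simp
qed

context coercive_operator
begin

lemma richardson_supp:
  fixes B :: "'a l2 \<Rightarrow> 'a l2"
  assumes B: "\<And>S x. restr S x = x \<Longrightarrow> restr (E S) (B x) = B x" and E: "\<And>S. S \<subseteq> E S"
    and v: "restr D v = v"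
  shows "restr ((E ^^ i) D) (richardson S B v i) = richardson S B v i"
    and "restr ((E ^^ Suc i) D) (B (v - richardson S B v i)) = B (v - richardson S B v i)"
proof -
  have mono: "D \<subseteq> (E ^^ i) D" for i by (induction i) (use E in auto)
  have vD: "restr ((E ^^ i) D) v = v" for i by (rule restr_mono[OF v mono])
  show *: "restr ((E ^^ i) D) (richardson S B v i) = richardson S B v i" for i
  proof (induction i)
    case (Suc i)
    define y where "y = richardson S B v i"
    have "restr ((E ^^ Suc i) D) (B (v - y)) = B (v - y)"
      using Suc vD[of i] B[of "(E ^^ i) D" "v - y"] by (simp add: y_def)
    moreover have "restr ((E ^^ Suc i) D) y = y"
      unfolding y_def funpow.simps o_apply by (rule restr_mono[OF Suc E])
    ultimately have "restr ((E ^^ Suc i) D) (y + step *\<^sub>R restr S (B (v - y))) = y + step *\<^sub>R restr S (B (v - y))"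
      unfolding restr_idem_iff by simp
    then show ?case by (simp add: y_def)
  qed simp
  show "restr ((E ^^ Suc i) D) (B (v - richardson S B v i)) = B (v - richardson S B v i)"
    using *[of i] vD[of i] B[of "(E ^^ i) D"] by simp
qed

end

lemma enrich_funpow: "((\<lambda>S. enrich S J) ^^ i) D \<subseteq> enrich D (i * J)"
proof (induction i)
  case (Suc i)
  have "enrich (((\<lambda>S. enrich S J) ^^ i) D) J \<subseteq> enrich (enrich D (i * J)) J"
    using Suc by (force simp: enrich_def)
  also have "\<dots> \<subseteq> enrich D (i * J + J)" by (rule enrich_enrich)
  finally show ?case by (simp add: add.commute)
qed (auto simp: subset_enrich[THEN subsetD])

locale banded_coercive = coercive_operator T \<alpha> M
  for T :: "(int ^ 'd::finite) l2 \<Rightarrow> (int ^ 'd) l2" and \<alpha> M +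
  fixes c \<beta> :: real
  assumes band: "\<And>J. \<exists>B. banded J B \<and> (\<forall>x. norm (T x - B x) \<le> c * exp (- \<beta> * real J) * norm x)"
    and c_pos: "0 < c" and \<beta>_pos: "0 < \<beta>"
begin

text \<open>The approximation \<open>z\<close> applies the truncated operator to the difference of
  \<open>v\<close> and its \<open>m\<close>-th Richardson iterate, both with bandwidth
  \<open>m\<close>; this spreads the support by \<open>(m + 1) * m\<close>. The constants do not
  depend on the index set \<open>S\<close> of the Galerkin problem.\<close>

lemma residual_approx:
  obtains a C where "0 < a" "0 < C"
    "\<And>S D v m. restr D v = v \<Longrightarrow>
       \<exists>z. restr (enrich D ((m + 1) * m)) z = z \<and> norm (T (v - gal S (T v)) - z) \<le> C * exp (- a * real m) * norm v"
proof -
  define q where "q = (1 + rate) / 2"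
  define s where "s = sqrt (M / \<alpha>)"
  have q: "0 < q" "q < 1" using rate_nonneg rate_less_1 by (simp_all add: q_def)
  have s0: "0 \<le> s" using M_pos alpha_pos by (simp add: s_def)
  define a where "a = min \<beta> (- ln q)"
  have a: "0 < a" using \<beta>_pos q by (simp add: a_def)
  obtain m0 :: nat where m0: "\<And>m. m \<ge> m0 \<Longrightarrow> step * (c * exp (- \<beta> * real m)) \<le> (1 - rate) / 2"
  proof -
    have "(\<lambda>m. step * (c * exp (- \<beta> * real m))) \<longlonglongrightarrow> 0"
    proof -
      have "(\<lambda>m. exp (- \<beta>) ^ m) \<longlonglongrightarrow> 0" by (rule LIMSEQ_power_zero) (use \<beta>_pos in simp)
      then have "(\<lambda>m. step * (c * exp (- \<beta>) ^ m)) \<longlonglongrightarrow> step * (c * 0)"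
        by (intro tendsto_mult tendsto_const)
      then show ?thesis by (simp add: exp_of_nat_mult[symmetric] mult.commute)
    qed
    then have "\<forall>\<^sub>F m in sequentially. step * (c * exp (- \<beta> * real m)) < (1 - rate) / 2"
      using rate_less_1 by (intro order_tendstoD) auto
    then show ?thesis using that by (force simp: eventually_sequentially intro: less_imp_le)
  qed
  define C1 where "C1 = (1 + s) + 2 * step * c * s / (1 - rate)"
  have C1: "0 < C1" using s0 step_pos c_pos rate_less_1 by (simp add: C1_def add_pos_nonneg)
  \<comment> \<open>The last summand serves the finitely many \<open>m\<close> below \<open>m0\<close>, for which the residual is approximated by \<open>0\<close>.\<close>
  define C where "C = M * C1 + c * (s + C1) + M * s * exp (a * real m0)"
  have Cpos: "0 < C" using C1 s0 c_pos M_pos by (simp add: C_def add_pos_nonneg)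
  show ?thesis
  proof (rule that[OF a Cpos])
    fix S D :: "(int ^ 'd) set" and v :: "(int ^ 'd) l2" and m :: nat
    assume v: "restr D v = v"
    show "\<exists>z. restr (enrich D ((m + 1) * m)) z = z \<and> norm (T (v - gal S (T v)) - z) \<le> C * exp (- a * real m) * norm v"
    proof (cases "m \<ge> m0")
      case False
      have "norm (T (v - gal S (T v)) - 0) \<le> M * s * norm v"
        using gal_error_bound[of v S] by (simp add: s_def)
      also have "M * s * 1 \<le> M * s * (exp (a * real m0) * exp (- a * real m))"
        using False a M_pos s0 by (intro mult_left_mono) (auto simp: exp_add[symmetric])
      then have "M * s * norm v \<le> M * s * exp (a * real m0) * exp (- a * real m) * norm v"
        by (intro mult_right_mono) auto
      also have "\<dots> \<le> C * exp (- a * real m) * norm v"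
        unfolding C_def using C1 M_pos c_pos s0 by (intro mult_right_mono) auto
      finally show ?thesis by (intro exI[of _ 0]) auto
    next
      case True
      obtain B where B: "banded m B" "\<And>x. norm (T x - B x) \<le> c * exp (- \<beta> * real m) * norm x"
        using band[of m] by blast
      define \<delta> where "\<delta> = c * exp (- \<beta> * real m)"
      define x where "x = gal S (T v)"
      define y where "y = richardson S B v m"
      define r where "r = exp (- a * real m)"
      have r: "0 < r" "r \<le> 1" using a by (simp_all add: r_def)
      have d0: "0 \<le> \<delta>" using c_pos by (simp add: \<delta>_def)
      have dr: "\<delta> \<le> c * r"
        unfolding \<delta>_def r_def using c_pos by (intro mult_left_mono) (auto simp: a_def mult_right_mono)
      have dc: "\<delta> \<le> c" using dr r c_pos by (smt (verit) mult_left_le)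
      have qm: "q ^ m \<le> r"
      proof -
        have "q ^ m = exp (ln q * real m)" using q by (simp add: exp_of_nat_mult mult.commute)
        also have "ln q * real m \<le> - a * real m" by (rule mult_right_mono) (auto simp: a_def)
        then have "exp (ln q * real m) \<le> r" by (simp add: r_def)
        finally show ?thesis .
      qed
      have vx: "norm (v - x) \<le> s * norm v" unfolding x_def s_def by (rule galerkin_stable)
      have nx: "norm x \<le> (1 + s) * norm v"
        using norm_triangle_ineq4[of v "v - x"] vx by (simp add: algebra_simps)
      have xy: "norm (x - y) \<le> C1 * r * norm v"
      proof -
        have "norm (x - y) \<le> q ^ m * norm x + 2 * step * \<delta> * norm (v - x) / (1 - rate)"
          unfolding x_def y_def q_def
          by (rule richardson_error) (use B m0[OF True] d0 in \<open>auto simp: \<delta>_def\<close>)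
        also have "\<dots> \<le> r * ((1 + s) * norm v) + 2 * step * (c * r) * (s * norm v) / (1 - rate)"
          using rate_less_1 step_pos c_pos r q d0
          by (intro add_mono mult_mono divide_right_mono qm nx vx mult_left_mono dr) auto
        finally show ?thesis by (simp add: C1_def algebra_simps add_divide_distrib)
      qed
      have vy: "norm (v - y) \<le> (s + C1) * norm v"
      proof -
        have "norm (v - y) \<le> norm (v - x) + norm (x - y)" using norm_triangle_ineq[of "v - x" "x - y"] by simp
        also have "C1 * r * norm v \<le> C1 * 1 * norm v" using C1 r by (intro mult_right_mono mult_left_mono) auto
        then have "norm (v - x) + norm (x - y) \<le> s * norm v + C1 * norm v" using vx xy by linarith
        finally show ?thesis by (simp add: algebra_simps)
      qed
      have "T (v - x) - B (v - y) = T (y - x) + (T (v - y) - B (v - y))" by (simp add: algebra_simps)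
      then have "norm (T (v - x) - B (v - y)) \<le> norm (T (y - x)) + norm (T (v - y) - B (v - y))"
        by (metis norm_triangle_ineq)
      also have "\<dots> \<le> M * norm (x - y) + \<delta> * norm (v - y)"
        using bounded[of "y - x"] B(2)[of "v - y"] by (simp add: \<delta>_def norm_minus_commute)
      also have "\<dots> \<le> M * (C1 * r * norm v) + (c * r) * ((s + C1) * norm v)"
        using M_pos d0 c_pos r by (intro add_mono mult_mono xy vy dr) auto
      also have "\<dots> = (M * C1 + c * (s + C1)) * r * norm v" by (simp add: algebra_simps)
      also have "\<dots> \<le> C * r * norm v"
        unfolding C_def using M_pos s0 r by (intro mult_right_mono) auto
      finally have "norm (T (v - x) - B (v - y)) \<le> C * r * norm v" .
      moreover have "restr (enrich D ((m + 1) * m)) (B (v - y)) = B (v - y)"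
      proof (rule restr_mono)
        show "restr (((\<lambda>S. enrich S m) ^^ Suc m) D) (B (v - y)) = B (v - y)"
          unfolding y_def by (rule richardson_supp(2)[OF _ subset_enrich v]) (use B in \<open>simp add: banded_def\<close>)
        show "((\<lambda>S. enrich S m) ^^ Suc m) D \<subseteq> enrich D ((m + 1) * m)"
          using enrich_funpow[where i="Suc m" and J=m and D=D] by simp
      qed
      ultimately show ?thesis unfolding r_def x_def by blast
    qed
  qed
qed

text \<open>Split \<open>u\<close> into a best approximation with \<open>N\<close> indices, whose
  residual is approximated as above, and a remainder, whose residual is bounded by its norm. Of the
  \<open>N'\<close> available indices, \<open>N * (5 * m^2) ^ d\<close> are used. For both errors to
  decay like \<open>exp (- e * X powr s)\<close> one takes \<open>N\<close> close to
  \<open>X\<close> and \<open>m\<close> close to \<open>X powr s\<close>, which gives \<open>X powr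
  (1 + 2 * d * s) = N' / 5 ^ d\<close>.\<close>

lemma residual_sparsity_class:
  assumes b: "0 < b" and s: "0 < s" "s \<le> 1" 
  defines "s' \<equiv> s / (1 + 2 * real CARD('d) * s)"
  obtains b' K where "0 < b'" "0 < K"
    "\<And>u W S N. (\<And>n. best_l2_err n u * exp (b * real n powr s) \<le> W) \<Longrightarrow>
       best_l2_err N (T (u - gal S (T u))) * exp (b' * real N powr s') \<le> K * W"
proof -
  define d where "d = CARD('d)"
  define c1 where "c1 = M * sqrt (M / \<alpha>)"
  have c1: "0 < c1" using M_pos alpha_pos by (simp add: c1_def)
  obtain a C where a: "0 < a" and C: "0 < C" and approx:
    "\<And>S D v m. restr D v = v \<Longrightarrow>
       \<exists>z. restr (enrich D ((m + 1) * m)) z = z \<and> norm (T (v - gal S (T v)) - z) \<le> C * exp (- a * real m) * norm v"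
    using residual_approx by blast
  define e where "e = min a b"
  define b' where "b' = e * (1 / 5 ^ d) powr s'"
  define K where "K = 2 * c1 * exp b + C * exp a"
  have e: "0 < e" "e \<le> a" "e \<le> b" using a b by (auto simp: e_def)
  have b': "0 < b'" using e by (simp add: b'_def)
  have K: "0 < K" using c1 C by (simp add: K_def add_pos_pos)
  show ?thesis
  proof (rule that[OF b' K])
    fix u :: "(int ^ 'd) l2" and W and S :: "(int ^ 'd) set" and N'
    assume W: "\<And>n. best_l2_err n u * exp (b * real n powr s) \<le> W"
    have uW: "norm u \<le> W" using W[of 0] s by (simp add: best_l2_err_0)
    show "best_l2_err N' (T (u - gal S (T u))) * exp (b' * real N' powr s') \<le> K * W"
    proof (cases "W = 0")
      case True
      then have "u = 0" using uW by simp
      then have "gal S (T u) = 0" by (intro gal_unique) auto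
      then have "best_l2_err N' (T (u - gal S (T u))) \<le> norm (0 :: (int ^ 'd) l2)"
        using \<open>u = 0\<close> best_l2_err_le_supp[OF infinite_lattice, of "{}" N' 0 0] by simp
      then show ?thesis using True by (simp add: mult_le_0_iff)
    next
      case False
      then have Wp: "0 < W" using uW norm_ge_zero[of u] by linarith
      define X where "X = (real N' / 5 ^ d) powr (1 / (1 + 2 * real d * s))"
      define N where "N = nat \<lfloor>X\<rfloor>"
      define m where "m = nat \<lfloor>X powr s\<rfloor>"
      have X0: "0 \<le> X" by (simp add: X_def)
      have N: "real N \<le> X" "X < real N + 1" using X0 unfolding N_def by linarith+
      have m: "real m \<le> X powr s" "X powr s < real m + 1"
        unfolding m_def using powr_ge_zero[of X s] by linarith+
      have card_le: "N * (2 * ((m + 1) * m) + 1) ^ d \<le> N'"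
      proof (cases "N = 0")
        case False
        then have X1: "1 \<le> X" using N by linarith
        then have m1: "1 \<le> m" using s unfolding m_def by (simp add: le_nat_iff ge_one_powr_ge_zero)
        have "2 * ((m + 1) * m) + 1 \<le> 5 * m ^ 2"
        proof -
          have "2 * (k + m) + 1 \<le> 5 * k" if "m \<le> k" "1 \<le> k" for k using that by presburger
          from this[of "m * m"] show ?thesis using m1 by (simp add: power2_eq_square)
        qed
        then have "real (2 * ((m + 1) * m) + 1) \<le> real (5 * m ^ 2)" by (simp only: of_nat_le_iff)
        also have "\<dots> = 5 * (real m) ^ 2" by simp
        also have "\<dots> \<le> 5 * (X powr s) ^ 2" using m by (intro mult_left_mono power_mono) auto
        finally have "real (2 * ((m + 1) * m) + 1) ^ d \<le> (5 * (X powr s) ^ 2) ^ d"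
          by (intro power_mono) auto
        also have "\<dots> = 5 ^ d * X powr (2 * real d * s)"
          using X1 by (simp add: power_mult_distrib power_mult[symmetric] powr_power mult_ac)
        finally have "real N * real (2 * ((m + 1) * m) + 1) ^ d \<le> X * (5 ^ d * X powr (2 * real d * s))"
          using N X0 by (intro mult_mono) auto
        also have "\<dots> = 5 ^ d * X powr (1 + 2 * real d * s)"
          using X1 by (simp add: powr_add)
        also have "\<dots> = real N'"
        proof -
          have "1 + 2 * real d * s > 0" using s by (simp add: add_pos_nonneg)
          then show ?thesis by (simp add: X_def powr_powr)
        qed
        finally have "real (N * (2 * ((m + 1) * m) + 1) ^ d) \<le> real N'" by simp
        then show ?thesis by (simp only: of_nat_le_iff)
      qed simp
      \<comment> \<open>The best error need not be attained; the factor \<open>2\<close> makes room for an approximate minimizer.\<close>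
      have "best_l2_err N u < 2 * W * exp (- b * real N powr s)"
      proof -
        have "best_l2_err N u \<le> W * exp (- b * real N powr s)"
          using W[of N] by (simp add: exp_minus field_simps)
        also have "\<dots> < 2 * W * exp (- b * real N powr s)" using Wp by simp
        finally show ?thesis .
      qed
      then obtain D where D: "finite D" "card D = N" "norm (u - restr D u) < 2 * W * exp (- b * real N powr s)"
        by (rule best_l2_err_less_obtain[OF infinite_lattice])
      define v where "v = restr D u"
      have v: "restr D v = v" by (simp add: v_def)
      obtain z where z: "restr (enrich D ((m + 1) * m)) z = z"
        "norm (T (v - gal S (T v)) - z) \<le> C * exp (- a * real m) * norm v"
        using approx[OF v] by blast
      have cd: "card (enrich D ((m + 1) * m)) \<le> N'"
        using card_enrich[OF D(1), of "(m + 1) * m"] card_le D(2) by (simp only: d_def)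
      have "best_l2_err N' (T (u - gal S (T u))) \<le> norm (T (u - gal S (T u)) - z)"
        by (rule best_l2_err_le_supp[OF infinite_lattice finite_enrich[OF D(1)] cd z(1)])
      also have "T (u - gal S (T u)) - z = T ((u - v) - gal S (T (u - v))) + (T (v - gal S (T v)) - z)"
        by (simp add: gal_diff)
      also have "norm \<dots> \<le> norm (T ((u - v) - gal S (T (u - v)))) + norm (T (v - gal S (T v)) - z)"
        by (rule norm_triangle_ineq)
      also have "\<dots> \<le> c1 * (2 * W * exp (- b * real N powr s)) + C * exp (- a * real m) * W"
      proof (rule add_mono)
        have "norm (T ((u - v) - gal S (T (u - v)))) \<le> c1 * norm (u - v)"
          unfolding c1_def by (rule gal_error_bound)
        also have "\<dots> \<le> c1 * (2 * W * exp (- b * real N powr s))"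
          using D c1 by (intro mult_left_mono) (auto simp: v_def)
        finally show "norm (T ((u - v) - gal S (T (u - v)))) \<le> c1 * (2 * W * exp (- b * real N powr s))" .
        have "norm v \<le> W" using norm_restr_le[of D u] uW by (simp add: v_def)
        then show "norm (T (v - gal S (T v)) - z) \<le> C * exp (- a * real m) * W"
          using C by (intro order_trans[OF z(2)] mult_left_mono) auto
      qed
      also have "\<dots> \<le> c1 * (2 * W * (exp b * exp (- e * X powr s))) + C * (exp a * exp (- e * X powr s)) * W"
      proof -
        have "X powr s \<le> (real N + 1) powr s" using N X0 s by (intro powr_mono2) auto
        also have "\<dots> \<le> real N powr s + 1"
        proof -
          have "(real N powr s) powr (1 / s) + 1 powr (1 / s) \<le> (real N powr s + 1) powr (1 / s)"
            using s by (intro powr_superadditive) auto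
          then have "(real N + 1) powr s \<le> ((real N powr s + 1) powr (1 / s)) powr s"
            using s by (intro powr_mono2) (auto simp: powr_powr)
          then show ?thesis using s by (simp add: powr_powr add_nonneg_nonneg)
        qed
        finally have "e * X powr s \<le> b * (real N powr s + 1)"
          using e b by (intro mult_mono) auto
        then have 1: "exp (- b * real N powr s) \<le> exp b * exp (- e * X powr s)"
          by (simp add: exp_add[symmetric] algebra_simps)
        have "e * X powr s \<le> a * (real m + 1)" using e a m by (intro mult_mono) auto
        then have 2: "exp (- a * real m) \<le> exp a * exp (- e * X powr s)"
          by (simp add: exp_add[symmetric] algebra_simps)
        show ?thesis using 1 2 c1 C Wp by (intro add_mono mult_left_mono mult_right_mono) auto
      qed
      also have "\<dots> = K * W * exp (- e * X powr s)" by (simp add: K_def algebra_simps)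
      also have "e * X powr s = b' * real N' powr s'"
      proof -
        have "X powr s = (real N' * (1 / 5 ^ d)) powr s'"
          by (simp add: X_def powr_powr s'_def d_def)
        also have "\<dots> = real N' powr s' * (1 / 5 ^ d) powr s'" by (rule powr_mult)
        finally show ?thesis by (simp add: b'_def)
      qed
      then have "- e * X powr s = - (b' * real N' powr s')" by simp
      finally have "best_l2_err N' (T (u - gal S (T u))) \<le> K * W * exp (- (b' * real N' powr s'))" by simp
      then have "best_l2_err N' (T (u - gal S (T u))) * exp (b' * real N' powr s')
          \<le> K * W * exp (- (b' * real N' powr s')) * exp (b' * real N' powr s')"
        by (rule mult_right_mono) simp
      also have "\<dots> = K * W" by (simp add: exp_minus)
      finally show ?thesis .
    qed
  qed
qed

end

section \<open>The torus\<close>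

text \<open>Functions on the torus are integrated over the open fundamental cell.\<close>

definition tor :: "(real ^ 'd::finite) measure" where
  "tor = restrict_space lborel Omega"

lemma Omega_sets [measurable, simp]: "Omega \<in> sets borel"
  by (simp add: Omega_def)

lemma in_Omega: "x \<in> Omega \<longleftrightarrow> (\<forall>i. 0 < x $ i \<and> x $ i < 2 * pi)"
  by (simp add: Omega_def mem_box_cart)

lemma space_tor [simp]: "space tor = Omega"
  by (simp add: tor_def space_restrict_space)

lemma measurable_tor [measurable (raw)]: "f \<in> measurable borel N \<Longrightarrow> f \<in> measurable tor N"
  unfolding tor_def by (rule measurable_restrict_space1) simp

lemma LINT_tor:
  fixes f :: "real ^ 'd::finite \<Rightarrow> 'b::{banach, second_countable_topology}"
  shows "(LINT x:Omega|lborel. f x) = (\<integral>x. f x \<partial>tor)"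
  unfolding tor_def set_lebesgue_integral_def by (subst integral_restrict_space) auto

lemma set_integrable_tor:
  fixes f :: "real ^ 'd::finite \<Rightarrow> 'b::{banach, second_countable_topology}"
  shows "set_integrable lborel Omega f \<longleftrightarrow> integrable tor f"
  unfolding tor_def set_integrable_def by (subst integrable_restrict_space) auto

lemma AE_tor: "(AE x in tor. P x) \<longleftrightarrow> (AE x in lborel. x \<in> Omega \<longrightarrow> P x)"
  unfolding tor_def by (rule AE_restrict_space_iff) simp

interpretation tor: finite_measure "tor :: (real ^ 'd::finite) measure"
proof
  have "emeasure (tor :: (real ^ 'd) measure) (space tor) = emeasure lborel (Omega :: (real ^ 'd) set)"
    by (simp add: tor_def emeasure_restrict_space)
  also have "\<dots> < \<infinity>" unfolding Omega_def by (rule emeasure_lborel_box_finite)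
  finally show "emeasure (tor :: (real ^ 'd) measure) (space tor) \<noteq> \<infinity>" by simp
qed

lemma measure_tor: "measure (tor :: (real ^ 'd::finite) measure) Omega = (2 * pi) ^ CARD('d)"
proof -
  have "measure (tor :: (real ^ 'd) measure) Omega = measure lborel (Omega :: (real ^ 'd) set)"
    unfolding tor_def by (rule measure_restrict_space) auto
  also have "\<dots> = (\<Prod>b\<in>(Basis :: (real ^ 'd) set). 2 * pi)"
  proof -
    have b: "(vec (2 * pi) :: real ^ 'd) \<bullet> b = 2 * pi" if "b \<in> Basis" for b
      using that by (auto simp: Basis_vec_def inner_axis)
    show ?thesis unfolding Omega_def by (subst measure_lborel_box_eq) (simp_all add: b)
  qed
  finally show ?thesis by simp
qed

lemma L2p_iff: "v \<in> L2p \<longleftrightarrow> v \<in> borel_measurable borel \<and> periodic v \<and> integrable tor (\<lambda>x. (cmod (v x))\<^sup>2)"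
  by (simp add: L2p_def set_integrable_tor)

lemma L2p_measurable: "v \<in> L2p \<Longrightarrow> v \<in> borel_measurable borel"
  by (simp add: L2p_iff)

lemma fcoeff_tor: "fcoeff v k = (\<integral>x. v x * cnj (phi k x) \<partial>tor)"
  by (simp add: fcoeff_def LINT_tor)

text \<open>With the free parameter \<open>e\<close> this replaces the Cauchy-Schwarz inequality for
  integrals.\<close>

lemma young: "a * b \<le> (e * a\<^sup>2 + b\<^sup>2 / e) / 2" if "0 < e" for a b e :: real
proof -
  have "0 \<le> (e * a - b)\<^sup>2 / e" using that by simp
  also have "\<dots> = e * a\<^sup>2 + b\<^sup>2 / e - 2 * (a * b)"
    using that by (simp add: power2_eq_square field_simps)
  finally show ?thesis by simp
qed

lemma L2p_mult_integrable:
  assumes u: "u \<in> L2p" and v: "v \<in> L2p" and g: "g \<in> borel_measurable borel" "\<And>x. cmod (g x) \<le> c"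
  shows "integrable tor (\<lambda>x. g x * u x * v x)"
proof (rule Bochner_Integration.integrable_bound)
  show "integrable tor (\<lambda>x. c * ((cmod (u x))\<^sup>2 + (cmod (v x))\<^sup>2))"
    using u v by (intro integrable_mult_right Bochner_Integration.integrable_add) (auto simp: L2p_iff)
  show "(\<lambda>x. g x * u x * v x) \<in> borel_measurable tor"
    using u v g by (intro measurable_tor borel_measurable_times) (auto simp: L2p_iff)
  show "AE x in tor. norm (g x * u x * v x) \<le> norm (c * ((cmod (u x))\<^sup>2 + (cmod (v x))\<^sup>2))"
  proof (intro AE_I2)
    fix x
    have c: "0 \<le> c" using g(2)[of x] norm_ge_zero[of "g x"] by linarith
    have "cmod (u x) * cmod (v x) \<le> (cmod (u x))\<^sup>2 + (cmod (v x))\<^sup>2"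
      using young[of 1 "cmod (u x)" "cmod (v x)"] by (simp add: field_simps) (smt (verit) zero_le_power2)
    then have "cmod (g x) * (cmod (u x) * cmod (v x)) \<le> c * ((cmod (u x))\<^sup>2 + (cmod (v x))\<^sup>2)"
      using c g(2)[of x] by (intro mult_mono) auto
    then show "norm (g x * u x * v x) \<le> norm (c * ((cmod (u x))\<^sup>2 + (cmod (v x))\<^sup>2))"
      using c by (simp add: norm_mult mult.assoc)
  qed
qed

lemma L2p_prod_integrable: "u \<in> L2p \<Longrightarrow> v \<in> L2p \<Longrightarrow> integrable tor (\<lambda>x. u x * v x)"
  using L2p_mult_integrable[of u v "\<lambda>_. 1" 1] by simp

lemma periodicD: "periodic v \<Longrightarrow> v (x + axis i (2 * pi)) = v x"
  by (simp add: periodic_def)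

lemma L2p_cnj: "v \<in> L2p \<Longrightarrow> (\<lambda>x. cnj (v x)) \<in> L2p"
  by (auto simp: L2p_iff periodic_def bounded_linear_cnj
      intro!: borel_measurable_continuous_on[OF linear_continuous_on[OF bounded_linear_cnj]])

lemma L2p_mult:
  assumes v: "v \<in> L2p" and g: "g \<in> borel_measurable borel" "\<And>x. cmod (g x) \<le> c" "periodic g"
  shows "(\<lambda>x. g x * v x) \<in> L2p"
  unfolding L2p_iff
proof (intro conjI)
  show "(\<lambda>x. g x * v x) \<in> borel_measurable borel" using v g by (auto simp: L2p_iff)
  show "periodic (\<lambda>x. g x * v x)" using v g by (auto simp: L2p_iff periodic_def)
  show "integrable tor (\<lambda>x. (cmod (g x * v x))\<^sup>2)"
  proof (rule Bochner_Integration.integrable_bound)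
    show "integrable tor (\<lambda>x. c\<^sup>2 * (cmod (v x))\<^sup>2)" using v by (auto simp: L2p_iff)
    show "(\<lambda>x. (cmod (g x * v x))\<^sup>2) \<in> borel_measurable tor"
      using v g by (intro measurable_tor) (auto simp: L2p_iff)
    have "(cmod (g x))\<^sup>2 \<le> c\<^sup>2" for x using g by (intro power_mono) auto
    then show "AE x in tor. norm ((cmod (g x * v x))\<^sup>2) \<le> norm (c\<^sup>2 * (cmod (v x))\<^sup>2)"
      by (intro AE_I2) (auto simp: norm_mult power_mult_distrib intro!: mult_right_mono)
  qed
qed

lemma L2p_scale: "v \<in> L2p \<Longrightarrow> (\<lambda>x. c * v x) \<in> L2p"
  by (rule L2p_mult[where c="cmod c"]) (auto simp: periodic_def)

lemma L2p_add:
  assumes u: "u \<in> L2p" and v: "v \<in> L2p"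
  shows "(\<lambda>x. u x + v x) \<in> L2p"
  unfolding L2p_iff
proof (intro conjI)
  show "(\<lambda>x. u x + v x) \<in> borel_measurable borel" using u v by (auto simp: L2p_iff)
  show "periodic (\<lambda>x. u x + v x)" using u v by (auto simp: L2p_iff periodic_def)
  show "integrable tor (\<lambda>x. (cmod (u x + v x))\<^sup>2)"
  proof (rule Bochner_Integration.integrable_bound)
    show "integrable tor (\<lambda>x. 2 * ((cmod (u x))\<^sup>2 + (cmod (v x))\<^sup>2))"
      using u v by (auto simp: L2p_iff)
    show "(\<lambda>x. (cmod (u x + v x))\<^sup>2) \<in> borel_measurable tor"
      using u v by (intro measurable_tor) (auto simp: L2p_iff)
    have "(cmod (u x + v x))\<^sup>2 \<le> 2 * ((cmod (u x))\<^sup>2 + (cmod (v x))\<^sup>2)" for x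
    proof -
      have "(cmod (u x + v x))\<^sup>2 \<le> (cmod (u x) + cmod (v x))\<^sup>2"
        by (intro power_mono norm_triangle_ineq) auto
      also have "\<dots> \<le> 2 * ((cmod (u x))\<^sup>2 + (cmod (v x))\<^sup>2)"
        using sum_squares_bound[of "cmod (u x)" "cmod (v x)"] by (simp add: power2_sum)
      finally show ?thesis .
    qed
    then show "AE x in tor. norm ((cmod (u x + v x))\<^sup>2) \<le> norm (2 * ((cmod (u x))\<^sup>2 + (cmod (v x))\<^sup>2))"
      by (intro AE_I2) simp
  qed
qed

lemma L2p_zero: "(\<lambda>_. 0) \<in> L2p"
  by (simp add: L2p_iff periodic_def)

lemma L2p_sum: "(\<And>i. i \<in> I \<Longrightarrow> f i \<in> L2p) \<Longrightarrow> (\<lambda>x. \<Sum>i\<in>I. f i x) \<in> L2p"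
  by (induction I rule: infinite_finite_induct) (auto intro: L2p_add L2p_zero)

lemma L2p_diff: "u \<in> L2p \<Longrightarrow> v \<in> L2p \<Longrightarrow> (\<lambda>x. u x - v x) \<in> L2p"
  using L2p_add[of u "\<lambda>x. - 1 * v x"] L2p_scale[of v "-1"] by simp

section \<open>Periodic functions and the circle map\<close>

text \<open>The quotient map from \<open>R^d\<close> to the torus, realized as a compact subset of
  \<open>C^d\<close>. There the Stone-Weierstrass theorem applies, and distances to compact sets are
  continuous periodic functions.\<close>

definition circle_map :: "real ^ 'd::finite \<Rightarrow> complex ^ 'd" where
  "circle_map x = (\<chi> i. cis (x $ i))"

definition cube :: "(real ^ 'd::finite) set" where
  "cube = cbox 0 (vec (2 * pi))"

lemma in_cube: "x \<in> cube \<longleftrightarrow> (\<forall>i. 0 \<le> x $ i \<and> x $ i \<le> 2 * pi)"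
  by (simp add: cube_def mem_box_cart)

lemma periodic_int_axis:
  assumes "periodic v"
  shows "v (x + axis i (2 * pi * of_int n)) = v x"
proof -
  have nat: "v (y + axis i (2 * pi * real m)) = v y" for y and m :: nat
  proof (induction m arbitrary: y)
    case 0
    have "y + axis i (2 * pi * real 0) = y" by (simp add: axis_def vec_eq_iff)
    then show ?case by metis
  next
    case (Suc m)
    have "y + axis i (2 * pi * real (Suc m)) = (y + axis i (2 * pi * real m)) + axis i (2 * pi)"
      by (simp add: axis_def vec_eq_iff algebra_simps)
    then show ?case using Suc periodicD[OF assms] by metis
  qed
  show ?thesis
  proof (cases "0 \<le> n")
    case True
    then show ?thesis using nat[of x "nat n"] by simp
  next
    case False
    have "v ((x + axis i (2 * pi * of_int n)) + axis i (2 * pi * real (nat (- n)))) = v (x + axis i (2 * pi * of_int n))"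
      by (rule nat)
    moreover have "(x + axis i (2 * pi * of_int n)) + axis i (2 * pi * real (nat (- n))) = x"
      using False by (simp add: axis_def vec_eq_iff algebra_simps)
    ultimately show ?thesis by simp
  qed
qed

lemma periodic_lattice:
  assumes "periodic v"
  shows "v (x + (2 * pi) *\<^sub>R rvec n) = v x"
proof -
  have "v (x + (\<Sum>i\<in>I. axis i (2 * pi * of_int (n $ i)))) = v x" if "finite I" for I
    using that
  proof (induction I arbitrary: x)
    case (insert i I)
    have "x + (\<Sum>i\<in>insert i I. axis i (2 * pi * of_int (n $ i)))
        = (x + axis i (2 * pi * of_int (n $ i))) + (\<Sum>i\<in>I. axis i (2 * pi * of_int (n $ i)))"
      using insert by (simp add: add.assoc)
    then show ?case by (simp only: insert.IH periodic_int_axis[OF assms])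
  qed simp
  moreover have "(\<Sum>i\<in>UNIV. axis i (2 * pi * of_int (n $ i))) = (2 * pi) *\<^sub>R rvec n"
    by (simp add: vec_eq_iff rvec_def axis_def if_distrib cong: if_cong)
  ultimately show ?thesis by (metis finite_class.finite_UNIV)
qed

lemma circle_map_eqD:
  assumes "circle_map x = circle_map y"
  obtains n where "x = y + (2 * pi) *\<^sub>R rvec n"
proof -
  have "\<exists>n::int. x $ i = y $ i + 2 * pi * of_int n" for i
  proof -
    have "cis (x $ i) = cis (y $ i)" using assms by (simp add: circle_map_def vec_eq_iff)
    then have "sin (x $ i) = sin (y $ i) \<and> cos (x $ i) = cos (y $ i)" by (metis cis.sel)
    then show ?thesis by (simp add: sin_cos_eq_iff)
  qed
  then obtain m where "\<And>i. x $ i = y $ i + 2 * pi * of_int (m i)" by metis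
  then have "x = y + (2 * pi) *\<^sub>R rvec (\<chi> i. m i)" by (simp add: vec_eq_iff rvec_def)
  then show ?thesis by (rule that)
qed

lemma circle_map_periodic: "circle_map (x + axis i (2 * pi)) = circle_map x"
  by (simp add: circle_map_def vec_eq_iff axis_def flip: cis_mult)

lemma circle_map_in_image_cube: "circle_map x \<in> circle_map ` cube"
proof -
  define y where "y = (\<chi> i. x $ i + 2 * pi * of_int (- \<lfloor>x $ i / (2 * pi)\<rfloor>))"
  have "circle_map y = circle_map x" by (simp add: circle_map_def y_def vec_eq_iff flip: cis_mult cis_divide)
  moreover have "y \<in> cube"
    unfolding in_cube
  proof
    fix i
    have "of_int \<lfloor>x $ i / (2 * pi)\<rfloor> * (2 * pi) \<le> x $ i"
      by (rule iffD1[OF pos_le_divide_eq[of "2 * pi"]]) auto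
    moreover have "x $ i \<le> (of_int \<lfloor>x $ i / (2 * pi)\<rfloor> + 1) * (2 * pi)"
      by (rule iffD1[OF pos_divide_le_eq[of "2 * pi"]]) (simp, linarith)
    ultimately show "0 \<le> y $ i \<and> y $ i \<le> 2 * pi" by (simp add: y_def algebra_simps)
  qed
  ultimately show ?thesis by (metis imageI)
qed

lemma continuous_on_circle_map: "continuous_on A circle_map"
  unfolding circle_map_def by (intro continuous_intros continuous_on_cis)

lemma compact_circle_map_cube: "compact (circle_map ` cube)"
  by (intro compact_continuous_image continuous_on_circle_map) (simp add: cube_def)

text \<open>The cube is compact, so the quotient map is closed on it, and preimages of closed sets
  under the induced function are images of compact sets.\<close>

lemma circle_map_factor:
  fixes v :: "real ^ 'd::finite \<Rightarrow> 'b::topological_space"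
  assumes v: "periodic v" "continuous_on UNIV v"
  obtains H where "continuous_on (circle_map ` cube) H" "\<And>x. H (circle_map x) = v x"
proof -
  define H where "H z = v (SOME x. circle_map x = z)" for z
  have H: "H (circle_map x) = v x" for x
  proof -
    have "circle_map (SOME y. circle_map y = circle_map x) = circle_map x" by (rule someI) simp
    then obtain n where "(SOME y. circle_map y = circle_map x) = x + (2 * pi) *\<^sub>R rvec n" by (rule circle_map_eqD)
    then show ?thesis by (simp add: H_def periodic_lattice[OF v(1)])
  qed
  have "continuous_on (circle_map ` cube) H"
    unfolding continuous_on_closed_vimage[OF compact_imp_closed[OF compact_circle_map_cube]]
  proof (intro allI impI)
    fix B :: "'b set" assume "closed B"
    then have "closed (v -` B)" using v by (simp add: closed_vimage continuous_on_eq_continuous_within)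
    then have "compact (cube \<inter> v -` B)" by (intro compact_Int_closed) (simp add: cube_def)
    then have "compact (circle_map ` (cube \<inter> v -` B))"
      by (intro compact_continuous_image continuous_on_circle_map)
    moreover have "H -` B \<inter> circle_map ` cube = circle_map ` (cube \<inter> v -` B)" by (auto simp: H)
    ultimately show "closed (H -` B \<inter> circle_map ` cube)" by (simp add: compact_imp_closed)
  qed
  then show ?thesis using H by (rule that)
qed

lemma continuous_periodic_bounded:
  fixes v :: "real ^ 'd::finite \<Rightarrow> 'b::real_normed_vector"
  assumes "periodic v" "continuous_on UNIV v"
  obtains c where "0 < c" "\<And>x. norm (v x) \<le> c"
proof -
  obtain H where H: "continuous_on (circle_map ` cube) H" "\<And>x. H (circle_map x) = v x"
    using circle_map_factor[OF assms] by blast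
  have "bounded (H ` (circle_map ` cube))"
    by (rule compact_imp_bounded[OF compact_continuous_image[OF H(1) compact_circle_map_cube]])
  then obtain c where "0 < c" "\<And>z. z \<in> circle_map ` cube \<Longrightarrow> norm (H z) \<le> c"
    by (auto simp: bounded_pos)
  then show ?thesis using that H(2) circle_map_in_image_cube by metis
qed

lemma continuous_periodic_L2p:
  assumes "periodic v" "continuous_on UNIV v"
  shows "v \<in> L2p"
proof -
  have m: "v \<in> borel_measurable borel" using assms by (simp add: borel_measurable_continuous_onI)
  obtain c where c: "0 < c" "\<And>x. norm (v x) \<le> c" using continuous_periodic_bounded[OF assms] by blast
  have "integrable tor (\<lambda>x. (cmod (v x))\<^sup>2)"
  proof (rule tor.integrable_const_bound[where B="c\<^sup>2"])
    show "AE x in tor. norm ((cmod (v x))\<^sup>2) \<le> c\<^sup>2"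
      using c by (intro AE_I2) (auto intro: power_mono)
    show "(\<lambda>x. (cmod (v x))\<^sup>2) \<in> borel_measurable tor"
      using m by (intro measurable_tor) auto
  qed
  then show ?thesis using assms m by (simp add: L2p_iff)
qed

lemma integral_translate:
  fixes f :: "real ^ 'd::finite \<Rightarrow> 'b::{banach, second_countable_topology}"
  assumes "f \<in> borel_measurable borel"
  shows "(\<integral>x. f (s + x) \<partial>lborel) = (\<integral>x. f x \<partial>lborel)"
proof -
  have "(\<integral>x. f x \<partial>lborel) = (\<integral>x. f x \<partial>distr lborel borel ((+) s))" by (simp add: lborel_distr_plus)
  also have "\<dots> = (\<integral>x. f (s + x) \<partial>lborel)" using assms by (intro integral_distr) auto
  finally show ?thesis by simp
qed

lemma AE_component_neq: "AE x in lborel. (x :: real ^ 'd::finite) $ i \<noteq> c"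
proof -
  have "negligible {x :: real ^ 'd. x $ i = c}" 
    using negligible_standard_hyperplane[of "axis i (1::real)" c] by (simp add: axis_in_Basis_iff inner_axis)
  then have "{x :: real ^ 'd. x $ i = c} \<in> null_sets lebesgue" by (simp add: negligible_iff_null_sets)
  moreover have "{x :: real ^ 'd. x $ i = c} \<in> sets borel" by simp
  ultimately have "{x :: real ^ 'd. x $ i = c} \<in> null_sets lborel"
    by (metis null_sets_completion_iff sets_lborel)
  then show ?thesis by (auto dest!: AE_not_in)
qed

text \<open>Translating the cell by \<open>c\<close> along an axis cuts off the slab
  \<open>A'\<close>, which reappears at the opposite face as \<open>B\<close>; periodicity moves it
  back.\<close>

lemma tor_integral_translate:
  fixes v :: "real ^ 'd::finite \<Rightarrow> complex"
  assumes v: "periodic v" "continuous_on UNIV v" and c: "0 \<le> c" "c \<le> 2 * pi"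
  shows "(\<integral>x. v (x + axis i c) \<partial>tor) = (\<integral>x. v x \<partial>tor)"
proof -
  have m [measurable]: "v \<in> borel_measurable borel" using v by (simp add: borel_measurable_continuous_onI)
  obtain b where b: "0 < b" "\<And>x. norm (v x) \<le> b" using continuous_periodic_bounded[OF v] by blast
  have fin: "integrable lborel (\<lambda>x. indicator S x *\<^sub>R v x)" if "S \<in> sets borel" "bounded S" for S
  proof (rule Bochner_Integration.integrable_bound)
    have "emeasure lborel S < \<infinity>" by (rule emeasure_bounded_finite[OF that(2)])
    then show "integrable lborel (\<lambda>x. indicator S x *\<^sub>R b)"
      using that by (intro integrable_scaleR_left integrable_real_indicator) auto
    show "(\<lambda>x. indicator S x *\<^sub>R v x) \<in> borel_measurable lborel" using that by measurable
    show "AE x in lborel. norm (indicator S x *\<^sub>R v x) \<le> norm (indicator S x *\<^sub>R b)"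
      using b by (intro AE_I2) (auto simp: indicator_def)
  qed
  define e where "e = (\<lambda>r::real. axis i r :: real ^ 'd)"
  define \<Omega> where "\<Omega> = (Omega :: (real ^ 'd) set)"
  define A where "A = \<Omega> \<inter> {x. x $ i > c}"
  define A' where "A' = \<Omega> \<inter> {x. x $ i < c}"
  define B where "B = (\<lambda>x. x - e (2 * pi)) -` A'"
  have bO: "bounded \<Omega>" by (simp add: \<Omega>_def Omega_def bounded_box)
  have sA: "A \<in> sets borel" "A' \<in> sets borel" unfolding A_def A'_def \<Omega>_def by measurable
  have "(\<lambda>x::real ^ 'd. x - e (2 * pi)) \<in> borel_measurable borel" by measurable
  then have sB: "B \<in> sets borel"
    unfolding B_def using sA(2) by (metis measurable_sets_borel)
  have bA: "bounded A" "bounded A'" using bO by (auto simp: A_def A'_def intro: bounded_subset)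
  have "B = (\<lambda>x. e (2 * pi) + x) ` A'" by (force simp: B_def)
  then have bB: "bounded B" using bounded_translation[OF bA(2)] by simp
  have "(\<integral>x. v (x + axis i c) \<partial>tor) = (\<integral>x. indicator \<Omega> x *\<^sub>R v (x + e c) \<partial>lborel)"
    unfolding tor_def \<Omega>_def e_def by (subst integral_restrict_space) auto
  also have "\<dots> = (\<integral>x. (\<lambda>y. indicator \<Omega> (y - e c) *\<^sub>R v y) (e c + x) \<partial>lborel)"
    by (simp add: add.commute)
  also have "\<dots> = (\<integral>y. indicator \<Omega> (y - e c) *\<^sub>R v y \<partial>lborel)"
    by (rule integral_translate) (simp add: \<Omega>_def)
  also have "\<dots> = (\<integral>y. indicator A y *\<^sub>R v y + indicator B y *\<^sub>R v y \<partial>lborel)"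
  proof (rule integral_cong_AE)
    show "(\<lambda>y. indicator \<Omega> (y - e c) *\<^sub>R v y) \<in> borel_measurable lborel" unfolding \<Omega>_def by measurable
    show "(\<lambda>y. indicator A y *\<^sub>R v y + indicator B y *\<^sub>R v y) \<in> borel_measurable lborel"
      using sA sB by measurable
    show "AE y in lborel. indicator \<Omega> (y - e c) *\<^sub>R v y = indicator A y *\<^sub>R v y + indicator B y *\<^sub>R v y"
      using AE_component_neq[of i "2 * pi"]
    proof eventually_elim
      case (elim y)
      have nth: "e r $ j = (if j = i then r else 0)" for r j
        by (simp add: e_def axis_def)
      define R where "R \<longleftrightarrow> (\<forall>j. j \<noteq> i \<longrightarrow> 0 < y $ j \<and> y $ j < 2 * pi)"
      have split: "z \<in> \<Omega> \<longleftrightarrow> (\<forall>j. j \<noteq> i \<longrightarrow> 0 < z $ j \<and> z $ j < 2 * pi) \<and> 0 < z $ i \<and> z $ i < 2 * pi" for z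
        unfolding \<Omega>_def in_Omega by metis
      have 1: "y - e c \<in> \<Omega> \<longleftrightarrow> R \<and> c < y $ i \<and> y $ i < c + 2 * pi"
        unfolding split R_def by (auto simp: nth)
      have 2: "y \<in> A \<longleftrightarrow> R \<and> 0 < y $ i \<and> y $ i < 2 * pi \<and> c < y $ i"
        unfolding A_def Int_iff split R_def by simp
      have 3: "y \<in> B \<longleftrightarrow> R \<and> 2 * pi < y $ i \<and> y $ i < 4 * pi \<and> y $ i < c + 2 * pi"
        unfolding B_def A'_def Int_iff vimage_def mem_Collect_eq split R_def by (auto simp: nth)
      show ?case
        using elim c unfolding indicator_def 1 2 3 by (cases R; cases "y $ i < 2 * pi") auto
    qed
  qed
  also have "\<dots> = (\<integral>y. indicator A y *\<^sub>R v y \<partial>lborel) + (\<integral>y. indicator B y *\<^sub>R v y \<partial>lborel)"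
    using fin sA sB bA bB by (intro Bochner_Integration.integral_add) auto
  also have "(\<integral>y. indicator B y *\<^sub>R v y \<partial>lborel) = (\<integral>y. (\<lambda>x. indicator B x *\<^sub>R v x) (e (2 * pi) + y) \<partial>lborel)"
    by (rule integral_translate[symmetric]) (use sB in measurable)
  also have "\<dots> = (\<integral>y. indicator A' y *\<^sub>R v y \<partial>lborel)"
    using periodicD[OF v(1)] by (simp add: B_def indicator_def e_def add.commute)
  also have "(\<integral>y. indicator A y *\<^sub>R v y \<partial>lborel) + (\<integral>y. indicator A' y *\<^sub>R v y \<partial>lborel)
      = (\<integral>y. indicator A y *\<^sub>R v y + indicator A' y *\<^sub>R v y \<partial>lborel)"
    using fin sA bA by (intro Bochner_Integration.integral_add[symmetric]) auto
  also have "\<dots> = (\<integral>y. indicator \<Omega> y *\<^sub>R v y \<partial>lborel)"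
  proof (rule integral_cong_AE)
    show "(\<lambda>y. indicator \<Omega> y *\<^sub>R v y) \<in> borel_measurable lborel" unfolding \<Omega>_def by measurable
    show "(\<lambda>y. indicator A y *\<^sub>R v y + indicator A' y *\<^sub>R v y) \<in> borel_measurable lborel"
      using sA by measurable
    show "AE y in lborel. indicator A y *\<^sub>R v y + indicator A' y *\<^sub>R v y = indicator \<Omega> y *\<^sub>R v y"
      using AE_component_neq[of i c] by eventually_elim (auto simp: A_def A'_def indicator_def)
  qed
  also have "\<dots> = (\<integral>x. v x \<partial>tor)"
    unfolding tor_def \<Omega>_def by (subst integral_restrict_space) auto
  finally show ?thesis .
qed

section \<open>Characters\<close>

definition phi_const :: "'d::finite itself \<Rightarrow> real" where
  "phi_const _ = (2 * pi) powr (- real CARD('d) / 2)"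

lemma phi_eq: "phi (k :: int ^ 'd::finite) x = complex_of_real (phi_const TYPE('d)) * cis (rvec k \<bullet> x)"
  by (simp add: phi_def phi_const_def)

lemma phi_const_pos: "0 < phi_const TYPE('d::finite)"
  by (simp add: phi_const_def)

lemma phi_const_sq: "(phi_const TYPE('d::finite))\<^sup>2 * (2 * pi) ^ CARD('d) = 1"
proof -
  have "(phi_const TYPE('d))\<^sup>2 = (2 * pi) powr (- real CARD('d))"
    unfolding phi_const_def power2_eq_square by (simp add: powr_add[symmetric])
  also have "\<dots> = 1 / (2 * pi) ^ CARD('d)" by (simp add: powr_minus powr_realpow divide_inverse)
  finally show ?thesis by simp
qed

lemma rvec_uminus: "rvec (- k) = - rvec k"
  by (simp add: rvec_def vec_eq_iff)

lemma rvec_inner_axis: "rvec k \<bullet> axis i c = c * real_of_int (k $ i)"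
  by (simp add: inner_axis rvec_def)

lemma cnj_phi: "cnj (phi k x) = phi (- k) x"
  by (simp add: phi_eq rvec_uminus cis_cnj)

lemma phi_mult: "phi k x * phi l x = complex_of_real (phi_const TYPE('d)) * phi (k + l) x"
  for k l :: "int ^ 'd::finite"
  by (simp add: phi_eq rvec_add inner_add_left flip: cis_mult)

lemma phi_translate: "phi k (x + axis i c) = cis (c * real_of_int (k $ i)) * phi k x"
  by (simp add: phi_eq inner_add_right rvec_inner_axis mult_ac flip: cis_mult)

lemma periodic_phi: "periodic (phi k)"
  by (simp add: periodic_def phi_translate cis_multiple_2pi)

lemma continuous_on_phi: "continuous_on A (phi k)"
  unfolding phi_eq[abs_def] by (intro continuous_intros continuous_on_cis)

lemma phi_L2p: "phi k \<in> L2p"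
  by (rule continuous_periodic_L2p[OF periodic_phi continuous_on_phi])

lemma integral_phi: "(\<integral>x. phi k x \<partial>tor) = (if k = 0 then complex_of_real (phi_const TYPE('d) * (2 * pi) ^ CARD('d)) else 0)"
  for k :: "int ^ 'd::finite"
proof (cases "k = 0")
  case True
  have "rvec (0 :: int ^ 'd) = 0" by (simp add: rvec_def vec_eq_iff)
  then have "(\<integral>x. phi k x \<partial>tor) = (\<integral>x. complex_of_real (phi_const TYPE('d)) \<partial>(tor :: (real ^ 'd) measure))"
    using True by (simp add: phi_eq)
  also have "\<dots> = complex_of_real (phi_const TYPE('d) * (2 * pi) ^ CARD('d))"
    by (simp add: measure_tor scaleR_conv_of_real mult.commute)
  finally show ?thesis using True by simp
next
  case False
  then obtain i where i: "k $ i \<noteq> 0" by (auto simp: vec_eq_iff)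
  \<comment> \<open>A shift by half a wave length changes the sign of the character, so its integral vanishes.\<close>
  define c where "c = pi / \<bar>real_of_int (k $ i)\<bar>"
  have "1 \<le> \<bar>k $ i\<bar>" using i by linarith
  then have "1 \<le> \<bar>real_of_int (k $ i)\<bar>" by linarith
  then have c: "0 \<le> c" "c \<le> 2 * pi" by (simp_all add: c_def field_simps)
  have "c * real_of_int (k $ i) = pi \<or> c * real_of_int (k $ i) = - pi"
    using i by (auto simp: c_def abs_if)
  then have "cis (c * real_of_int (k $ i)) = -1" by (auto simp: complex_eq_iff)
  then have "(\<integral>x. phi k (x + axis i c) \<partial>tor) = - (\<integral>x. phi k x \<partial>tor)"
    by (simp add: phi_translate)
  then have "(\<integral>x. phi k x \<partial>tor) = - (\<integral>x. phi k x \<partial>tor)"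
    using tor_integral_translate[OF periodic_phi continuous_on_phi c, of k i] by simp
  then show ?thesis using False by simp
qed

lemma phi_orthonormal: "(\<integral>x. phi k x * cnj (phi l x) \<partial>tor) = (if k = l then 1 else 0)"
  for k l :: "int ^ 'd::finite"
proof -
  have "(\<integral>x. phi k x * cnj (phi l x) \<partial>tor) = complex_of_real (phi_const TYPE('d)) * (\<integral>x. phi (k - l) x \<partial>tor)"
    by (simp add: cnj_phi phi_mult)
  also have "\<dots> = (if k = l then 1 else 0)"
  proof (cases "k = l")
    case True
    have "complex_of_real (phi_const TYPE('d)) * complex_of_real (phi_const TYPE('d) * (2 * pi) ^ CARD('d))
        = complex_of_real ((phi_const TYPE('d))\<^sup>2 * (2 * pi) ^ CARD('d))"
      by (simp add: power2_eq_square)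
    then show ?thesis using True unfolding integral_phi phi_const_sq by simp
  qed (simp add: integral_phi)
  finally show ?thesis .
qed

lemma fcoeff_phi: "fcoeff (phi k) l = (if k = l then 1 else 0)"
  by (simp add: fcoeff_tor phi_orthonormal)

lemma fcoeff_integrable: "v \<in> L2p \<Longrightarrow> integrable tor (\<lambda>x. v x * cnj (phi k x))"
  by (intro L2p_prod_integrable L2p_cnj phi_L2p)

lemma fcoeff_add: "u \<in> L2p \<Longrightarrow> v \<in> L2p \<Longrightarrow> fcoeff (\<lambda>x. u x + v x) k = fcoeff u k + fcoeff v k"
  by (simp add: fcoeff_tor distrib_right fcoeff_integrable)

lemma fcoeff_diff: "u \<in> L2p \<Longrightarrow> v \<in> L2p \<Longrightarrow> fcoeff (\<lambda>x. u x - v x) k = fcoeff u k - fcoeff v k"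
  by (simp add: fcoeff_tor left_diff_distrib fcoeff_integrable)

lemma fcoeff_scale: "fcoeff (\<lambda>x. c * v x) k = c * fcoeff v k"
  by (simp add: fcoeff_tor mult.assoc)

lemma fcoeff_zero [simp]: "fcoeff (\<lambda>_. 0) k = 0"
  by (simp add: fcoeff_tor)

lemma fcoeff_sum: "(\<And>i. i \<in> I \<Longrightarrow> f i \<in> L2p) \<Longrightarrow> fcoeff (\<lambda>x. \<Sum>i\<in>I. f i x) k = (\<Sum>i\<in>I. fcoeff (f i) k)"
  by (induction I rule: infinite_finite_induct) (auto simp: fcoeff_add L2p_sum)

definition trigp :: "(int ^ 'd::finite) set \<Rightarrow> (int ^ 'd \<Rightarrow> complex) \<Rightarrow> real ^ 'd \<Rightarrow> complex" where
  "trigp S c = (\<lambda>x. \<Sum>k\<in>S. c k * phi k x)"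

lemma trigp_L2p: "trigp S c \<in> L2p"
  unfolding trigp_def by (intro L2p_sum L2p_scale phi_L2p)

lemma fcoeff_trigp: "finite S \<Longrightarrow> fcoeff (trigp S c) k = (if k \<in> S then c k else 0)"
  unfolding trigp_def by (subst fcoeff_sum) (simp_all add: L2p_scale phi_L2p fcoeff_scale fcoeff_phi if_distrib cong: if_cong)

lemma integral_cnj_trigp:
  assumes "finite S" "v \<in> L2p"
  shows "(\<integral>x. v x * cnj (trigp S c x) \<partial>tor) = (\<Sum>k\<in>S. fcoeff v k * cnj (c k))"
proof -
  have "(\<integral>x. v x * cnj (trigp S c x) \<partial>tor) = (\<integral>x. (\<Sum>k\<in>S. cnj (c k) * (v x * cnj (phi k x))) \<partial>tor)"
    by (simp add: trigp_def sum_distrib_left mult_ac)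
  also have "\<dots> = (\<Sum>k\<in>S. cnj (c k) * fcoeff v k)"
    using assms by (simp add: fcoeff_integrable fcoeff_tor)
  finally show ?thesis by (simp add: mult.commute)
qed

text \<open>The squared distance of \<open>v\<close> from its Fourier partial sum is
  nonnegative.\<close>

lemma bessel:
  assumes v: "v \<in> L2p" and S: "finite S"
  shows "(\<Sum>k\<in>S. (cmod (fcoeff v k))\<^sup>2) \<le> (\<integral>x. (cmod (v x))\<^sup>2 \<partial>tor)"
proof -
  define p where "p = trigp S (fcoeff v)"
  have p: "p \<in> L2p" by (simp add: p_def trigp_L2p)
  have d: "(\<lambda>x. v x - p x) \<in> L2p" by (rule L2p_diff[OF v p])
  note i1 = L2p_prod_integrable[OF v L2p_cnj[OF v]] and i2 = L2p_prod_integrable[OF v L2p_cnj[OF p]]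
    and i3 = L2p_prod_integrable[OF p L2p_cnj[OF v]] and i4 = L2p_prod_integrable[OF p L2p_cnj[OF p]]
  define s where "s = (\<Sum>k\<in>S. (cmod (fcoeff v k))\<^sup>2)"
  have s: "(\<integral>x. v x * cnj (p x) \<partial>tor) = of_real s"
    unfolding p_def integral_cnj_trigp[OF S v] s_def of_real_sum complex_norm_square ..
  have s': "(\<integral>x. p x * cnj (v x) \<partial>tor) = of_real s"
  proof -
    have "(\<integral>x. p x * cnj (v x) \<partial>tor) = (\<integral>x. cnj (v x * cnj (p x)) \<partial>tor)" by (simp add: mult.commute)
    also have "\<dots> = cnj (\<integral>x. v x * cnj (p x) \<partial>tor)" by (rule Bochner_Integration.integral_cnj)
    finally show ?thesis by (simp add: s)
  qed
  have s'': "(\<integral>x. p x * cnj (p x) \<partial>tor) = of_real s"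
    unfolding p_def integral_cnj_trigp[OF S trigp_L2p] s_def of_real_sum complex_norm_square
    by (rule sum.cong) (simp_all add: fcoeff_trigp[OF S])
  have nsq: "complex_of_real (\<integral>x. (cmod (w x))\<^sup>2 \<partial>tor) = (\<integral>x. w x * cnj (w x) \<partial>tor)" for w :: "real ^ 'a \<Rightarrow> complex"
    by (simp only: integral_complex_of_real[symmetric] complex_norm_square)
  have "complex_of_real (\<integral>x. (cmod (v x - p x))\<^sup>2 \<partial>tor)
      = (\<integral>x. v x * cnj (v x) - v x * cnj (p x) - (p x * cnj (v x) - p x * cnj (p x)) \<partial>tor)"
    unfolding nsq by (simp add: algebra_simps)
  also have "\<dots> = (\<integral>x. v x * cnj (v x) \<partial>tor) - of_real s"
    using i1 i2 i3 i4 by (simp add: s s' s'')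
  also have "\<dots> = complex_of_real ((\<integral>x. (cmod (v x))\<^sup>2 \<partial>tor) - s)" by (simp add: nsq)
  finally have "(\<integral>x. (cmod (v x - p x))\<^sup>2 \<partial>tor) = (\<integral>x. (cmod (v x))\<^sup>2 \<partial>tor) - s"
    by (simp only: of_real_eq_iff)
  moreover have "0 \<le> (\<integral>x. (cmod (v x - p x))\<^sup>2 \<partial>tor)" by simp
  ultimately show ?thesis by (simp add: s_def)
qed

lemma fcoeff_summable: "v \<in> L2p \<Longrightarrow> (\<lambda>k. (cmod (fcoeff v k))\<^sup>2) summable_on UNIV"
  by (rule square_summableI) (rule bessel)

section \<open>Uniform approximation by trigonometric polynomials\<close>

text \<open>Trigonometric polynomials with unspecified spectrum; the inductive form suits closure
  under products.\<close>

inductive_set trigs :: "(real ^ 'd::finite \<Rightarrow> complex) set" where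
  char: "(\<lambda>x. c * phi k x) \<in> trigs"
| add: "f \<in> trigs \<Longrightarrow> g \<in> trigs \<Longrightarrow> (\<lambda>x. f x + g x) \<in> trigs"

lemma trigs_mult_char: "f \<in> trigs \<Longrightarrow> (\<lambda>x. f x * (c * phi k x)) \<in> trigs"
proof (induction rule: trigs.induct)
  case (char c' k')
  have "(\<lambda>x. c' * phi k' x * (c * phi k x)) = (\<lambda>x. (c' * c * complex_of_real (phi_const TYPE('a))) * phi (k' + k) x)"
  proof
    fix x
    have "c' * phi k' x * (c * phi k x) = c' * c * (phi k' x * phi k x)" by (simp add: mult_ac)
    then show "c' * phi k' x * (c * phi k x) = (c' * c * complex_of_real (phi_const TYPE('a))) * phi (k' + k) x"
      by (simp add: phi_mult)
  qed
  then show ?case by (simp only: trigs.char)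
next
  case (add f g)
  then show ?case by (simp add: distrib_right trigs.add)
qed

lemma trigs_mult: "g \<in> trigs \<Longrightarrow> f \<in> trigs \<Longrightarrow> (\<lambda>x. f x * g x) \<in> trigs"
proof (induction rule: trigs.induct)
  case (char c k)
  then show ?case by (rule trigs_mult_char)
next
  case (add g h)
  then show ?case by (simp add: distrib_left trigs.add)
qed

lemma trigs_cis: "(\<lambda>x. c * cis (rvec k \<bullet> x)) \<in> trigs"
proof -
  have "(\<lambda>x. c * cis (rvec k \<bullet> x)) = (\<lambda>x. (c / complex_of_real (phi_const TYPE('a))) * phi k x)"
    using phi_const_pos[where 'd='a] by (simp add: phi_eq fun_eq_iff)
  then show ?thesis by (simp only: trigs.char)
qed

lemma trigs_const: "(\<lambda>_. c) \<in> trigs"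
proof -
  have "rvec (0 :: int ^ 'a) = 0" by (simp add: rvec_def vec_eq_iff)
  then show ?thesis using trigs_cis[of c "0 :: int ^ 'a"] by simp
qed

lemma trigs_sum: "(\<And>i. i \<in> I \<Longrightarrow> f i \<in> trigs) \<Longrightarrow> (\<lambda>x. \<Sum>i\<in>I. f i x) \<in> trigs"
  by (induction I rule: infinite_finite_induct) (auto intro: trigs.add trigs_const)

lemma trigs_cos_sin:
  "(\<lambda>x. complex_of_real (a * cos (x $ i))) \<in> trigs" "(\<lambda>x. complex_of_real (a * sin (x $ i))) \<in> trigs"
proof -
  define k where "k = (axis i 1 :: int ^ 'a)"
  have k: "rvec k \<bullet> x = x $ i" "rvec (- k) \<bullet> x = - x $ i" for x
  proof -
    have "rvec k = axis i 1" by (simp add: rvec_def k_def axis_def vec_eq_iff)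
    then show "rvec k \<bullet> x = x $ i" "rvec (- k) \<bullet> x = - x $ i" by (simp_all add: rvec_uminus inner_axis')
  qed
  have "(\<lambda>x. (a / 2) * cis (rvec k \<bullet> x) + (a / 2) * cis (rvec (- k) \<bullet> x)) \<in> trigs"
    by (intro trigs.add trigs_cis)
  then show "(\<lambda>x. complex_of_real (a * cos (x $ i))) \<in> trigs"
    by (rule back_subst[of "\<lambda>f. f \<in> trigs"]) (auto simp: k fun_eq_iff complex_eq_iff)
  have "(\<lambda>x. (- \<i> * a / 2) * cis (rvec k \<bullet> x) + (\<i> * a / 2) * cis (rvec (- k) \<bullet> x)) \<in> trigs"
    by (intro trigs.add trigs_cis)
  then show "(\<lambda>x. complex_of_real (a * sin (x $ i))) \<in> trigs"
    by (rule back_subst[of "\<lambda>f. f \<in> trigs"]) (auto simp: k fun_eq_iff complex_eq_iff)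
qed

text \<open>Coordinates of points on the torus are sines and cosines.\<close>

lemma trigs_real_polynomial:
  "real_polynomial_function p \<Longrightarrow> (\<lambda>x. complex_of_real (p (circle_map x))) \<in> trigs"
proof (induction rule: real_polynomial_function.induct)
  case (linear f)
  have dec: "circle_map x = (\<Sum>i\<in>UNIV. cos (x $ i) *\<^sub>R axis i 1 + sin (x $ i) *\<^sub>R axis i \<i>)" for x :: "real ^ 'a"
    by (simp add: vec_eq_iff circle_map_def axis_def if_distrib complex_eq_iff cong: if_cong)
  have "f (circle_map x) = (\<Sum>i\<in>UNIV. f (axis i 1) * cos (x $ i) + f (axis i \<i>) * sin (x $ i))" for x
    unfolding dec using linear
    by (simp add: bounded_linear.linear linear_sum linear_add linear_scale mult.commute)
  moreover have "(\<lambda>x. \<Sum>i\<in>UNIV. complex_of_real (f (axis i 1) * cos (x $ i)) + complex_of_real (f (axis i \<i>) * sin (x $ i))) \<in> trigs"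
    by (intro trigs_sum trigs.add trigs_cos_sin)
  ultimately show ?case by simp
qed (auto simp: trigs_const trigs.add trigs_mult)

lemma trigs_uniform_approximation:
  assumes h: "periodic h" "continuous_on UNIV h" and e: "0 < e"
  obtains q where "q \<in> trigs" "\<And>x. cmod (h x - q x) \<le> e"
proof -
  obtain H where H: "continuous_on (circle_map ` cube) H" "\<And>x. H (circle_map x) = h x"
    using circle_map_factor[OF h] by blast
  have e2: "0 < e / 2" using e by simp
  have "continuous_on (circle_map ` cube) (\<lambda>z. Re (H z))" using H(1) by (intro continuous_intros)
  then obtain p1 where p1: "real_polynomial_function p1" "\<And>z. z \<in> circle_map ` cube \<Longrightarrow> \<bar>Re (H z) - p1 z\<bar> < e / 2"
    using Stone_Weierstrass_real_polynomial_function[OF compact_circle_map_cube _ e2] by metis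
  have "continuous_on (circle_map ` cube) (\<lambda>z. Im (H z))" using H(1) by (intro continuous_intros)
  then obtain p2 where p2: "real_polynomial_function p2" "\<And>z. z \<in> circle_map ` cube \<Longrightarrow> \<bar>Im (H z) - p2 z\<bar> < e / 2"
    using Stone_Weierstrass_real_polynomial_function[OF compact_circle_map_cube _ e2] by metis
  define q where "q x = complex_of_real (p1 (circle_map x)) + \<i> * complex_of_real (p2 (circle_map x))" for x
  have "q \<in> trigs" unfolding q_def
    by (intro trigs.add trigs_mult trigs_const trigs_real_polynomial p1 p2)
  moreover have "cmod (h x - q x) \<le> e" for x
  proof -
    have "cmod (h x - q x) \<le> \<bar>Re (h x - q x)\<bar> + \<bar>Im (h x - q x)\<bar>" by (rule cmod_le)
    also have "\<dots> \<le> e / 2 + e / 2"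
      using p1(2)[OF circle_map_in_image_cube[of x]] p2(2)[OF circle_map_in_image_cube[of x]]
      by (intro add_mono) (auto simp: q_def H)
    finally show ?thesis by simp
  qed
  ultimately show ?thesis by (rule that)
qed

lemma trigs_regular: "q \<in> trigs \<Longrightarrow> periodic q \<and> continuous_on UNIV q"
proof (induction rule: trigs.induct)
  case (char c k)
  then show ?case using periodic_phi[of k] by (auto simp: periodic_def intro!: continuous_intros continuous_on_phi)
qed (auto simp: periodic_def intro!: continuous_intros)

section \<open>Parseval\<close>

lemma parseval_trigs:
  assumes g: "g \<in> L2p"
  shows "q \<in> trigs \<Longrightarrow> ((\<lambda>k. fcoeff g k * cnj (fcoeff q k)) has_sum (\<integral>x. g x * cnj (q x) \<partial>tor)) UNIV"
proof (induction rule: trigs.induct)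
  case (char c k)
  have "(\<integral>x. g x * cnj (c * phi k x) \<partial>tor) = cnj c * fcoeff g k"
    by (simp add: fcoeff_tor mult.left_commute)
  moreover have "((\<lambda>j. fcoeff g j * cnj (fcoeff (\<lambda>x. c * phi k x) j)) has_sum cnj c * fcoeff g k) UNIV"
    by (rule has_sum_finite_neutralI[of "{k}"]) (auto simp: fcoeff_scale fcoeff_phi)
  ultimately show ?case by simp
next
  case (add p q)
  have pq: "p \<in> L2p" "q \<in> L2p" using add trigs_regular continuous_periodic_L2p by blast+
  have "(\<integral>x. g x * cnj (p x + q x) \<partial>tor) = (\<integral>x. g x * cnj (p x) \<partial>tor) + (\<integral>x. g x * cnj (q x) \<partial>tor)"
    using g pq by (simp add: distrib_left L2p_prod_integrable L2p_cnj)
  then show ?case using add has_sum_add[OF add.IH] pq by (simp add: fcoeff_add distrib_left)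
qed

lemma integral_prod_young:
  assumes g: "g \<in> L2p" and h: "h \<in> L2p" and e: "0 < e"
  shows "cmod (\<integral>x. g x * cnj (h x) \<partial>tor)
    \<le> (e * (\<integral>x. (cmod (g x))\<^sup>2 \<partial>tor) + (\<integral>x. (cmod (h x))\<^sup>2 \<partial>tor) / e) / 2"
proof -
  have "cmod (\<integral>x. g x * cnj (h x) \<partial>tor) \<le> (\<integral>x. cmod (g x * cnj (h x)) \<partial>tor)"
    by (rule integral_norm_bound)
  also have "\<dots> \<le> (\<integral>x. (e * (cmod (g x))\<^sup>2 + (cmod (h x))\<^sup>2 / e) / 2 \<partial>tor)"
  proof (rule integral_mono)
    show "integrable tor (\<lambda>x. cmod (g x * cnj (h x)))"
      by (intro integrable_norm L2p_prod_integrable g L2p_cnj h)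
    show "integrable tor (\<lambda>x. (e * (cmod (g x))\<^sup>2 + (cmod (h x))\<^sup>2 / e) / 2)"
      using g h by (auto simp: L2p_iff)
    show "cmod (g x * cnj (h x)) \<le> (e * (cmod (g x))\<^sup>2 + (cmod (h x))\<^sup>2 / e) / 2" for x
      using young[OF e] by (simp add: norm_mult)
  qed
  also have "\<dots> = (e * (\<integral>x. (cmod (g x))\<^sup>2 \<partial>tor) + (\<integral>x. (cmod (h x))\<^sup>2 \<partial>tor) / e) / 2"
    using g h by (simp add: L2p_iff)
  finally show ?thesis .
qed

lemma sum_prod_young:
  fixes a b :: "'a \<Rightarrow> complex"
  assumes e: "0 < e"
  shows "cmod (\<Sum>k\<in>S. a k * cnj (b k)) \<le> (e * (\<Sum>k\<in>S. (cmod (a k))\<^sup>2) + (\<Sum>k\<in>S. (cmod (b k))\<^sup>2) / e) / 2"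
proof -
  have "cmod (\<Sum>k\<in>S. a k * cnj (b k)) \<le> (\<Sum>k\<in>S. cmod (a k * cnj (b k)))" by (rule norm_sum)
  also have "\<dots> \<le> (\<Sum>k\<in>S. (e * (cmod (a k))\<^sup>2 + (cmod (b k))\<^sup>2 / e) / 2)"
    using young[OF e] by (intro sum_mono) (simp add: norm_mult)
  also have "\<dots> = (e * (\<Sum>k\<in>S. (cmod (a k))\<^sup>2) + (\<Sum>k\<in>S. (cmod (b k))\<^sup>2) / e) / 2"
    by (simp add: sum_divide_distrib sum_distrib_left sum.distrib add_divide_distrib)
  finally show ?thesis .
qed

text \<open>The identity is clear for trigonometric polynomials \<open>q\<close>. If
  \<open>q\<close> is uniformly close to \<open>h\<close>, both sides for \<open>h - q\<close> are
  small by Bessel's inequality and Young's inequality, uniformly in the finite partial sums.\<close>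

lemma parseval:
  assumes g: "g \<in> L2p" and h: "periodic h" "continuous_on UNIV h"
  shows "((\<lambda>k. fcoeff g k * cnj (fcoeff h k)) has_sum (\<integral>x. g x * cnj (h x) \<partial>tor)) UNIV"
  unfolding has_sum_def
proof (rule tendstoI)
  fix r :: real assume r: "0 < r"
  define G where "G = (\<integral>x. (cmod (g x))\<^sup>2 \<partial>tor)"
  define V where "V = measure (tor :: (real ^ 'a) measure) Omega"
  define e where "e = r / (2 * (G + V + 1))"
  have G: "0 \<le> G" by (simp add: G_def)
  have V: "0 \<le> V" by (simp add: V_def)
  have e: "0 < e" "e * (G + V) < r / 2" using r G V by (simp_all add: e_def field_simps)
  obtain q where q: "q \<in> trigs" "\<And>x. cmod (h x - q x) \<le> e" using trigs_uniform_approximation[OF h e(1)] by blast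
  have qL: "q \<in> L2p" using trigs_regular[OF q(1)] continuous_periodic_L2p by blast
  have hL: "h \<in> L2p" by (rule continuous_periodic_L2p[OF h])
  have dL: "(\<lambda>x. h x - q x) \<in> L2p" by (rule L2p_diff[OF hL qL])
  have dn: "(\<integral>x. (cmod (h x - q x))\<^sup>2 \<partial>tor) \<le> e\<^sup>2 * V"
  proof -
    have "(\<integral>x. (cmod (h x - q x))\<^sup>2 \<partial>tor) \<le> (\<integral>x. e\<^sup>2 \<partial>(tor :: (real ^ 'a) measure))"
      using dL q(2) e by (intro integral_mono) (auto simp: L2p_iff intro: power_mono)
    then show ?thesis by (simp add: V_def mult.commute)
  qed
  have "\<forall>\<^sub>F S in finite_subsets_at_top UNIV. dist (\<Sum>k\<in>S. fcoeff g k * cnj (fcoeff q k)) (\<integral>x. g x * cnj (q x) \<partial>tor) < r / 2"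
    using parseval_trigs[OF g q(1)] r unfolding has_sum_def by (intro tendstoD) auto
  moreover have "\<forall>\<^sub>F S in finite_subsets_at_top UNIV. finite (S :: (int ^ 'a) set)"
    by (simp add: eventually_finite_subsets_at_top_weakI)
  ultimately show "\<forall>\<^sub>F S in finite_subsets_at_top UNIV. dist (\<Sum>k\<in>S. fcoeff g k * cnj (fcoeff h k)) (\<integral>x. g x * cnj (h x) \<partial>tor) < r"
  proof eventually_elim
    case (elim S)
    define F where "F w = (\<Sum>k\<in>S. fcoeff g k * cnj (fcoeff w k)) - (\<integral>x. g x * cnj (w x) \<partial>tor)" for w
    have Fh: "F h = F q + F (\<lambda>x. h x - q x)"
    proof -
      have "(\<integral>x. g x * cnj (h x - q x) \<partial>tor) = (\<integral>x. g x * cnj (h x) \<partial>tor) - (\<integral>x. g x * cnj (q x) \<partial>tor)"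
        using g hL qL by (simp add: right_diff_distrib L2p_prod_integrable L2p_cnj)
      then show ?thesis by (simp add: F_def fcoeff_diff hL qL right_diff_distrib sum_subtractf)
    qed
    have "cmod (F (\<lambda>x. h x - q x)) \<le> e * (G + V)"
    proof -
      have e2: "e\<^sup>2 * V / e = e * V" using e by (simp add: power2_eq_square)
      have "cmod (\<Sum>k\<in>S. fcoeff g k * cnj (fcoeff (\<lambda>x. h x - q x) k)) \<le> (e * G + e\<^sup>2 * V / e) / 2"
        using e bessel[OF g, of S] bessel[OF dL, of S] dn elim
        by (intro order_trans[OF sum_prod_young[OF e(1)]] divide_right_mono add_mono mult_left_mono)
           (auto simp: G_def)
      moreover have "cmod (\<integral>x. g x * cnj (h x - q x) \<partial>tor) \<le> (e * G + e\<^sup>2 * V / e) / 2"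
        unfolding G_def using e dn
        by (intro order_trans[OF integral_prod_young[OF g dL e(1)]] divide_right_mono add_mono) auto
      ultimately show ?thesis unfolding F_def e2
        by (intro order_trans[OF norm_triangle_ineq4]) (simp add: algebra_simps)
    qed
    moreover have "cmod (F q) < r / 2" using elim by (simp add: F_def dist_norm)
    ultimately have "cmod (F h) < r" unfolding Fh using e norm_triangle_ineq[of "F q" "F (\<lambda>x. h x - q x)"] by linarith
    then show ?case by (simp add: F_def dist_norm)
  qed
qed

section \<open>Completeness\<close>

lemma circle_map_inj_Omega: 
  assumes "x \<in> Omega" "y \<in> Omega" "circle_map x = circle_map y"
  shows "x = y"
proof -
  obtain n where n: "x = y + (2 * pi) *\<^sub>R rvec n" using circle_map_eqD[OF assms(3)] by blast
  have "n $ i = 0" for i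
  proof -
    have "x $ i = y $ i + 2 * pi * real_of_int (n $ i)" by (simp add: n rvec_def)
    moreover have "0 < x $ i" "x $ i < 2 * pi" "0 < y $ i" "y $ i < 2 * pi" using assms by (auto simp: in_Omega)
    ultimately have "\<bar>2 * pi * real_of_int (n $ i)\<bar> < 2 * pi" by linarith
    then have "\<bar>real_of_int (n $ i)\<bar> < 1" by (simp add: abs_mult)
    then show ?thesis by linarith
  qed
  then have "rvec n = 0" by (simp add: rvec_def vec_eq_iff)
  then show ?thesis using n by simp
qed

text \<open>Parseval's identity makes the integral of \<open>g\<close> against every continuous
  periodic function vanish. The indicator of a compact subset of the cell is a bounded pointwise
  limit of such functions, built from the distance on the torus.\<close>

lemma integral_compact_zero:
  assumes g: "g \<in> L2p" and z: "\<And>k. fcoeff g k = 0" and K: "compact K" "K \<subseteq> Omega"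
  shows "(\<integral>x. indicator K x *\<^sub>R g x \<partial>tor) = 0"
proof (cases "K = {}")
  case False
  define h where "h n x = complex_of_real (max 0 (1 - real n * infdist (circle_map x) (circle_map ` K)))" for n x
  have cK: "closed (circle_map ` K)" using K by (intro compact_imp_closed compact_continuous_image continuous_on_circle_map)
  have per: "periodic (h n)" for n by (simp add: h_def periodic_def circle_map_periodic)
  have cont: "continuous_on UNIV (h n)" for n
    unfolding h_def by (intro continuous_intros continuous_on_infdist continuous_on_circle_map)
  have h1: "cmod (h n x) \<le> 1" for n x
  proof -
    have "0 \<le> real n * infdist (circle_map x) (circle_map ` K)" by (simp add: infdist_nonneg)
    then show ?thesis by (simp add: h_def)
  qed
  have zero: "(\<integral>x. g x * cnj (h n x) \<partial>tor) = 0" for n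
  proof -
    have "((\<lambda>k :: int ^ 'a. 0) has_sum (\<integral>x. g x * cnj (h n x) \<partial>tor)) UNIV"
      using parseval[OF g per cont, of n] by (simp add: z)
    then show ?thesis using has_sum_unique has_sum_0_simp by blast
  qed
  have gm: "g \<in> borel_measurable borel" using g by (rule L2p_measurable)
  have "(\<lambda>n. \<integral>x. g x * cnj (h n x) \<partial>tor) \<longlonglongrightarrow> (\<integral>x. indicator K x *\<^sub>R g x \<partial>tor)"
  proof (rule integral_dominated_convergence[where w="\<lambda>x. cmod (g x)"])
    show "(\<lambda>x. indicator K x *\<^sub>R g x) \<in> borel_measurable tor"
      using gm K by (intro measurable_tor) (auto intro!: borel_measurable_scaleR borel_measurable_indicator borel_compact)
    show "(\<lambda>x. g x * cnj (h n x)) \<in> borel_measurable tor" for n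
      using borel_measurable_integrable[OF L2p_prod_integrable[OF g L2p_cnj[OF continuous_periodic_L2p[OF per cont]]]] .
    have "(\<lambda>_. 1) \<in> L2p" by (rule continuous_periodic_L2p) (auto simp: periodic_def)
    from L2p_prod_integrable[OF g this] show "integrable tor (\<lambda>x. cmod (g x))" by simp
    show "AE x in tor. cmod (g x * cnj (h n x)) \<le> cmod (g x)" for n
      using h1 by (intro AE_I2) (simp add: norm_mult mult_left_le)
    have "(\<lambda>n. g x * cnj (h n x)) \<longlonglongrightarrow> indicator K x *\<^sub>R g x" if x: "x \<in> Omega" for x
    proof (cases "x \<in> K")
      case True
      then have "h n x = 1" for n by (simp add: h_def)
      then show ?thesis using True by simp
    next
      case False
      have "circle_map x \<notin> circle_map ` K" using False circle_map_inj_Omega[OF x] K by blast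
      then have d: "0 < infdist (circle_map x) (circle_map ` K)"
        using in_closed_iff_infdist_zero[OF cK] \<open>K \<noteq> {}\<close> infdist_nonneg[of "circle_map x" "circle_map ` K"] by fastforce
      then obtain m :: nat where "1 / infdist (circle_map x) (circle_map ` K) < real m" using reals_Archimedean2 by blast
      then have "1 \<le> real n * infdist (circle_map x) (circle_map ` K)" if "n \<ge> m" for n
        using d that by (simp add: field_simps) (smt (verit) mult_right_mono of_nat_le_iff)
      then have "\<forall>\<^sub>F n in sequentially. g x * cnj (h n x) = 0"
        unfolding eventually_sequentially h_def by (intro exI[of _ m]) auto
      then show ?thesis using False by (simp add: tendsto_eventually)
    qed
    then show "AE x in tor. (\<lambda>n. g x * cnj (h n x)) \<longlonglongrightarrow> indicator K x *\<^sub>R g x"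
      by (intro AE_I2) simp
  qed
  then show ?thesis using zero by (simp add: LIMSEQ_const_iff)
qed simp

text \<open>The measure with density the positive part of \<open>f\<close> vanishes on compact
  subsets of the set where \<open>f\<close> is positive, hence on that set by inner
  regularity.\<close>

lemma AE_nonpos_of_compact_integrals:
  fixes f :: "real ^ 'd::finite \<Rightarrow> real"
  assumes m [measurable]: "f \<in> borel_measurable borel" and int: "integrable tor f"
    and K: "\<And>K. compact K \<Longrightarrow> K \<subseteq> Omega \<Longrightarrow> (\<integral>x. indicator K x *\<^sub>R f x \<partial>tor) = 0"
  shows "AE x in tor. f x \<le> 0"
proof -
  define d where "d x = ennreal (indicator Omega x * max 0 (f x))" for x
  have dm [measurable]: "d \<in> borel_measurable borel" unfolding d_def by measurable
  define M where "M = density lborel d"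
  define B where "B = {x \<in> Omega. 0 < f x}"
  have B [measurable]: "B \<in> sets borel" unfolding B_def by measurable
  have intO: "integrable lborel (\<lambda>x. indicator Omega x *\<^sub>R f x)"
    using int unfolding tor_def by (subst (asm) integrable_restrict_space) auto
  have eM: "emeasure M A = (\<integral>\<^sup>+x. d x * indicator A x \<partial>lborel)" if "A \<in> sets borel" for A
    unfolding M_def using that by (subst emeasure_density) auto
  have "emeasure M (space M) = (\<integral>\<^sup>+x. d x \<partial>lborel)"
    by (subst eM) (auto simp: M_def)
  also have "\<dots> \<le> (\<integral>\<^sup>+x. ennreal (norm (indicator Omega x *\<^sub>R f x)) \<partial>lborel)"
    unfolding d_def by (intro nn_integral_mono ennreal_leI) (auto simp: indicator_def)
  also have "\<dots> < \<infinity>" using intO by (simp add: integrable_iff_bounded)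
  finally have fin: "emeasure M (space M) \<noteq> \<infinity>" by simp
  have "emeasure M B = (SUP K \<in> {K. K \<subseteq> B \<and> compact K}. emeasure M K)"
    by (rule inner_regular[OF _ fin B]) (simp add: M_def)
  also have "\<dots> \<le> 0"
  proof (rule SUP_least, clarify)
    fix C assume C: "C \<subseteq> B" "compact C"
    have Cb: "C \<in> sets borel" using C by (simp add: borel_compact)
    have CO: "C \<subseteq> Omega" using C by (auto simp: B_def)
    have i: "integrable lborel (\<lambda>x. indicator C x * f x)"
    proof -
      have "integrable lborel (\<lambda>x. indicator C x *\<^sub>R (indicator Omega x *\<^sub>R f x))"
        by (rule integrable_mult_indicator[OF _ intO]) (use Cb in simp)
      moreover have "indicator C x *\<^sub>R (indicator Omega x *\<^sub>R f x) = indicator C x * f x" for x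
        using CO by (auto simp: indicator_def)
      ultimately show ?thesis by (simp only:)
    qed
    have "emeasure M C = (\<integral>\<^sup>+x. ennreal (indicator C x * f x) \<partial>lborel)"
      unfolding eM[OF Cb] using C CO by (intro nn_integral_cong) (auto simp: d_def B_def indicator_def)
    also have "\<dots> = ennreal (\<integral>x. indicator C x * f x \<partial>lborel)"
      using i C by (intro nn_integral_eq_integral) (auto simp: B_def indicator_def intro!: AE_I2)
    also have "(\<integral>x. indicator C x * f x \<partial>lborel) = (\<integral>x. indicator C x *\<^sub>R f x \<partial>tor)"
      unfolding tor_def using CO
      by (subst integral_restrict_space) (auto simp: indicator_def intro!: Bochner_Integration.integral_cong)
    also have "\<dots> = 0" using C CO by (intro K) auto
    finally show "emeasure M C \<le> 0" by simp
  qed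
  finally have "(\<integral>\<^sup>+x. d x * indicator B x \<partial>lborel) = 0" using eM[OF B] by simp
  then have "AE x in lborel. d x * indicator B x = 0"
    by (subst (asm) nn_integral_0_iff_AE) auto
  then show ?thesis
    unfolding AE_tor by eventually_elim (auto simp: d_def B_def indicator_def split: if_splits)
qed

text \<open>Completeness of the trigonometric system. It makes weak derivatives, of which the
  definition of the form selects an arbitrary one, unique almost everywhere.\<close>

lemma L2p_fcoeff_zero_AE:
  assumes g: "g \<in> L2p" and z: "\<And>k. fcoeff g k = 0"
  shows "AE x in tor. g x = 0"
proof -
  have gm [measurable]: "g \<in> borel_measurable borel" using g by (rule L2p_measurable)
  have "(\<lambda>_. 1) \<in> L2p" by (rule continuous_periodic_L2p) (auto simp: periodic_def)
  from L2p_prod_integrable[OF g this] have int: "integrable tor g" by simp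
  have intK: "integrable tor (\<lambda>x. indicator K x *\<^sub>R g x)" if "compact K" "K \<subseteq> Omega" for K
  proof (rule integrable_mult_indicator[OF _ int])
    show "K \<in> sets tor" using that unfolding tor_def
      by (subst sets_restrict_space_iff) (auto simp: borel_compact)
  qed
  have neg: "AE x in tor. f x \<le> 0"
    if f: "\<And>x. f x = L (g x)" and L: "bounded_linear L" for f :: "real ^ 'a \<Rightarrow> real" and L
  proof (rule AE_nonpos_of_compact_integrals)
    show "f \<in> borel_measurable borel"
      unfolding f[abs_def] using L gm by (rule borel_measurable_continuous_on[OF linear_continuous_on])
    show "integrable tor f" unfolding f[abs_def] by (rule integrable_bounded_linear[OF L int])
    fix K :: "(real ^ 'a) set" assume K: "compact K" "K \<subseteq> Omega"
    have "(\<integral>x. indicator K x *\<^sub>R f x \<partial>tor) = (\<integral>x. L (indicator K x *\<^sub>R g x) \<partial>tor)"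
      by (simp add: f linear_scale[OF bounded_linear.linear[OF L]])
    also have "\<dots> = L (\<integral>x. indicator K x *\<^sub>R g x \<partial>tor)" by (rule integral_bounded_linear[OF L intK[OF K]])
    also have "\<dots> = 0" using integral_compact_zero[OF g z K] linear_0[OF bounded_linear.linear[OF L]] by simp
    finally show "(\<integral>x. indicator K x *\<^sub>R f x \<partial>tor) = 0" .
  qed
  have "AE x in tor. Re (g x) \<le> 0" by (rule neg[OF _ bounded_linear_Re]) simp
  moreover have "AE x in tor. - Re (g x) \<le> 0"
    by (rule neg[OF _ bounded_linear_minus[OF bounded_linear_Re]]) simp
  moreover have "AE x in tor. Im (g x) \<le> 0" by (rule neg[OF _ bounded_linear_Im]) simp
  moreover have "AE x in tor. - Im (g x) \<le> 0"
    by (rule neg[OF _ bounded_linear_minus[OF bounded_linear_Im]]) simp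
  ultimately show ?thesis by eventually_elim (simp add: complex_eq_iff)
qed

section \<open>Weak derivatives\<close>

lemma C1_funD:
  assumes "C1_fun g"
  obtains g' where "\<And>x. (g has_derivative blinfun_apply (g' x)) (at x)" "continuous_on UNIV g'"
  using assms by (auto simp: C1_fun_def)

lemma C1_fun_continuous: "C1_fun g \<Longrightarrow> continuous_on UNIV g"
  by (auto simp: C1_fun_def continuous_on_eq_continuous_at intro: has_derivative_continuous)

lemma partial_eq: "(g has_derivative g') (at x) \<Longrightarrow> partial j g x = g' (axis j 1)"
  by (simp add: partial_def frechet_derivative_at[symmetric])

lemma C1_fun_partial_continuous: "C1_fun p \<Longrightarrow> continuous_on UNIV (partial j p)"
proof -
  assume "C1_fun p"
  then obtain g' where g': "\<And>x. (p has_derivative blinfun_apply (g' x)) (at x)" "continuous_on UNIV g'"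
    using C1_funD by blast
  have "partial j p = (\<lambda>x. g' x (axis j 1))" using partial_eq[OF g'(1)] by auto
  then show ?thesis using g'(2) by (auto intro!: continuous_intros)
qed

lemma partial_periodic:
  assumes "periodic p" "C1_fun p"
  shows "periodic (partial j p)"
  unfolding periodic_def
proof (intro allI)
  fix x i
  obtain g' where g': "\<And>x. (p has_derivative blinfun_apply (g' x)) (at x)"
    using C1_funD[OF assms(2)] by blast
  have "((\<lambda>y. p (y + axis i (2 * pi))) has_derivative blinfun_apply (g' (x + axis i (2 * pi)))) (at x)"
    by (rule has_derivative_eq_rhs[OF has_derivative_compose[OF _ g']])
       (auto intro!: derivative_eq_intros)
  then have "(p has_derivative blinfun_apply (g' (x + axis i (2 * pi)))) (at x)"
    using assms(1) by (simp add: periodic_def)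
  then show "partial j p (x + axis i (2 * pi)) = partial j p x"
    using partial_eq g' by metis
qed

text \<open>Difference quotients of a periodic function have integral zero by translation
  invariance, and they converge boundedly to the partial derivative. This replaces integration by
  parts with boundary terms.\<close>

lemma integral_partial_zero:
  fixes p :: "real ^ 'd::finite \<Rightarrow> complex"
  assumes p: "periodic p" and C1: "C1_fun p"
  shows "(\<integral>x. partial j p x \<partial>tor) = 0"
proof -
  obtain g' where g': "\<And>x. (p has_derivative blinfun_apply (g' x)) (at x)" "continuous_on UNIV g'"
    using C1_funD[OF C1] by blast
  have pc: "continuous_on UNIV p" by (rule C1_fun_continuous[OF C1])
  define S where "S = cbox (0 :: real ^ 'd) (vec (2 * pi + 1))"
  have "compact (g' ` S)" using g'(2) by (intro compact_continuous_image) (auto simp: S_def intro: continuous_on_subset)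
  then obtain L where L: "0 < L" "\<And>x. x \<in> S \<Longrightarrow> norm (g' x) \<le> L"
    using compact_imp_bounded bounded_pos by (metis (no_types, lifting) imageI)
  define h where "h n = 1 / (real n + 1)" for n :: nat
  have h: "0 < h n" "h n \<le> 1" for n by (simp_all add: h_def)
  define e where "e = axis j (1::real)"
  have axis: "axis j r = r *\<^sub>R e" for r by (simp add: e_def axis_def vec_eq_iff)
  have ne: "norm e = 1" by (simp add: e_def norm_axis_1)
  define q where "q n x = (p (x + axis j (h n)) - p x) /\<^sub>R h n" for n x
  have q_zero: "(\<integral>x. q n x \<partial>tor) = 0" for n
  proof -
    have pi2: "h n \<le> 2 * pi" using h[of n] pi_ge_two by linarith
    have pL: "integrable tor p"
    proof -
      have "(\<lambda>_. 1) \<in> L2p" by (rule continuous_periodic_L2p) (auto simp: periodic_def)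
      from L2p_prod_integrable[OF continuous_periodic_L2p[OF p pc] this] show ?thesis by simp
    qed
    have pL': "integrable tor (\<lambda>x. p (x + axis j (h n)))"
    proof -
      have "periodic (\<lambda>x. p (x + axis j (h n)))"
        using p by (simp add: periodic_def add.assoc add.commute[of "axis j (h n)"] flip: add.assoc)
           (metis add.assoc add.commute)
      moreover have "continuous_on UNIV (\<lambda>x. p (x + axis j (h n)))"
        by (intro continuous_on_compose2[OF pc] continuous_intros) auto
      moreover have "(\<lambda>_. 1) \<in> L2p" by (rule continuous_periodic_L2p) (auto simp: periodic_def)
      ultimately show ?thesis using L2p_prod_integrable continuous_periodic_L2p by fastforce
    qed
    show ?thesis
      unfolding q_def using pL pL' tor_integral_translate[OF p pc _ pi2, of j] h[of n] by simp
  qed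
  have "(\<lambda>n. \<integral>x. q n x \<partial>tor) \<longlonglongrightarrow> (\<integral>x. partial j p x \<partial>tor)"
  proof (rule integral_dominated_convergence[where w="\<lambda>_. L"])
    show "partial j p \<in> borel_measurable tor"
      using C1_fun_partial_continuous[OF C1] by (intro measurable_tor borel_measurable_continuous_onI)
    show "q n \<in> borel_measurable tor" for n
      unfolding q_def by (intro measurable_tor borel_measurable_continuous_onI continuous_intros
          continuous_on_compose2[OF pc] pc) auto
    show "integrable tor (\<lambda>_. L)" by simp
    have "norm (q n x) \<le> L" if x: "x \<in> Omega" for n x
    proof -
      have xS: "x \<in> S" "x + axis j (h n) \<in> S"
        using x h[of n] by (auto simp: S_def mem_box_cart in_Omega axis_def less_imp_le)
           (smt (verit))+
      have "norm (p (x + axis j (h n)) - p x) \<le> L * norm ((x + axis j (h n)) - x)"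
      proof (rule differentiable_bound[of S])
        show "convex S" by (simp add: S_def convex_box)
        show "(p has_derivative blinfun_apply (g' y)) (at y within S)" for y
          using g'(1) has_derivative_at_withinI by blast
        show "onorm (blinfun_apply (g' y)) \<le> L" if "y \<in> S" for y
          using L(2)[OF that] by (simp add: norm_blinfun.rep_eq)
      qed (use xS in auto)
      then have "norm (p (x + axis j (h n)) - p x) / h n \<le> L"
        using h[of n] ne by (simp add: axis pos_divide_le_eq)
      moreover have "norm (q n x) = norm (p (x + axis j (h n)) - p x) / h n"
        using h(1)[of n] by (simp add: q_def divide_inverse mult.commute)
      ultimately show ?thesis by simp
    qed
    then show "AE x in tor. norm (q n x) \<le> L" for n by (intro AE_I2) simp
    have "(\<lambda>n. q n x) \<longlonglongrightarrow> partial j p x" for x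
    proof -
      have lim: "((\<lambda>v. norm (p (x + v) - p x - g' x v) / norm v) \<longlongrightarrow> 0) (at 0)"
        using g'(1)[of x] by (simp add: has_derivative_at)
      have h0: "h \<longlonglongrightarrow> 0" unfolding h_def using LIMSEQ_inverse_real_of_nat by (simp add: divide_inverse add.commute)
      have "filterlim (\<lambda>n. axis j (h n)) (at 0) sequentially"
      proof (rule filterlim_atI)
        have "(\<lambda>n. h n *\<^sub>R e) \<longlonglongrightarrow> 0 *\<^sub>R e" by (intro tendsto_intros h0)
        then show "(\<lambda>n. axis j (h n)) \<longlonglongrightarrow> 0" by (simp add: axis)
        show "\<forall>\<^sub>F n in sequentially. axis j (h n) \<noteq> 0"
          using h(1) ne by (intro always_eventually) (auto simp: axis, metis less_irrefl)
      qed
      then have "(\<lambda>n. norm (p (x + axis j (h n)) - p x - g' x (axis j (h n))) / norm (axis j (h n))) \<longlonglongrightarrow> 0"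
        by (rule filterlim_compose[OF lim])
      also have "(\<lambda>n. norm (p (x + axis j (h n)) - p x - g' x (axis j (h n))) / norm (axis j (h n))) = (\<lambda>n. norm (q n x - partial j p x))"
      proof
        fix n
        have "q n x - partial j p x = (p (x + axis j (h n)) - p x - g' x (axis j (h n))) /\<^sub>R h n"
          using h(1)[of n] unfolding q_def partial_eq[OF g'(1)] e_def[symmetric] axis
          by (simp add: blinfun.scaleR_right scaleR_diff_right)
        then show "norm (p (x + axis j (h n)) - p x - g' x (axis j (h n))) / norm (axis j (h n)) = norm (q n x - partial j p x)"
          using h(1)[of n] ne by (simp add: axis divide_inverse mult.commute)
      qed
      finally show ?thesis using LIM_zero_cancel tendsto_norm_zero_iff by blast
    qed
    then show "AE x in tor. (\<lambda>n. q n x) \<longlonglongrightarrow> partial j p x" by simp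
  qed
  then show ?thesis using q_zero by (simp add: LIMSEQ_const_iff)
qed

lemma phi_has_derivative:
  "(phi k has_derivative (\<lambda>h. (\<i> * phi k x) * complex_of_real (rvec k \<bullet> h))) (at x)"
proof -
  have "((\<lambda>x. exp (\<i> * complex_of_real (rvec k \<bullet> x))) has_derivative
      (\<lambda>h. exp (\<i> * complex_of_real (rvec k \<bullet> x)) * (\<i> * complex_of_real (rvec k \<bullet> h)))) (at x)"
    by (rule has_derivative_compose[OF _ has_field_derivative_imp_has_derivative[OF DERIV_exp]])
       (auto intro!: derivative_eq_intros)
  then have "((\<lambda>x. complex_of_real (phi_const TYPE('a)) * exp (\<i> * complex_of_real (rvec k \<bullet> x))) has_derivative
      (\<lambda>h. complex_of_real (phi_const TYPE('a)) * (exp (\<i> * complex_of_real (rvec k \<bullet> x)) * (\<i> * complex_of_real (rvec k \<bullet> h))))) (at x)"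
    by (rule has_derivative_mult_right)
  then show ?thesis by (simp add: phi_eq[abs_def] cis_conv_exp mult_ac)
qed

lemma C1_fun_phi: "C1_fun (phi k)"
  unfolding C1_fun_def
proof (intro exI conjI allI)
  define R where "R = Blinfun (\<lambda>h. complex_of_real (rvec k \<bullet> h))"
  have R: "blinfun_apply R h = complex_of_real (rvec k \<bullet> h)" for h
    unfolding R_def by (subst bounded_linear_Blinfun_apply)
      (auto intro!: bounded_linear_compose[OF bounded_linear_of_real] bounded_linear_inner_right)
  fix x
  show "(phi k has_derivative blinfun_apply ((\<lambda>x. blinfun_mult_right (\<i> * phi k x) o\<^sub>L R) x)) (at x)"
    by (rule has_derivative_eq_rhs[OF phi_has_derivative]) (auto simp: R fun_eq_iff)
  show "continuous_on UNIV (\<lambda>x. blinfun_mult_right (\<i> * phi k x) o\<^sub>L R)"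
    by (intro bounded_bilinear.continuous_on[OF bounded_bilinear_blinfun_compose]
        bounded_linear.continuous_on[OF bounded_linear_blinfun_mult_right] continuous_intros continuous_on_phi)
qed

lemma C1_fun_mult:
  fixes f g :: "real ^ 'd::finite \<Rightarrow> complex"
  assumes "C1_fun f" "C1_fun g"
  shows "C1_fun (\<lambda>x. f x * g x)" 
proof -
  obtain f' where f': "\<And>x. (f has_derivative blinfun_apply (f' x)) (at x)" "continuous_on UNIV f'"
    using C1_funD[OF assms(1)] by blast
  obtain g' where g': "\<And>x. (g has_derivative blinfun_apply (g' x)) (at x)" "continuous_on UNIV g'"
    using C1_funD[OF assms(2)] by blast
  show ?thesis unfolding C1_fun_def
  proof (intro exI conjI allI)
    fix x
    have "((\<lambda>x. f x * g x) has_derivative (\<lambda>h. f x * g' x h + f' x h * g x)) (at x)"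
      by (rule has_derivative_mult[OF f'(1) g'(1)])
    then show "((\<lambda>x. f x * g x) has_derivative blinfun_apply
        ((\<lambda>x. (blinfun_mult_right (f x) o\<^sub>L g' x) + (blinfun_mult_left (g x) o\<^sub>L f' x)) x)) (at x)"
      by (rule has_derivative_eq_rhs) (auto simp: blinfun.add_left)
    show "continuous_on UNIV (\<lambda>x. (blinfun_mult_right (f x) o\<^sub>L g' x) + (blinfun_mult_left (g x) o\<^sub>L f' x))"
      by (intro continuous_on_add bounded_bilinear.continuous_on[OF bounded_bilinear_blinfun_compose]
        bounded_linear.continuous_on[OF bounded_linear_blinfun_mult_right]
        bounded_linear.continuous_on[OF bounded_linear_blinfun_mult_left]
        C1_fun_continuous assms f'(2) g'(2))
  qed
qed

lemma partial_mult:
  fixes f g :: "real ^ 'd::finite \<Rightarrow> complex"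
  assumes "C1_fun f" "C1_fun g"
  shows "partial j (\<lambda>x. f x * g x) x = f x * partial j g x + partial j f x * g x"
proof -
  obtain f' where f': "\<And>x. (f has_derivative blinfun_apply (f' x)) (at x)" using assms(1) by (metis C1_funD)
  obtain g' where g': "\<And>x. (g has_derivative blinfun_apply (g' x)) (at x)" using assms(2) by (metis C1_funD)
  show ?thesis
    using partial_eq[OF has_derivative_mult[OF f' g']] by (simp add: partial_eq[OF f'] partial_eq[OF g'])
qed

lemma partial_phi: "partial j (phi k) x = \<i> * of_int (k $ j) * phi k x"
  by (subst partial_eq[OF phi_has_derivative]) (simp add: rvec_inner_axis)

lemma test_fun_L2p: "C1_fun p \<Longrightarrow> periodic p \<Longrightarrow> p \<in> L2p"
  by (intro continuous_periodic_L2p C1_fun_continuous)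

lemma partial_L2p: "C1_fun p \<Longrightarrow> periodic p \<Longrightarrow> partial j p \<in> L2p"
  by (intro continuous_periodic_L2p C1_fun_partial_continuous partial_periodic)

text \<open>Integrate the partial derivative of the periodic product \<open>phi k *
  p\<close>.\<close>

lemma weak_partial_phi: "weak_partial j (phi k) (\<lambda>x. \<i> * of_int (k $ j) * phi k x)"
  unfolding weak_partial_def LINT_tor
proof (intro conjI allI impI)
  show "(\<lambda>x. \<i> * of_int (k $ j) * phi k x) \<in> L2p" by (intro L2p_scale phi_L2p)
  fix p :: "real ^ 'a \<Rightarrow> complex" assume p: "C1_fun p \<and> periodic p"
  have C: "C1_fun (\<lambda>x. phi k x * p x)" using p by (intro C1_fun_mult C1_fun_phi) auto
  have P: "periodic (\<lambda>x. phi k x * p x)" using p periodic_phi[of k] by (auto simp: periodic_def)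
  have i: "integrable tor (\<lambda>x. phi k x * partial j p x)" "integrable tor (\<lambda>x. phi k x * p x)"
    using p by (auto intro: L2p_prod_integrable[OF phi_L2p partial_L2p] L2p_prod_integrable[OF phi_L2p test_fun_L2p])
  have "0 = (\<integral>x. partial j (\<lambda>x. phi k x * p x) x \<partial>tor)" using integral_partial_zero[OF P C] by simp
  also have "\<dots> = (\<integral>x. phi k x * partial j p x + \<i> * of_int (k $ j) * (phi k x * p x) \<partial>tor)"
    using p by (simp add: partial_mult C1_fun_phi partial_phi mult.assoc)
  also have "\<dots> = (\<integral>x. phi k x * partial j p x \<partial>tor) + (\<integral>x. \<i> * of_int (k $ j) * (phi k x * p x) \<partial>tor)"
    using i by (intro Bochner_Integration.integral_add integrable_mult_right) auto
  finally show "(\<integral>x. phi k x * partial j p x \<partial>tor) = - (\<integral>x. \<i> * of_int (k $ j) * phi k x * p x \<partial>tor)"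
    by (simp add: mult.assoc eq_neg_iff_add_eq_0)
qed

lemma weak_partial_L2p: "weak_partial j v g \<Longrightarrow> g \<in> L2p"
  by (simp add: weak_partial_def)

lemma weak_partialD:
  "weak_partial j v g \<Longrightarrow> C1_fun p \<Longrightarrow> periodic p \<Longrightarrow>
    (\<integral>x. v x * partial j p x \<partial>tor) = - (\<integral>x. g x * p x \<partial>tor)"
  by (simp add: weak_partial_def LINT_tor)

lemma weak_partial_add:
  assumes "u \<in> L2p" "v \<in> L2p" "weak_partial j u g" "weak_partial j v h"
  shows "weak_partial j (\<lambda>x. u x + v x) (\<lambda>x. g x + h x)"
  unfolding weak_partial_def LINT_tor
proof (intro conjI allI impI)
  have gh: "g \<in> L2p" "h \<in> L2p" using assms weak_partial_L2p by blast+
  then show "(\<lambda>x. g x + h x) \<in> L2p" by (rule L2p_add)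
  fix p :: "real ^ 'a \<Rightarrow> complex" assume p: "C1_fun p \<and> periodic p"
  then have pL: "p \<in> L2p" "partial j p \<in> L2p" by (auto intro: test_fun_L2p partial_L2p)
  have "(\<integral>x. u x * partial j p x + v x * partial j p x \<partial>tor) = - (\<integral>x. g x * p x \<partial>tor) - (\<integral>x. h x * p x \<partial>tor)"
    using assms p pL weak_partialD[of j u g p] weak_partialD[of j v h p] by (simp add: L2p_prod_integrable)
  also have "\<dots> = - (\<integral>x. g x * p x + h x * p x \<partial>tor)" using gh pL by (simp add: L2p_prod_integrable)
  finally show "(\<integral>x. (u x + v x) * partial j p x \<partial>tor) = - (\<integral>x. (g x + h x) * p x \<partial>tor)"
    by (simp add: distrib_right)
qed

lemma weak_partial_scale:
  assumes "weak_partial j u g"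
  shows "weak_partial j (\<lambda>x. c * u x) (\<lambda>x. c * g x)"
  using assms unfolding weak_partial_def LINT_tor by (simp add: L2p_scale mult.assoc)

lemma weak_partial_zero: "weak_partial j (\<lambda>_. 0) (\<lambda>_. 0)"
  by (simp add: weak_partial_def L2p_zero)

lemma weak_partial_trigp: "weak_partial j (trigp S c) (trigp S (\<lambda>k. \<i> * of_int (k $ j) * c k))"
  unfolding trigp_def
proof (induction S rule: infinite_finite_induct)
  case (insert k S)
  have "weak_partial j (\<lambda>x. c k * phi k x) (\<lambda>x. c k * (\<i> * of_int (k $ j) * phi k x))"
    by (intro weak_partial_scale weak_partial_phi)
  then have "weak_partial j (\<lambda>x. c k * phi k x + (\<Sum>k\<in>S. c k * phi k x))
      (\<lambda>x. c k * (\<i> * of_int (k $ j) * phi k x) + (\<Sum>k\<in>S. \<i> * of_int (k $ j) * c k * phi k x))"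
    using insert.IH trigp_L2p[of S c] by (intro weak_partial_add L2p_scale phi_L2p) (auto simp: trigp_def)
  then show ?case using insert.hyps by (simp add: mult_ac)
qed (auto simp: weak_partial_zero)

text \<open>Test with the conjugated character, which is again a character.\<close>

lemma fcoeff_weak_partial:
  assumes "weak_partial j v g"
  shows "fcoeff g k = \<i> * of_int (k $ j) * fcoeff v k"
proof -
  have "(\<integral>x. v x * partial j (phi (- k)) x \<partial>tor) = - (\<integral>x. g x * phi (- k) x \<partial>tor)"
    by (rule weak_partialD[OF assms C1_fun_phi periodic_phi])
  moreover have "(\<integral>x. v x * partial j (phi (- k)) x \<partial>tor) = - (\<i> * of_int (k $ j) * (\<integral>x. v x * phi (- k) x \<partial>tor))"
    by (simp add: partial_phi mult.left_commute[of "v _"])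
  ultimately show ?thesis by (simp add: fcoeff_tor cnj_phi)
qed

lemma weak_partial_unique_AE:
  assumes g: "weak_partial j v g" and h: "weak_partial j v h"
  shows "AE x in tor. g x = h x"
proof -
  have "AE x in tor. g x - h x = 0"
    using weak_partial_L2p[OF g] weak_partial_L2p[OF h]
    by (intro L2p_fcoeff_zero_AE L2p_diff)
       (simp_all add: fcoeff_diff fcoeff_weak_partial[OF g] fcoeff_weak_partial[OF h])
  then show ?thesis by simp
qed

lemma weak_partial_wderiv: "weak_partial j v g \<Longrightarrow> weak_partial j v (wderiv j v)"
  unfolding wderiv_def by (rule someI[of "weak_partial j v"])

lemma wderiv_AE: "weak_partial j v g \<Longrightarrow> AE x in tor. wderiv j v x = g x"
  using weak_partial_unique_AE weak_partial_wderiv by blast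

lemma H1p_L2p: "v \<in> H1p \<Longrightarrow> v \<in> L2p"
  by (simp add: H1p_def)

lemma H1p_wderiv: "v \<in> H1p \<Longrightarrow> weak_partial j v (wderiv j v)"
  by (auto simp: H1p_def intro: weak_partial_wderiv)

lemma H1p_wderiv_L2p: "v \<in> H1p \<Longrightarrow> wderiv j v \<in> L2p"
  by (rule weak_partial_L2p[OF H1p_wderiv])

lemma trigp_H1p: "trigp S c \<in> H1p"
  unfolding H1p_def using trigp_L2p weak_partial_trigp by blast

lemma phi_H1p: "phi k \<in> H1p"
  unfolding H1p_def using phi_L2p weak_partial_phi by blast

lemma H1p_add: "u \<in> H1p \<Longrightarrow> v \<in> H1p \<Longrightarrow> (\<lambda>x. u x + v x) \<in> H1p"
  unfolding H1p_def using L2p_add weak_partial_add by blast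

lemma H1p_scale: "u \<in> H1p \<Longrightarrow> (\<lambda>x. c * u x) \<in> H1p"
  unfolding H1p_def using L2p_scale weak_partial_scale by blast

section \<open>The sesquilinear form\<close>

lemma has_sum_finite_sum:
  fixes f :: "'i \<Rightarrow> 'a \<Rightarrow> 'b::topological_comm_monoid_add"
  assumes "\<And>i. i \<in> I \<Longrightarrow> (f i has_sum s i) A"
  shows "((\<lambda>k. \<Sum>i\<in>I. f i k) has_sum (\<Sum>i\<in>I. s i)) A"
  using assms by (induction I rule: infinite_finite_induct) (auto intro: has_sum_add)

locale elliptic =
  fixes \<nu> \<sigma> :: "real ^ 'd::finite \<Rightarrow> real" and \<nu>\<^sub>l \<nu>\<^sub>u \<sigma>\<^sub>l \<sigma>\<^sub>u \<alpha>\<^sub>l \<alpha>\<^sub>u :: real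
  assumes coeffs: "elliptic_coeffs \<nu> \<sigma> \<nu>\<^sub>l \<nu>\<^sub>u \<sigma>\<^sub>l \<sigma>\<^sub>u"
    and alpha_l: "\<alpha>\<^sub>l = min \<nu>\<^sub>l \<sigma>\<^sub>l" and alpha_u: "\<alpha>\<^sub>u = max \<nu>\<^sub>u \<sigma>\<^sub>u"
begin

text \<open>What is used of the two coefficients of the operator: continuity, periodicity and the
  common bounds.\<close>

definition admissible :: "(real ^ 'd \<Rightarrow> real) \<Rightarrow> bool" where
  "admissible \<rho> \<longleftrightarrow> continuous_on UNIV \<rho> \<and> periodic \<rho> \<and> (\<forall>x. \<alpha>\<^sub>l \<le> \<rho> x \<and> \<rho> x \<le> \<alpha>\<^sub>u)"

lemma admissible_coeffs: "admissible \<nu>" "admissible \<sigma>"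
  unfolding admissible_def using coeffs
  by (auto simp: elliptic_coeffs_def alpha_l alpha_u C1_fun_continuous min_le_iff_disj le_max_iff_disj)

lemma lower_pos: "0 < \<alpha>\<^sub>l"
  using coeffs by (simp add: elliptic_coeffs_def alpha_l)

lemma admissibleD:
  assumes "admissible \<rho>"
  shows "continuous_on UNIV (\<lambda>x. complex_of_real (\<rho> x))" "periodic (\<lambda>x. complex_of_real (\<rho> x))"
    "(\<lambda>x. complex_of_real (\<rho> x)) \<in> borel_measurable borel" "cmod (complex_of_real (\<rho> x)) \<le> \<alpha>\<^sub>u"
    "\<alpha>\<^sub>l \<le> \<rho> x" "\<rho> x \<le> \<alpha>\<^sub>u" "0 < \<rho> x"
proof -
  show "continuous_on UNIV (\<lambda>x. complex_of_real (\<rho> x))"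
    using assms by (auto simp: admissible_def intro!: continuous_intros)
  then show "(\<lambda>x. complex_of_real (\<rho> x)) \<in> borel_measurable borel"
    by (rule borel_measurable_continuous_onI)
  show "periodic (\<lambda>x. complex_of_real (\<rho> x))" using assms by (auto simp: admissible_def periodic_def)
  show l: "\<alpha>\<^sub>l \<le> \<rho> x" and u: "\<rho> x \<le> \<alpha>\<^sub>u" using assms by (auto simp: admissible_def)
  then show "0 < \<rho> x" using lower_pos by linarith
  with u show "cmod (complex_of_real (\<rho> x)) \<le> \<alpha>\<^sub>u" by simp
qed

text \<open>The form is a sum of such weighted inner products of weak derivatives and of the
  functions themselves.\<close>

definition weighted_ip :: "(real ^ 'd \<Rightarrow> real) \<Rightarrow> (real ^ 'd \<Rightarrow> complex) \<Rightarrow> (real ^ 'd \<Rightarrow> complex) \<Rightarrow> complex" where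
  "weighted_ip \<rho> g h = (\<integral>x. complex_of_real (\<rho> x) * g x * cnj (h x) \<partial>tor)"

lemma weighted_ip_integrable:
  "admissible \<rho> \<Longrightarrow> g \<in> L2p \<Longrightarrow> h \<in> L2p \<Longrightarrow> integrable tor (\<lambda>x. complex_of_real (\<rho> x) * g x * cnj (h x))"
  by (rule L2p_mult_integrable[where c="\<alpha>\<^sub>u"]) (auto intro: admissibleD(3,4) L2p_cnj simp del: norm_of_real)

lemma weighted_ip_cnj: "weighted_ip \<rho> h g = cnj (weighted_ip \<rho> g h)"
  unfolding weighted_ip_def Bochner_Integration.integral_cnj[symmetric] by (simp add: mult_ac)

lemma weighted_ip_add: "admissible \<rho> \<Longrightarrow> g \<in> L2p \<Longrightarrow> g' \<in> L2p \<Longrightarrow> h \<in> L2p \<Longrightarrow>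
    weighted_ip \<rho> (\<lambda>x. g x + g' x) h = weighted_ip \<rho> g h + weighted_ip \<rho> g' h"
  by (simp add: weighted_ip_def distrib_left distrib_right weighted_ip_integrable)

lemma weighted_ip_scale: "weighted_ip \<rho> (\<lambda>x. c * g x) h = c * weighted_ip \<rho> g h"
  by (simp add: weighted_ip_def mult.left_commute[of _ c] mult.assoc)

lemma weighted_ip_bound:
  assumes "admissible \<rho>" "g \<in> L2p" "h \<in> L2p"
  shows "cmod (weighted_ip \<rho> g h) \<le> \<alpha>\<^sub>u * ((\<integral>x. (cmod (g x))\<^sup>2 \<partial>tor) + (\<integral>x. (cmod (h x))\<^sup>2 \<partial>tor)) / 2"
proof -
  have "cmod (weighted_ip \<rho> g h) \<le> (\<integral>x. cmod (complex_of_real (\<rho> x) * g x * cnj (h x)) \<partial>tor)"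
    unfolding weighted_ip_def by (rule integral_norm_bound)
  also have "\<dots> \<le> (\<integral>x. \<alpha>\<^sub>u * ((cmod (g x))\<^sup>2 + (cmod (h x))\<^sup>2) / 2 \<partial>tor)"
  proof (rule integral_mono)
    show "integrable tor (\<lambda>x. cmod (complex_of_real (\<rho> x) * g x * cnj (h x)))"
      by (intro integrable_norm weighted_ip_integrable assms)
    show "integrable tor (\<lambda>x. \<alpha>\<^sub>u * ((cmod (g x))\<^sup>2 + (cmod (h x))\<^sup>2) / 2)"
      using assms by (auto simp: L2p_iff)
    fix x
    have "cmod (g x) * cmod (h x) \<le> ((cmod (g x))\<^sup>2 + (cmod (h x))\<^sup>2) / 2"
      using young[of 1 "cmod (g x)" "cmod (h x)"] by simp
    then have "cmod (complex_of_real (\<rho> x)) * (cmod (g x) * cmod (h x)) \<le> \<alpha>\<^sub>u * (((cmod (g x))\<^sup>2 + (cmod (h x))\<^sup>2) / 2)"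
      using admissibleD(4,6,7)[OF assms(1), of x] by (intro mult_mono) auto
    then show "cmod (complex_of_real (\<rho> x) * g x * cnj (h x)) \<le> \<alpha>\<^sub>u * ((cmod (g x))\<^sup>2 + (cmod (h x))\<^sup>2) / 2"
      by (simp only: norm_mult complex_mod_cnj mult.assoc times_divide_eq_right)
  qed
  also have "\<dots> = \<alpha>\<^sub>u * ((\<integral>x. (cmod (g x))\<^sup>2 \<partial>tor) + (\<integral>x. (cmod (h x))\<^sup>2 \<partial>tor)) / 2"
    using assms by (simp add: L2p_iff)
  finally show ?thesis .
qed

lemma weighted_ip_coercive:
  assumes "admissible \<rho>" "g \<in> L2p"
  shows "\<alpha>\<^sub>l * (\<integral>x. (cmod (g x))\<^sup>2 \<partial>tor) \<le> Re (weighted_ip \<rho> g g)"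
proof -
  have "\<alpha>\<^sub>l * (\<integral>x. (cmod (g x))\<^sup>2 \<partial>tor) = (\<integral>x. \<alpha>\<^sub>l * (cmod (g x))\<^sup>2 \<partial>tor)" by simp
  also have "\<dots> \<le> (\<integral>x. Re (complex_of_real (\<rho> x) * g x * cnj (g x)) \<partial>tor)"
  proof (rule integral_mono)
    show "integrable tor (\<lambda>x. \<alpha>\<^sub>l * (cmod (g x))\<^sup>2)" using assms by (simp add: L2p_iff)
    show "integrable tor (\<lambda>x. Re (complex_of_real (\<rho> x) * g x * cnj (g x)))"
      by (intro integrable_Re weighted_ip_integrable assms)
    fix x
    have "Re (complex_of_real (\<rho> x) * g x * cnj (g x)) = \<rho> x * (cmod (g x))\<^sup>2"
    proof -
      have e: "complex_of_real (\<rho> x) * g x * cnj (g x) = complex_of_real (\<rho> x * (cmod (g x))\<^sup>2)"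
        by (simp only: of_real_mult complex_norm_square mult.assoc)
      show ?thesis unfolding e by simp
    qed
    then show "\<alpha>\<^sub>l * (cmod (g x))\<^sup>2 \<le> Re (complex_of_real (\<rho> x) * g x * cnj (g x))"
      using admissibleD(5)[OF assms(1), of x] by (simp add: mult_right_mono)
  qed
  also have "\<dots> = Re (weighted_ip \<rho> g g)"
    unfolding weighted_ip_def by (rule integral_Re[OF weighted_ip_integrable[OF assms(1,2,2)]])
  finally show ?thesis .
qed

text \<open>The continuous factors, weight and \<open>h\<close>, are combined in order to apply
  Parseval's identity to \<open>g\<close>.\<close>

lemma weighted_ip_has_sum:
  assumes \<rho>: "admissible \<rho>" and g: "g \<in> L2p" and h: "periodic h" "continuous_on UNIV h"
  shows "((\<lambda>k. fcoeff g k * weighted_ip \<rho> (phi k) h) has_sum weighted_ip \<rho> g h) UNIV"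
proof -
  define w where "w x = complex_of_real (\<rho> x) * h x" for x
  have w: "periodic w" "continuous_on UNIV w"
    using h admissibleD(1,2)[OF \<rho>] by (auto simp: w_def periodic_def intro!: continuous_intros)
  have *: "weighted_ip \<rho> v h = (\<integral>x. v x * cnj (w x) \<partial>tor)" for v
    by (simp add: weighted_ip_def w_def mult_ac)
  have "weighted_ip \<rho> (phi k) h = cnj (fcoeff w k)" for k
    unfolding * fcoeff_tor Bochner_Integration.integral_cnj[symmetric] by (simp add: mult.commute)
  then show ?thesis using parseval[OF g w] by (simp add: *)
qed

lemma bilin_eq:
  assumes u: "u \<in> L2p" "\<And>j. weak_partial j u (g j)" and v: "v \<in> L2p" "\<And>j. weak_partial j v (h j)"
  shows "bilin \<nu> \<sigma> u v = (\<Sum>j\<in>UNIV. weighted_ip \<nu> (g j) (h j)) + weighted_ip \<sigma> u v"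
proof -
  have gL: "g j \<in> L2p" and hL: "h j \<in> L2p" for j using u v weak_partial_L2p by blast+
  have wg: "wderiv j u \<in> L2p" and wh: "wderiv j v \<in> L2p" for j
    using u v weak_partial_L2p weak_partial_wderiv by blast+
  have "(\<integral>x. complex_of_real (\<nu> x) * (\<Sum>j\<in>UNIV. wderiv j u x * cnj (wderiv j v x)) \<partial>tor)
      = (\<Sum>j\<in>UNIV. weighted_ip \<nu> (wderiv j u) (wderiv j v))"
    unfolding weighted_ip_def sum_distrib_left
    by (subst Bochner_Integration.integral_sum[symmetric])
       (use weighted_ip_integrable[OF admissible_coeffs(1) wg wh] in \<open>simp_all add: mult.assoc\<close>)
  also have "\<dots> = (\<Sum>j\<in>UNIV. weighted_ip \<nu> (g j) (h j))"
  proof (rule sum.cong[OF refl])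
    fix j
    show "weighted_ip \<nu> (wderiv j u) (wderiv j v) = weighted_ip \<nu> (g j) (h j)"
      unfolding weighted_ip_def
    proof (rule integral_cong_AE)
      show "AE x in tor. complex_of_real (\<nu> x) * wderiv j u x * cnj (wderiv j v x) = complex_of_real (\<nu> x) * g j x * cnj (h j x)"
        using wderiv_AE[OF u(2)[of j]] wderiv_AE[OF v(2)[of j]] by eventually_elim simp
    qed (intro borel_measurable_integrable weighted_ip_integrable admissible_coeffs wg wh gL hL)+
  qed
  finally show ?thesis unfolding bilin_def LINT_tor by (simp add: weighted_ip_def)
qed

lemma bilin_H1p:
  "u \<in> H1p \<Longrightarrow> v \<in> H1p \<Longrightarrow>
    bilin \<nu> \<sigma> u v = (\<Sum>j\<in>UNIV. weighted_ip \<nu> (wderiv j u) (wderiv j v)) + weighted_ip \<sigma> u v"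
  by (intro bilin_eq H1p_L2p H1p_wderiv)

lemma bilin_hermitian: "u \<in> H1p \<Longrightarrow> v \<in> H1p \<Longrightarrow> bilin \<nu> \<sigma> v u = cnj (bilin \<nu> \<sigma> u v)"
  by (simp add: bilin_H1p weighted_ip_cnj[of _ "wderiv _ v"] weighted_ip_cnj[of _ v])

lemma bilin_add_left:
  assumes "u \<in> H1p" "u' \<in> H1p" "v \<in> H1p"
  shows "bilin \<nu> \<sigma> (\<lambda>x. u x + u' x) v = bilin \<nu> \<sigma> u v + bilin \<nu> \<sigma> u' v"
proof -
  have "bilin \<nu> \<sigma> (\<lambda>x. u x + u' x) v
      = (\<Sum>j\<in>UNIV. weighted_ip \<nu> (\<lambda>x. wderiv j u x + wderiv j u' x) (wderiv j v)) + weighted_ip \<sigma> (\<lambda>x. u x + u' x) v"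
    using assms by (intro bilin_eq weak_partial_add L2p_add H1p_L2p H1p_wderiv)
  then show ?thesis
    using assms by (simp add: bilin_H1p weighted_ip_add admissible_coeffs H1p_wderiv_L2p H1p_L2p sum.distrib)
qed

lemma bilin_scale_left:
  assumes "u \<in> H1p" "v \<in> H1p"
  shows "bilin \<nu> \<sigma> (\<lambda>x. c * u x) v = c * bilin \<nu> \<sigma> u v"
proof -
  have "bilin \<nu> \<sigma> (\<lambda>x. c * u x) v
      = (\<Sum>j\<in>UNIV. weighted_ip \<nu> (\<lambda>x. c * wderiv j u x) (wderiv j v)) + weighted_ip \<sigma> (\<lambda>x. c * u x) v"
    using assms by (intro bilin_eq weak_partial_scale L2p_scale H1p_L2p H1p_wderiv)
  then show ?thesis using assms by (simp add: bilin_H1p weighted_ip_scale sum_distrib_left distrib_left)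
qed

lemma bilin_add_right:
  "u \<in> H1p \<Longrightarrow> v \<in> H1p \<Longrightarrow> v' \<in> H1p \<Longrightarrow>
    bilin \<nu> \<sigma> u (\<lambda>x. v x + v' x) = bilin \<nu> \<sigma> u v + bilin \<nu> \<sigma> u v'"
  by (simp add: bilin_hermitian[of _ u] H1p_add bilin_add_left)

lemma bilin_scale_right:
  "u \<in> H1p \<Longrightarrow> v \<in> H1p \<Longrightarrow> bilin \<nu> \<sigma> u (\<lambda>x. c * v x) = cnj c * bilin \<nu> \<sigma> u v"
  by (simp add: bilin_hermitian[of _ u] H1p_scale bilin_scale_left)

lemma bilin_trigp_left:
  assumes v: "v \<in> H1p"
  shows "bilin \<nu> \<sigma> (trigp S c) v = (\<Sum>k\<in>S. c k * bilin \<nu> \<sigma> (phi k) v)"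
proof -
  have z: "bilin \<nu> \<sigma> (\<lambda>_. 0) v = 0"
    using bilin_scale_left[OF phi_H1p v, of 0] by simp
  show ?thesis
  proof (induction S rule: infinite_finite_induct)
    case (insert k S)
    have "trigp (insert k S) c = (\<lambda>x. c k * phi k x + trigp S c x)"
      using insert.hyps by (simp add: trigp_def)
    then show ?case using insert v
      by (simp add: bilin_add_left[OF H1p_scale[OF phi_H1p] trigp_H1p] bilin_scale_left phi_H1p)
  qed (simp_all add: trigp_def z)
qed

lemma bilin_trigp_right:
  assumes u: "u \<in> H1p"
  shows "bilin \<nu> \<sigma> u (trigp S c) = (\<Sum>k\<in>S. cnj (c k) * bilin \<nu> \<sigma> u (phi k))"
  using bilin_trigp_left[OF u, of S c] u
  by (simp add: bilin_hermitian[of _ u] trigp_H1p phi_H1p)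

text \<open>This identifies the form with the action of its matrix for a general first argument: the
  Fourier coefficients of its weak derivatives are multiples of its own coefficients, and the second
  argument is smooth.\<close>

lemma bilin_has_sum:
  assumes u: "u \<in> H1p"
  shows "((\<lambda>k. fcoeff u k * bilin \<nu> \<sigma> (phi k) (phi l)) has_sum bilin \<nu> \<sigma> u (phi l)) UNIV"
proof -
  define h where "h j x = \<i> * of_int (l $ j) * phi l x" for j x
  have h: "periodic (h j)" "continuous_on UNIV (h j)" for j
    using periodic_phi[of l] by (auto simp: h_def periodic_def intro!: continuous_intros continuous_on_phi)
  have wh: "weak_partial j (phi l) (h j)" for j unfolding h_def by (rule weak_partial_phi)
  have t: "bilin \<nu> \<sigma> v (phi l) = (\<Sum>j\<in>UNIV. weighted_ip \<nu> (g j) (h j)) + weighted_ip \<sigma> v (phi l)"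
    if "v \<in> L2p" "\<And>j. weak_partial j v (g j)" for v g
    by (rule bilin_eq[OF that phi_L2p wh])
  have "((\<lambda>k. (\<Sum>j\<in>UNIV. fcoeff (wderiv j u) k * weighted_ip \<nu> (phi k) (h j)) + fcoeff u k * weighted_ip \<sigma> (phi k) (phi l))
      has_sum (\<Sum>j\<in>UNIV. weighted_ip \<nu> (wderiv j u) (h j)) + weighted_ip \<sigma> u (phi l)) UNIV"
    by (intro has_sum_add has_sum_finite_sum weighted_ip_has_sum admissible_coeffs h H1p_wderiv_L2p u H1p_L2p
        periodic_phi continuous_on_phi)
  also have "(\<Sum>j\<in>UNIV. weighted_ip \<nu> (wderiv j u) (h j)) + weighted_ip \<sigma> u (phi l) = bilin \<nu> \<sigma> u (phi l)"
    by (rule t[symmetric]) (auto intro: H1p_L2p H1p_wderiv u)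
  also have "(\<lambda>k. (\<Sum>j\<in>UNIV. fcoeff (wderiv j u) k * weighted_ip \<nu> (phi k) (h j)) + fcoeff u k * weighted_ip \<sigma> (phi k) (phi l))
      = (\<lambda>k. fcoeff u k * bilin \<nu> \<sigma> (phi k) (phi l))"
  proof
    fix k
    have "bilin \<nu> \<sigma> (phi k) (phi l)
        = (\<Sum>j\<in>UNIV. weighted_ip \<nu> (\<lambda>x. \<i> * of_int (k $ j) * phi k x) (h j)) + weighted_ip \<sigma> (phi k) (phi l)"
      by (rule t[OF phi_L2p weak_partial_phi])
    then show "(\<Sum>j\<in>UNIV. fcoeff (wderiv j u) k * weighted_ip \<nu> (phi k) (h j)) + fcoeff u k * weighted_ip \<sigma> (phi k) (phi l)
        = fcoeff u k * bilin \<nu> \<sigma> (phi k) (phi l)"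
      unfolding weighted_ip_scale fcoeff_weak_partial[OF H1p_wderiv[OF u]]
      by (simp add: sum_distrib_left distrib_left mult_ac)
  qed
  finally show ?thesis .
qed

lemma idx_norm_sq: "(idx_norm (k :: int ^ 'd))\<^sup>2 = (\<Sum>j\<in>UNIV. (real_of_int (k $ j))\<^sup>2)"
  by (simp add: norm_vec_def L2_set_def rvec_def sum_nonneg)

lemma norm_sq_trigp:
  assumes "finite S"
  shows "(\<integral>x. (cmod (trigp S c x))\<^sup>2 \<partial>tor) = (\<Sum>k\<in>S. (cmod (c k))\<^sup>2)"
proof -
  have "complex_of_real (\<integral>x. (cmod (trigp S c x))\<^sup>2 \<partial>tor) = (\<integral>x. trigp S c x * cnj (trigp S c x) \<partial>tor)"
    by (simp only: integral_complex_of_real[symmetric] complex_norm_square)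
  also have "\<dots> = (\<Sum>k\<in>S. c k * cnj (c k))"
    using assms by (simp add: integral_cnj_trigp trigp_L2p fcoeff_trigp)
  also have "\<dots> = complex_of_real (\<Sum>k\<in>S. (cmod (c k))\<^sup>2)"
    by (simp only: of_real_sum complex_norm_square)
  finally show ?thesis by (simp only: of_real_eq_iff)
qed

lemma energy_trigp:
  assumes "finite S"
  shows "(\<Sum>j\<in>UNIV. \<integral>x. (cmod (trigp S (\<lambda>k. \<i> * of_int (k $ j) * c k) x))\<^sup>2 \<partial>tor) + (\<integral>x. (cmod (trigp S c x))\<^sup>2 \<partial>tor)
    = (\<Sum>k\<in>S. (1 + (idx_norm (k :: int ^ 'd))\<^sup>2) * (cmod (c k))\<^sup>2)"
proof -
  have "(\<Sum>j\<in>UNIV. \<Sum>k\<in>S. (real_of_int (k $ j))\<^sup>2 * (cmod (c k))\<^sup>2) = (\<Sum>k\<in>S. (idx_norm k)\<^sup>2 * (cmod (c k))\<^sup>2)"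
    by (subst sum.swap) (simp add: idx_norm_sq sum_distrib_right)
  then show ?thesis
    by (simp add: norm_sq_trigp[OF assms] norm_mult power_mult_distrib distrib_right sum.distrib)
qed

lemma bilin_trigp_bound:
  assumes S: "finite S" "finite S'"
  shows "cmod (bilin \<nu> \<sigma> (trigp S c) (trigp S' d)) \<le>
    \<alpha>\<^sub>u * ((\<Sum>k\<in>S'. (1 + (idx_norm k)\<^sup>2) * (cmod (d k))\<^sup>2) + (\<Sum>k\<in>S. (1 + (idx_norm k)\<^sup>2) * (cmod (c k))\<^sup>2)) / 2"
proof -
  define g where "g j = trigp S (\<lambda>k. \<i> * of_int (k $ j) * c k)" for j
  define h where "h j = trigp S' (\<lambda>k. \<i> * of_int (k $ j) * d k)" for j
  define I where "I v = (\<integral>x. (cmod (v x))\<^sup>2 \<partial>(tor :: (real ^ 'd) measure))" for v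
  have b: "bilin \<nu> \<sigma> (trigp S c) (trigp S' d) = (\<Sum>j\<in>UNIV. weighted_ip \<nu> (g j) (h j)) + weighted_ip \<sigma> (trigp S c) (trigp S' d)"
    unfolding g_def h_def by (intro bilin_eq trigp_L2p weak_partial_trigp)
  have "cmod (bilin \<nu> \<sigma> (trigp S c) (trigp S' d))
      \<le> (\<Sum>j\<in>UNIV. cmod (weighted_ip \<nu> (g j) (h j))) + cmod (weighted_ip \<sigma> (trigp S c) (trigp S' d))"
    unfolding b by (intro order_trans[OF norm_triangle_ineq] add_mono norm_sum) auto
  also have "\<dots> \<le> (\<Sum>j\<in>UNIV. \<alpha>\<^sub>u * (I (g j) + I (h j)) / 2) + \<alpha>\<^sub>u * (I (trigp S c) + I (trigp S' d)) / 2"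
    unfolding I_def by (intro add_mono sum_mono weighted_ip_bound admissible_coeffs) (auto simp: g_def h_def trigp_L2p)
  also have "\<dots> = \<alpha>\<^sub>u * (((\<Sum>j\<in>UNIV. I (h j)) + I (trigp S' d)) + ((\<Sum>j\<in>UNIV. I (g j)) + I (trigp S c))) / 2"
    by (simp add: sum.distrib sum_distrib_left sum_divide_distrib[symmetric] add_divide_distrib algebra_simps)
  finally show ?thesis
    unfolding I_def g_def h_def energy_trigp[OF S(1)] energy_trigp[OF S(2)] .
qed

lemma bilin_trigp_coercive:
  assumes S: "finite S"
  shows "\<alpha>\<^sub>l * (\<Sum>k\<in>S. (1 + (idx_norm k)\<^sup>2) * (cmod (c k))\<^sup>2) \<le> Re (bilin \<nu> \<sigma> (trigp S c) (trigp S c))"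
proof -
  define g where "g j = trigp S (\<lambda>k. \<i> * of_int (k $ j) * c k)" for j
  define I where "I v = (\<integral>x. (cmod (v x))\<^sup>2 \<partial>(tor :: (real ^ 'd) measure))" for v
  have b: "bilin \<nu> \<sigma> (trigp S c) (trigp S c) = (\<Sum>j\<in>UNIV. weighted_ip \<nu> (g j) (g j)) + weighted_ip \<sigma> (trigp S c) (trigp S c)"
    unfolding g_def by (intro bilin_eq trigp_L2p weak_partial_trigp)
  have "\<alpha>\<^sub>l * ((\<Sum>j\<in>UNIV. I (g j)) + I (trigp S c)) = (\<Sum>j\<in>UNIV. \<alpha>\<^sub>l * I (g j)) + \<alpha>\<^sub>l * I (trigp S c)"
    by (simp add: distrib_left sum_distrib_left)
  also have "\<dots> \<le> (\<Sum>j\<in>UNIV. Re (weighted_ip \<nu> (g j) (g j))) + Re (weighted_ip \<sigma> (trigp S c) (trigp S c))"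
    unfolding I_def by (intro add_mono sum_mono weighted_ip_coercive admissible_coeffs) (auto simp: g_def trigp_L2p)
  also have "\<dots> = Re (bilin \<nu> \<sigma> (trigp S c) (trigp S c))" unfolding b by simp
  finally show ?thesis unfolding I_def g_def energy_trigp[OF S] .
qed

section \<open>The stiffness matrix\<close>

text \<open>The weights \<open>c\<^sub>k\<close> in the definition of the stiffness matrix.\<close>

definition wt :: "int ^ 'd \<Rightarrow> real" where "wt k = sqrt (1 + (idx_norm k)\<^sup>2)"

lemma wt_pos: "0 < wt k" and wt_sq: "(wt k)\<^sup>2 = 1 + (idx_norm k)\<^sup>2"
  by (simp_all add: wt_def add_pos_nonneg)

lemma wt_nonzero [simp]: "wt k \<noteq> 0"
  using wt_pos[of k] by simp

abbreviation A :: "'d imatrix" where "A \<equiv> stiffness \<nu> \<sigma>"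

lemma stiffness_eq: "bilin \<nu> \<sigma> (phi k) (phi l) = of_real (wt l * wt k) * A l k"
  using wt_pos[of l] wt_pos[of k] by (simp add: stiffness_def wt_def)

lemma stiffness_form:
  "(\<Sum>l\<in>F. \<Sum>k\<in>G. cnj (y l) * A l k * x k)
    = bilin \<nu> \<sigma> (trigp G (\<lambda>k. x k / of_real (wt k))) (trigp F (\<lambda>l. y l / of_real (wt l)))"
  by (simp add: bilin_trigp_left trigp_H1p bilin_trigp_right phi_H1p sum_distrib_left stiffness_eq mult_ac)

lemma weighted_sum: "(\<Sum>k\<in>G. (1 + (idx_norm k)\<^sup>2) * (cmod (x k / of_real (wt k)))\<^sup>2) = (\<Sum>k\<in>G. (cmod (x k))\<^sup>2)"
  by (intro sum.cong) (simp_all add: norm_divide power_divide wt_sq[symmetric])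

lemma stiffness_form_bounded: "form_bounded \<alpha>\<^sub>u A"
  unfolding form_bounded_def
proof (intro conjI allI impI)
  show "0 \<le> \<alpha>\<^sub>u" using admissibleD(6,7)[OF admissible_coeffs(1), of 0] by linarith
  fix F G :: "(int ^ 'd) set" and x y :: "int ^ 'd \<Rightarrow> complex" assume "finite F" "finite G"
  then show "cmod (\<Sum>l\<in>F. \<Sum>k\<in>G. cnj (y l) * A l k * x k)
     \<le> \<alpha>\<^sub>u * ((\<Sum>l\<in>F. (cmod (y l))\<^sup>2) + (\<Sum>k\<in>G. (cmod (x k))\<^sup>2)) / 2"
    unfolding stiffness_form using bilin_trigp_bound[of G F "\<lambda>k. x k / of_real (wt k)" "\<lambda>l. y l / of_real (wt l)"] by (simp only: weighted_sum)
qed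

text \<open>Finite sections of the matrix are values of the form at trigonometric polynomials, whose
  weighted coefficients carry the norm of \<open>V\<close>.\<close>

lemma stiffness_coercive_matrix: "coercive_matrix A \<alpha>\<^sub>l \<alpha>\<^sub>u"
proof (rule coercive_matrix.intro[OF stiffness_form_bounded coercive_operator_mat_op[OF stiffness_form_bounded]])
  show "A l k = cnj (A k l)" for l k
    by (simp add: stiffness_def bilin_hermitian[OF phi_H1p phi_H1p, of k l] mult.commute)
  show "0 < \<alpha>\<^sub>l" by (rule lower_pos)
  show "\<alpha>\<^sub>l * (\<Sum>k\<in>F. (cmod (x k))\<^sup>2) \<le> Re (\<Sum>l\<in>F. \<Sum>k\<in>F. cnj (x l) * A l k * x k)" if "finite F" for F x
    unfolding stiffness_form using bilin_trigp_coercive[OF that, of "\<lambda>k. x k / of_real (wt k)"]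
    by (simp only: weighted_sum)
qed

end

sublocale elliptic \<subseteq> coercive_matrix "stiffness \<nu> \<sigma>" \<alpha>\<^sub>l \<alpha>\<^sub>u
  by (rule stiffness_coercive_matrix)

section \<open>Coefficient vectors\<close>

lemma summable_on_finite_sum:
  fixes f :: "'i \<Rightarrow> 'a \<Rightarrow> 'b::topological_comm_monoid_add"
  assumes "\<And>i. i \<in> I \<Longrightarrow> f i summable_on A"
  shows "(\<lambda>k. \<Sum>i\<in>I. f i k) summable_on A"
  using assms by (induction I rule: infinite_finite_induct) (auto intro: summable_on_add)

context elliptic
begin

abbreviation T :: "(int ^ 'd) l2 \<Rightarrow> (int ^ 'd) l2" where "T \<equiv> mat_op (stiffness \<nu> \<sigma>)"

text \<open>The isometry from \<open>V\<close> into \<open>l2\<close>; on vectors with finite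
  support in \<open>S\<close>, \<open>synth S\<close> below is its inverse.\<close>

definition cvec :: "(real ^ 'd \<Rightarrow> complex) \<Rightarrow> (int ^ 'd) l2" where
  "cvec v = mk (\<lambda>k. of_real (wt k) * fcoeff v k)"

lemma cmod_weighted_sq: "(cmod (of_real (wt k) * z))\<^sup>2 = (1 + (idx_norm k)\<^sup>2) * (cmod z)\<^sup>2"
  by (simp add: norm_mult power_mult_distrib wt_sq)

lemma seq_cvec:
  assumes v: "v \<in> H1p"
  shows "seq (cvec v) k = of_real (wt k) * fcoeff v k"
proof -
  have "(\<lambda>k. (\<Sum>j\<in>UNIV. (cmod (fcoeff (wderiv j v) k))\<^sup>2) + (cmod (fcoeff v k))\<^sup>2) summable_on UNIV"
    by (intro summable_on_add summable_on_finite_sum fcoeff_summable H1p_wderiv_L2p H1p_L2p v)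
  also have "(\<lambda>k. (\<Sum>j\<in>UNIV. (cmod (fcoeff (wderiv j v) k))\<^sup>2) + (cmod (fcoeff v k))\<^sup>2)
      = (\<lambda>k. (cmod (of_real (wt k) * fcoeff v k))\<^sup>2)"
    by (simp add: wt_sq fcoeff_weak_partial[OF H1p_wderiv[OF v]] norm_mult power_mult_distrib
        idx_norm_sq sum_distrib_right distrib_right add.commute)
  finally show ?thesis unfolding cvec_def by (simp add: seq_mk)
qed

lemma H1_norm_eq: "v \<in> H1p \<Longrightarrow> H1_norm v = norm (cvec v)"
  by (simp add: H1_norm_def norm_l2_eq seq_cvec cmod_weighted_sq)

lemma cvec_diff: "u \<in> H1p \<Longrightarrow> v \<in> H1p \<Longrightarrow> (\<lambda>x. u x - v x) \<in> H1p \<and> cvec (\<lambda>x. u x - v x) = cvec u - cvec v"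
proof -
  assume uv: "u \<in> H1p" "v \<in> H1p"
  have d: "(\<lambda>x. u x - v x) \<in> H1p" using H1p_add[OF uv(1) H1p_scale[OF uv(2), of "-1"]] by simp
  moreover have "cvec (\<lambda>x. u x - v x) = cvec u - cvec v"
    using uv d by (intro l2_eqI) (simp add: seq_cvec fcoeff_diff H1p_L2p right_diff_distrib)
  ultimately show ?thesis by blast
qed

definition synth :: "(int ^ 'd) set \<Rightarrow> (int ^ 'd) l2 \<Rightarrow> real ^ 'd \<Rightarrow> complex" where
  "synth S x = trigp S (\<lambda>k. seq x k / of_real (wt k))"

lemma synth_H1p: "synth S x \<in> H1p"
  by (simp add: synth_def trigp_H1p)

lemma cvec_synth: "finite S \<Longrightarrow> restr S x = x \<Longrightarrow> cvec (synth S x) = x"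
proof (rule l2_eqI)
  fix k assume S: "finite S" and x: "restr S x = x"
  then have "k \<notin> S \<Longrightarrow> seq x k = 0" by (metis seq_restr)
  then show "seq (cvec (synth S x)) k = seq x k"
    using S wt_pos[of k] by (simp add: seq_cvec synth_H1p) (simp add: synth_def fcoeff_trigp)
qed

lemma H1_norm_minus_synth:
  "u \<in> H1p \<Longrightarrow> finite S \<Longrightarrow> restr S x = x \<Longrightarrow> H1_norm (\<lambda>y. u y - synth S x y) = norm (cvec u - x)"
  using cvec_diff[OF _ synth_H1p] by (simp add: H1_norm_eq cvec_synth)

lemma proj_eq_synth: "v \<in> H1p \<Longrightarrow> proj S v = synth S (restr S (cvec v))"
  using wt_pos by (auto simp: proj_def synth_def trigp_def seq_cvec fun_eq_iff less_imp_neq intro!: sum.cong)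

lemma H1_norm_minus_proj:
  "v \<in> H1p \<Longrightarrow> finite S \<Longrightarrow> H1_norm (\<lambda>x. v x - proj S v x) = norm (cvec v - restr S (cvec v))"
  by (simp add: proj_eq_synth H1_norm_minus_synth)

lemma best_err_eq: "v \<in> H1p \<Longrightarrow> best_err N v = best_l2_err N (cvec v)"
  unfolding best_err_def best_l2_err_def by (rule INF_cong) (auto simp: H1_norm_minus_proj)

text \<open>The weighted form of \<open>bilin_has_sum\<close>.\<close>

lemma bilin_eq_T: "v \<in> H1p \<Longrightarrow> bilin \<nu> \<sigma> v (phi l) = of_real (wt l) * seq (T (cvec v)) l"
proof -
  assume v: "v \<in> H1p"
  have "((\<lambda>k. of_real (wt l) * (A l k * seq (cvec v) k)) has_sum of_real (wt l) * seq (T (cvec v)) l) UNIV"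
    unfolding seq_mat_op[OF form]
    by (intro has_sum_cmult_right has_sum_infsum form_bounded_summable[OF form])
  moreover have "of_real (wt l) * (A l k * seq (cvec v) k) = fcoeff v k * bilin \<nu> \<sigma> (phi k) (phi l)" for k
    by (simp add: seq_cvec v stiffness_eq)
  ultimately show ?thesis using bilin_has_sum[OF v, of l] has_sum_unique by fastforce
qed

section \<open>Forms\<close>

text \<open>Norms and best errors of a form depend only on its values at the characters, so this
  relation transfers them to \<open>l2\<close>.\<close>

definition represents :: "'d form \<Rightarrow> (int ^ 'd) l2 \<Rightarrow> bool" where
  "represents r y \<longleftrightarrow> (\<forall>l. r (phi l) = of_real (wt l) * seq y l)"

lemma weighted_dual_sq: "(cmod (of_real (wt l) * z))\<^sup>2 / (1 + (idx_norm l)\<^sup>2) = (cmod z)\<^sup>2"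
  using wt_pos[of l] by (simp add: norm_mult power_mult_distrib wt_sq[symmetric])

lemma dual_norm_eq: "represents r y \<Longrightarrow> dual_norm r = norm y"
  unfolding dual_norm_def norm_l2_eq represents_def by (simp add: weighted_dual_sq)

lemma represents_proj:
  assumes r: "represents r y" and S: "finite S"
  shows "represents (proj_dual S r) (restr S y)" "represents (\<lambda>v. r v - proj_dual S r v) (y - restr S y)"
proof -
  have "proj_dual S r (phi l) = (if l \<in> S then r (phi l) else 0)" for l
    using S by (simp add: proj_dual_def fcoeff_phi if_distrib cong: if_cong)
  then show "represents (proj_dual S r) (restr S y)" "represents (\<lambda>v. r v - proj_dual S r v) (y - restr S y)"
    using r by (auto simp: represents_def)
qed

lemma best_err_dual_eq: "represents r y \<Longrightarrow> best_err_dual N r = best_l2_err N y"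
  unfolding best_err_dual_def best_l2_err_def by (rule INF_cong) (auto intro!: dual_norm_eq represents_proj)

end

section \<open>The elliptic problem\<close>

locale elliptic_problem = elliptic \<nu> \<sigma> \<nu>\<^sub>l \<nu>\<^sub>u \<sigma>\<^sub>l \<sigma>\<^sub>u \<alpha>\<^sub>l \<alpha>\<^sub>u
  for \<nu> \<sigma> :: "real ^ 'd::finite \<Rightarrow> real" and \<nu>\<^sub>l \<nu>\<^sub>u \<sigma>\<^sub>l \<sigma>\<^sub>u \<alpha>\<^sub>l \<alpha>\<^sub>u :: real +
  fixes f :: "'d form" and u :: "real ^ 'd \<Rightarrow> complex"
  assumes f: "f \<in> Hm1p" and solution: "weak_solution \<nu> \<sigma> f u"
begin

lemma u_H1p: "u \<in> H1p" and f_eq: "v \<in> H1p \<Longrightarrow> f v = bilin \<nu> \<sigma> u v"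
  using solution by (auto simp: weak_solution_def)

text \<open>Weighted coefficients of the exact solution and of the Galerkin solution on
  \<open>S\<close>.\<close>

abbreviation uvec :: "(int ^ 'd) l2" where "uvec \<equiv> cvec u"
abbreviation gvec :: "(int ^ 'd) set \<Rightarrow> (int ^ 'd) l2" where "gvec S \<equiv> gal S (T uvec)"

lemma represents_f: "represents f (T uvec)"
  by (simp add: represents_def f_eq phi_H1p bilin_eq_T u_H1p)

text \<open>Both variational problems say that the images of the coefficient vectors agree on
  \<open>S\<close>, and the finite section has exactly one solution.\<close>

lemma galerkin_eq:
  assumes S: "finite S"
  shows "galerkin \<nu> \<sigma> f S = synth S (gvec S)"
  unfolding galerkin_def
proof (rule the_equality)
  have tr: "trial_space S = range (trigp S)" by (auto simp: trial_space_def trigp_def)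
  have w: "cvec (synth S (gvec S)) = gvec S" using S by (intro cvec_synth restr_gal)
  have eq: "bilin \<nu> \<sigma> (synth S (gvec S)) (phi l) = f (phi l)" if "l \<in> S" for l
  proof -
    have "seq (restr S (T (gvec S))) l = seq (restr S (T uvec)) l" by (simp only: restr_T_gal)
    then show ?thesis using that by (simp add: bilin_eq_T synth_H1p w f_eq phi_H1p u_H1p)
  qed
  show "synth S (gvec S) \<in> trial_space S \<and> (\<forall>v\<in>trial_space S. bilin \<nu> \<sigma> (synth S (gvec S)) v = f v)"
    unfolding tr using eq
    by (auto simp: synth_def bilin_trigp_right trigp_H1p f_eq u_H1p phi_H1p intro!: sum.cong)
  fix w assume w': "w \<in> trial_space S \<and> (\<forall>v\<in>trial_space S. bilin \<nu> \<sigma> w v = f v)"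
  then obtain c where c: "w = trigp S c" unfolding tr by blast
  have wH: "w \<in> H1p" by (simp add: c trigp_H1p)
  have fw: "fcoeff w k = (if k \<in> S then c k else 0)" for k by (simp add: c fcoeff_trigp S)
  have phi_tr: "phi l \<in> trial_space S" if "l \<in> S" for l
  proof -
    have "phi l = trigp S (\<lambda>k. if k = l then 1 else 0)"
      using that S by (auto simp: trigp_def fun_eq_iff if_distrib if_distribR cong: if_cong)
    then show ?thesis unfolding tr by blast
  qed
  have "gal S (T uvec) = cvec w"
  proof (rule gal_unique)
    show "restr S (cvec w) = cvec w" by (rule l2_eqI) (simp add: seq_cvec wH fw)
    show "restr S (T (cvec w)) = restr S (T uvec)"
    proof (rule l2_eqI)
      fix l
      have "seq (T (cvec w)) l = seq (T uvec) l" if "l \<in> S"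
      proof -
        have "bilin \<nu> \<sigma> w (phi l) = bilin \<nu> \<sigma> u (phi l)" using w' phi_tr[OF that] f_eq phi_H1p by auto
        then show ?thesis using wt_pos[of l] by (simp add: bilin_eq_T wH u_H1p)
      qed
      then show "seq (restr S (T (cvec w))) l = seq (restr S (T uvec)) l" by simp
    qed
  qed
  moreover have "synth S (cvec w) = w"
  proof -
    have "w = (\<lambda>x. \<Sum>k\<in>S. c k * phi k x)" by (simp add: c trigp_def)
    moreover have "seq (cvec w) k / of_real (wt k) = c k" if "k \<in> S" for k
      using that by (simp add: seq_cvec wH fw)
    ultimately show ?thesis by (simp add: synth_def trigp_def)
  qed
  ultimately show "w = synth S (gvec S)" by simp
qed

lemma H1_norm_galerkin_error:
  "finite S \<Longrightarrow> H1_norm (\<lambda>x. u x - synth S (gvec S) x) = norm (uvec - gvec S)"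
  by (intro H1_norm_minus_synth u_H1p restr_gal)

lemma represents_residual:
  "finite S \<Longrightarrow> represents (residual \<nu> \<sigma> f (synth S (gvec S))) (T (uvec - gvec S))"
  using represents_f by (simp add: represents_def residual_def bilin_eq_T synth_H1p cvec_synth restr_gal right_diff_distrib)

text \<open>The form with fixed first argument \<open>phi k\<close> is bounded, since its value is
  conjugate to a single coordinate of the image of \<open>cvec v\<close> under a bounded
  operator.\<close>

lemma residual_Hm1p: "residual \<nu> \<sigma> f (trigp S c) \<in> Hm1p"
proof -
  define w where "w = trigp S c"
  have wH: "w \<in> H1p" by (simp add: w_def trigp_H1p)
  have "\<exists>K. \<forall>v\<in>H1p. cmod (f v) \<le> K * H1_norm v" using f by (simp add: Hm1p_def)
  then obtain K where K: "\<And>v. v \<in> H1p \<Longrightarrow> cmod (f v) \<le> K * H1_norm v" by blast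
  define L where "L = (\<Sum>k\<in>S. cmod (c k) * (wt k * \<alpha>\<^sub>u))"
  have "cmod (bilin \<nu> \<sigma> w v) \<le> L * H1_norm v" if v: "v \<in> H1p" for v
  proof -
    have 1: "cmod (bilin \<nu> \<sigma> (phi k) v) \<le> wt k * \<alpha>\<^sub>u * H1_norm v" for k
    proof -
      have "cmod (bilin \<nu> \<sigma> (phi k) v) = wt k * cmod (seq (T (cvec v)) k)"
        using bilin_hermitian[OF v phi_H1p, of k] wt_pos[of k] by (simp add: bilin_eq_T v norm_mult)
      also have "\<dots> \<le> wt k * (\<alpha>\<^sub>u * norm (cvec v))"
        using wt_pos[of k] by (intro mult_left_mono order_trans[OF cmod_seq_le_norm bounded]) auto
      finally show ?thesis by (simp add: H1_norm_eq v)
    qed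
    have "cmod (bilin \<nu> \<sigma> w v) \<le> (\<Sum>k\<in>S. cmod (c k) * (wt k * \<alpha>\<^sub>u * H1_norm v))"
      unfolding w_def bilin_trigp_left[OF v]
      by (intro order_trans[OF norm_sum] sum_mono) (simp add: norm_mult mult_left_mono 1)
    then show ?thesis by (simp add: L_def sum_distrib_right mult.assoc)
  qed
  then have L: "cmod (bilin \<nu> \<sigma> w v) \<le> L * H1_norm v" if "v \<in> H1p" for v using that by blast
  have bd: "\<forall>v\<in>H1p. cmod (f v - bilin \<nu> \<sigma> w v) \<le> (K + L) * H1_norm v"
  proof
    fix v :: "real ^ 'd \<Rightarrow> complex" assume v: "v \<in> H1p"
    have "cmod (f v - bilin \<nu> \<sigma> w v) \<le> cmod (f v) + cmod (bilin \<nu> \<sigma> w v)" by (rule norm_triangle_ineq4)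
    also have "\<dots> \<le> K * H1_norm v + L * H1_norm v" by (intro add_mono K L v)
    finally show "cmod (f v - bilin \<nu> \<sigma> w v) \<le> (K + L) * H1_norm v" by (simp add: distrib_right)
  qed
  have add: "\<forall>v\<in>H1p. \<forall>v'\<in>H1p. f (\<lambda>x. v x + v' x) - bilin \<nu> \<sigma> w (\<lambda>x. v x + v' x)
      = (f v - bilin \<nu> \<sigma> w v) + (f v' - bilin \<nu> \<sigma> w v')"
    using f wH by (auto simp: Hm1p_def bilin_add_right)
  have scale: "\<forall>a. \<forall>v\<in>H1p. f (\<lambda>x. a * v x) - bilin \<nu> \<sigma> w (\<lambda>x. a * v x) = cnj a * (f v - bilin \<nu> \<sigma> w v)"
    using f wH by (auto simp: Hm1p_def bilin_scale_right right_diff_distrib)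
  have "residual \<nu> \<sigma> f w \<in> Hm1p"
    unfolding Hm1p_def residual_def using add scale bd by blast
  then show ?thesis by (simp add: w_def)
qed

end

section \<open>Runs of the algorithm\<close>

locale adfour_run = elliptic_problem \<nu> \<sigma> \<nu>\<^sub>l \<nu>\<^sub>u \<sigma>\<^sub>l \<sigma>\<^sub>u \<alpha>\<^sub>l \<alpha>\<^sub>u f u
  for \<nu> \<sigma> :: "real ^ 'd::finite \<Rightarrow> real" and \<nu>\<^sub>l \<nu>\<^sub>u \<sigma>\<^sub>l \<sigma>\<^sub>u \<alpha>\<^sub>l \<alpha>\<^sub>u :: real and f u +
  fixes \<psi> :: "nat \<Rightarrow> real" and \<theta> tol :: real and J N :: nat
    and \<Lambda> \<Lambda>h :: "nat \<Rightarrow> (int ^ 'd) set" and U R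
  assumes inverse_decay:
      "ell2_opnorm (\<lambda>l k. mat_inverse (stiffness \<nu> \<sigma>) l k - mat_trunc J (mat_inverse (stiffness \<nu> \<sigma>)) l k) \<le> ereal (\<psi> J)"
    and theta: "0 < \<theta>" "\<theta> < 1"
    and psi: "\<psi> J \<le> sqrt ((1 - \<theta>\<^sup>2) / (\<alpha>\<^sub>l * \<alpha>\<^sub>u))"
    and run: "pc_adfour_run \<nu> \<sigma> \<alpha>\<^sub>l f \<theta> tol J N \<Lambda> \<Lambda>h U R"
begin

lemma run_0: "\<Lambda> 0 = {}" "U 0 = (\<lambda>_. 0)" "R 0 = f"
  using run by (auto simp: pc_adfour_run_def)

lemma run_Suc:
  assumes "n < N"
  obtains D where "dorfler (R n) \<theta> D" "\<Lambda>h (n + 1) = \<Lambda> n \<union> enrich D J"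
    "coarse (galerkin \<nu> \<sigma> f (\<Lambda>h (n + 1))) (1 / \<alpha>\<^sub>l * sqrt (1 - \<theta>\<^sup>2) * dual_norm (R n)) (\<Lambda>h (n + 1)) (\<Lambda> (n + 1))"
    "U (n + 1) = galerkin \<nu> \<sigma> f (\<Lambda> (n + 1))" "R (n + 1) = residual \<nu> \<sigma> f (U (n + 1))"
  using run assms unfolding pc_adfour_run_def e_dorfler_def by blast

lemma run_invariant:
  "n \<le> N \<Longrightarrow> finite (\<Lambda> n) \<and> U n = synth (\<Lambda> n) (gvec (\<Lambda> n)) \<and> represents (R n) (T (uvec - gvec (\<Lambda> n)))"
proof (induction n)
  case 0
  have g: "gvec {} = 0" by (rule gal_unique) auto
  then show ?case using represents_f by (simp add: run_0 g synth_def trigp_def)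
next
  case (Suc n)
  then have n: "n < N" and fin: "finite (\<Lambda> n)" by auto
  from n obtain D where D: "dorfler (R n) \<theta> D" "\<Lambda>h (n + 1) = \<Lambda> n \<union> enrich D J"
    "coarse (galerkin \<nu> \<sigma> f (\<Lambda>h (n + 1))) (1 / \<alpha>\<^sub>l * sqrt (1 - \<theta>\<^sup>2) * dual_norm (R n)) (\<Lambda>h (n + 1)) (\<Lambda> (n + 1))"
    "U (n + 1) = galerkin \<nu> \<sigma> f (\<Lambda> (n + 1))" "R (n + 1) = residual \<nu> \<sigma> f (U (n + 1))"
    by (rule run_Suc)
  have "finite (\<Lambda>h (n + 1))" unfolding D(2) using D(1) fin by (simp add: dorfler_def finite_enrich)
  moreover have "\<Lambda> (n + 1) \<subseteq> \<Lambda>h (n + 1)" using D(3) by (simp add: coarse_def)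
  ultimately have fin': "finite (\<Lambda> (n + 1))" by (rule rev_finite_subset)
  then show ?case using D(4,5) represents_residual[OF fin'] by (simp add: galerkin_eq)
qed

text \<open>Marking and coarsening enter only through minimality: the marked set is no larger than
  any set that captures enough of the residual, the new active set is no larger than any set that
  approximates \<open>u\<close> up to the slack of the coarsening.\<close>

lemma run_step:
  assumes n: "n < N"
  defines "r \<equiv> T (uvec - gvec (\<Lambda> n))"
  defines "\<epsilon> \<equiv> 1 / \<alpha>\<^sub>l * sqrt (1 - \<theta>\<^sup>2) * norm r"
  obtains D where "finite D" "\<Lambda>h (n + 1) = \<Lambda> n \<union> enrich D J"
    "\<And>Z. finite Z \<Longrightarrow> norm (r - restr Z r) \<le> sqrt (1 - \<theta>\<^sup>2) * norm r \<Longrightarrow> card D \<le> card Z"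
    "\<And>Z. finite Z \<Longrightarrow> norm (uvec - restr Z uvec) \<le> marking_gap \<theta> * \<epsilon> \<Longrightarrow> card (\<Lambda> (n + 1)) \<le> card Z"
    "norm (uvec - gvec (\<Lambda> (n + 1))) \<le> 4 * sqrt (\<alpha>\<^sub>u / \<alpha>\<^sub>l) * \<epsilon>"
proof -
  have inv: "finite (\<Lambda> n)" "U n = synth (\<Lambda> n) (gvec (\<Lambda> n))" "represents (R n) r"
    using run_invariant[of n] n by (auto simp: r_def)
  have Rn: "dual_norm (R n) = norm r" by (rule dual_norm_eq[OF inv(3)])
  have Rp: "dual_norm (proj_dual Z (R n)) = norm (restr Z r)" if "finite Z" for Z
    by (rule dual_norm_eq[OF represents_proj(1)[OF inv(3) that]])
  from n obtain D where D: "dorfler (R n) \<theta> D" "\<Lambda>h (n + 1) = \<Lambda> n \<union> enrich D J"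
    "coarse (galerkin \<nu> \<sigma> f (\<Lambda>h (n + 1))) (1 / \<alpha>\<^sub>l * sqrt (1 - \<theta>\<^sup>2) * dual_norm (R n)) (\<Lambda>h (n + 1)) (\<Lambda> (n + 1))"
    by (rule run_Suc)
  define S where "S = \<Lambda>h (n + 1)"
  define w where "w = gvec S"
  have fD: "finite D" using D(1) by (simp add: dorfler_def)
  have fS: "finite S" unfolding S_def D(2) using fD inv(1) by (simp add: finite_enrich)
  have mark: "\<theta> * norm r \<le> norm (restr D r)" using D(1) Rp[OF fD] by (simp add: dorfler_def Rn)
  have mark_min: "card D \<le> card Z" if Z: "finite Z" "norm (r - restr Z r) \<le> sqrt (1 - \<theta>\<^sup>2) * norm r" for Z
  proof -
    have t: "0 \<le> 1 - \<theta>\<^sup>2" using theta by (simp add: power_le_one)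
    have "(norm (r - restr Z r))\<^sup>2 \<le> (sqrt (1 - \<theta>\<^sup>2) * norm r)\<^sup>2" using Z(2) by (intro power_mono) auto
    then have "(\<theta> * norm r)\<^sup>2 \<le> (norm (restr Z r))\<^sup>2"
      using norm_restr_pythagoras[of r Z] t by (simp add: power_mult_distrib left_diff_distrib)
    then have "\<theta> * norm r \<le> norm (restr Z r)" by (rule power2_le_imp_le) simp
    then show ?thesis using D(1) Z by (simp add: dorfler_def Rn Rp)
  qed
  have wS: "restr S w = w" unfolding w_def by (rule restr_gal)
  obtain b where b: "restr (enrich D J) b = b" "norm (gal UNIV (restr D r) - b) \<le> \<psi> J * norm (restr D r)"
    using truncated_inverse_approximation[OF fD _ inverse_decay, of "restr D r"] by auto
  have err: "norm (uvec - w) \<le> (2 - marking_gap \<theta>) * \<epsilon>"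
    unfolding w_def \<epsilon>_def
  proof (rule predictor_error[OF theta])
    show "r = T (uvec - gvec (\<Lambda> n))" by (simp only: r_def)
    show "restr S (gvec (\<Lambda> n)) = gvec (\<Lambda> n)"
      unfolding S_def D(2) by (rule restr_mono[OF restr_gal]) simp
    show "D \<subseteq> S" unfolding S_def D(2) using subset_enrich[of D J] by auto
    show "restr S b = b" unfolding S_def D(2) by (rule restr_mono[OF b(1)]) simp
  qed (use mark b psi in auto)
  have H: "H1_norm (\<lambda>x. synth S w x - proj Z (synth S w) x) = norm (w - restr Z w)" if "finite Z" for Z
    using that by (simp add: H1_norm_minus_proj synth_H1p cvec_synth fS wS)
  have co: "coarse (synth S w) \<epsilon> S (\<Lambda> (n + 1))"
    using D(3) by (simp only: S_def[symmetric] galerkin_eq[OF fS] w_def Rn \<epsilon>_def)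
  then have K: "\<Lambda> (n + 1) \<subseteq> S" "finite (\<Lambda> (n + 1))" using fS finite_subset by (auto simp: coarse_def)
  show ?thesis
  proof (rule that[OF fD D(2) mark_min])
    show "norm (uvec - gvec (\<Lambda> (n + 1))) \<le> 4 * sqrt (\<alpha>\<^sub>u / \<alpha>\<^sub>l) * \<epsilon>"
    proof (rule corrector_error[OF err])
      show "0 \<le> marking_gap \<theta>" using marking_gap(1)[OF theta] by simp
      show "0 \<le> \<epsilon>" using lower_pos theta by (simp add: \<epsilon>_def power_le_one)
      show "norm (w - restr (\<Lambda> (n + 1)) w) \<le> 2 * \<epsilon>" using co H[OF K(2)] by (simp add: coarse_def)
    qed
    fix Z assume Z: "finite Z" "norm (uvec - restr Z uvec) \<le> marking_gap \<theta> * \<epsilon>"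
    show "card (\<Lambda> (n + 1)) \<le> card Z"
    proof (rule corrector_card[OF err wS _ Z])
      fix T' assume T': "T' \<subseteq> S" "norm (w - restr T' w) \<le> 2 * \<epsilon>"
      then have "finite T'" using fS finite_subset by blast
      then show "card (\<Lambda> (n + 1)) \<le> card T'" using co T' H by (simp add: coarse_def)
    qed
  qed
qed

end

section \<open>Cardinality bounds\<close>

lemma omega_pos: "0 < omega TYPE('d::finite)"
  unfolding omega_def by (rule content_ball_pos) simp

text \<open>The rate in the weight of the exponential class, after separating the power of
  \<open>N\<close>.\<close>

definition growth :: "'d::finite itself \<Rightarrow> real \<Rightarrow> real \<Rightarrow> real" where
  "growth D \<eta> t = \<eta> * omega D powr (- t / real CARD('d))"

lemma growth_pos: "0 < \<eta> \<Longrightarrow> 0 < growth TYPE('d::finite) \<eta> t"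
  using omega_pos[where 'd='d] by (simp add: growth_def)

lemma exp_weight_eq: "exp_weight TYPE('d::finite) \<eta> t N = exp (growth TYPE('d) \<eta> t * real N powr (t / real CARD('d)))"
  by (simp add: exp_weight_def growth_def)

lemma growth_powr:
  assumes "0 < \<eta>" "0 < t" "0 \<le> L"
  shows "(L / growth TYPE('d::finite) \<eta> t) powr (1 / (t / real CARD('d)))
    = omega TYPE('d) / \<eta> powr (real CARD('d) / t) * L powr (real CARD('d) / t)"
proof -
  have "growth TYPE('d) \<eta> t powr (real CARD('d) / t) = \<eta> powr (real CARD('d) / t) / omega TYPE('d)"
  proof -
    have "(omega TYPE('d) powr (- t / real CARD('d))) powr (real CARD('d) / t) = omega TYPE('d) powr (-1)"
      using assms omega_pos[where 'd='d] by (simp add: powr_powr)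
    also have "\<dots> = inverse (omega TYPE('d))" using omega_pos[where 'd='d] by (simp add: powr_minus)
    finally have "(omega TYPE('d) powr (- t / real CARD('d))) powr (real CARD('d) / t) = inverse (omega TYPE('d))" .
    then show ?thesis unfolding growth_def by (simp add: powr_mult divide_inverse)
  qed
  then show ?thesis using assms growth_pos[of \<eta> t, where 'd='d] by (simp add: powr_divide)
qed

context elliptic_problem
begin

lemma AG_bound:
  assumes "u \<in> AG \<eta> t"
  shows "best_l2_err n uvec * exp (growth TYPE('d) \<eta> t * real n powr (t / real CARD('d))) \<le> AG_norm \<eta> t u"
  using assms unfolding AG_norm_def AG_def
  by (auto simp: best_err_eq[symmetric] u_H1p exp_weight_eq[symmetric] intro!: cSUP_upper)

lemma AG_norm_nonneg:
  assumes "u \<in> AG \<eta> t" "0 < t"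
  shows "0 \<le> AG_norm \<eta> t u"
  using AG_bound[OF assms(1), of 0] assms(2) by (simp add: best_l2_err_0) (meson norm_ge_zero order_trans)

lemma residual_sparsityD:
  assumes "residual_sparsity \<nu> \<sigma> f u \<eta> t \<eta>' t'" "0 \<le> AG_norm \<eta> t u"
  obtains K where "1 \<le> K" "\<And>S n. finite S \<Longrightarrow>
      best_l2_err n (T (uvec - gvec S)) * exp (growth TYPE('d) \<eta>' t' * real n powr (t' / real CARD('d))) \<le> K * AG_norm \<eta> t u"
proof -
  obtain K where K: "\<And>S. finite S \<Longrightarrow> residual \<nu> \<sigma> f (galerkin \<nu> \<sigma> f S) \<in> AG_dual \<eta>' t' \<and>
      AG_dual_norm \<eta>' t' (residual \<nu> \<sigma> f (galerkin \<nu> \<sigma> f S)) \<le> K * AG_norm \<eta> t u"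
    using assms(1) unfolding residual_sparsity_def by blast
  show ?thesis
  proof (rule that[of "max K 1"])
    fix S :: "(int ^ 'd) set" and n assume S: "finite S"
    define r where "r = residual \<nu> \<sigma> f (galerkin \<nu> \<sigma> f S)"
    have rep: "represents r (T (uvec - gvec S))"
      unfolding r_def galerkin_eq[OF S] by (rule represents_residual[OF S])
    have "best_err_dual n r * exp_weight TYPE('d) \<eta>' t' n \<le> AG_dual_norm \<eta>' t' r"
      using K[OF S] unfolding AG_dual_norm_def AG_dual_def r_def by (auto intro!: cSUP_upper)
    also have "\<dots> \<le> K * AG_norm \<eta> t u" using K[OF S] by (simp add: r_def)
    also have "\<dots> \<le> max K 1 * AG_norm \<eta> t u" using assms(2) by (intro mult_right_mono) auto
    finally show "best_l2_err n (T (uvec - gvec S)) * exp (growth TYPE('d) \<eta>' t' * real n powr (t' / real CARD('d)))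
        \<le> max K 1 * AG_norm \<eta> t u"
      by (simp only: best_err_dual_eq[OF rep] exp_weight_eq)
  qed simp
qed

lemma mat_op_diff:
  assumes "form_bounded c B" "form_bounded c' B'" "form_bounded c'' (\<lambda>l k. B l k - B' l k)"
  shows "mat_op (\<lambda>l k. B l k - B' l k) x = mat_op B x - mat_op B' x"
proof (rule l2_eqI)
  fix l
  have "(\<Sum>\<^sub>\<infinity>k. (B l k - B' l k) * seq x k + B' l k * seq x k)
      = (\<Sum>\<^sub>\<infinity>k. (B l k - B' l k) * seq x k) + (\<Sum>\<^sub>\<infinity>k. B' l k * seq x k)"
    by (intro infsum_add form_bounded_summable[OF assms(2)] form_bounded_summable[OF assms(3)])
  then show "seq (mat_op (\<lambda>l k. B l k - B' l k) x) l = seq (mat_op B x - mat_op B' x) l"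
    by (simp add: seq_mat_op[OF assms(1)] seq_mat_op[OF assms(2)] seq_mat_op[OF assms(3)] left_diff_distrib)
qed

text \<open>Exponential decay of the stiffness matrix yields banded approximations, so that
  \<open>residual_sparsity_class\<close> applies. Its rate is converted to the normalization by
  \<open>omega\<close> and lowered to \<open>\<eta>\<close> if necessary.\<close>

lemma residual_sparsity_exists:
  assumes \<mu>: "0 < \<mu>" "stiffness \<nu> \<sigma> \<in> exp_decay \<mu>"
    and \<eta>: "0 < \<eta>" and t: "0 < t" "t \<le> real CARD('d)" and u: "u \<in> AG \<eta> t"
  shows "\<exists>\<eta>' t'. 0 < \<eta>' \<and> \<eta>' \<le> \<eta> \<and> 0 < t' \<and> t' \<le> t \<and> residual_sparsity \<nu> \<sigma> f u \<eta> t \<eta>' t'"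
proof -
  obtain c \<beta> where c: "0 < c" "0 < \<beta>" "form_bounded c (stiffness \<nu> \<sigma>)"
    and fd: "\<And>J. form_bounded (c * exp (- \<beta> * real J)) (\<lambda>l k. stiffness \<nu> \<sigma> l k - mat_trunc J (stiffness \<nu> \<sigma>) l k)"
    and ft: "\<And>J. form_bounded (2 * c) (mat_trunc J (stiffness \<nu> \<sigma>))"
    using exp_decay_banded_approximation[OF \<mu>(2,1)] by blast
  interpret banded_coercive T \<alpha>\<^sub>l \<alpha>\<^sub>u c \<beta>
  proof (unfold_locales)
    fix J
    have "norm (T x - mat_op (mat_trunc J (stiffness \<nu> \<sigma>)) x) \<le> c * exp (- \<beta> * real J) * norm x" for x
      using norm_mat_op[OF fd, of J x] by (simp only: mat_op_diff[OF c(3) ft fd])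
    then show "\<exists>B. banded J B \<and> (\<forall>x. norm (T x - B x) \<le> c * exp (- \<beta> * real J) * norm x)"
      using banded_mat_op_trunc[OF ft] by blast
  qed (use c in auto)
  define d where "d = real CARD('d)"
  define s where "s = t / d"
  define s' where "s' = s / (1 + 2 * d * s)"
  define t' where "t' = t / (1 + 2 * t)"
  have d: "0 < d" by (simp add: d_def)
  have s: "0 < s" "s \<le> 1" using t d by (simp_all add: s_def) (simp add: d_def)
  have s't': "t' / d = s'" using d by (simp add: s'_def s_def t'_def field_simps)
  obtain b' K where b': "0 < b'" "0 < K" "\<And>x W S N. (\<And>n. best_l2_err n x * exp (growth TYPE('d) \<eta> t * real n powr s) \<le> W) \<Longrightarrow>
       best_l2_err N (T (x - gal S (T x))) * exp (b' * real N powr s') \<le> K * W"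
    using residual_sparsity_class[OF growth_pos[OF \<eta>, where 'd='d] s] unfolding s'_def d_def by blast
  define \<eta>' where "\<eta>' = min \<eta> (b' * omega TYPE('d) powr s')"
  have g: "growth TYPE('d) \<eta>' t' \<le> b'"
  proof -
    have "- t' / d = - s'" using s't' by simp
    then have "growth TYPE('d) \<eta>' t' \<le> (b' * omega TYPE('d) powr s') * omega TYPE('d) powr (- s')"
      unfolding growth_def d_def[symmetric] by (simp only:) (intro mult_right_mono, auto simp: \<eta>'_def)
    also have "\<dots> = b'" using omega_pos[where 'd='d] by (simp add: powr_minus)
    finally show ?thesis .
  qed
  have main: "best_err_dual N (residual \<nu> \<sigma> f (galerkin \<nu> \<sigma> f S)) * exp_weight TYPE('d) \<eta>' t' N \<le> K * AG_norm \<eta> t u"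
    if S: "finite S" for S N
  proof -
    have rep: "represents (residual \<nu> \<sigma> f (galerkin \<nu> \<sigma> f S)) (T (uvec - gvec S))"
      unfolding galerkin_eq[OF S] by (rule represents_residual[OF S])
    have "best_l2_err N (T (uvec - gvec S)) * exp (growth TYPE('d) \<eta>' t' * real N powr s')
        \<le> best_l2_err N (T (uvec - gvec S)) * exp (b' * real N powr s')"
      using g by (intro mult_left_mono) (auto intro: mult_right_mono best_l2_err_nonneg[OF infinite_lattice])
    also have "\<dots> \<le> K * AG_norm \<eta> t u"
      by (rule b'(3)) (use AG_bound[OF u] in \<open>simp add: s_def d_def\<close>)
    finally show ?thesis by (simp only: best_err_dual_eq[OF rep] exp_weight_eq s't'[symmetric] d_def)
  qed
  have "residual_sparsity \<nu> \<sigma> f u \<eta> t \<eta>' t'"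
    unfolding residual_sparsity_def
  proof (intro exI[of _ K] allI impI conjI)
    fix S :: "(int ^ 'd) set" assume S: "finite S"
    show "residual \<nu> \<sigma> f (galerkin \<nu> \<sigma> f S) \<in> AG_dual \<eta>' t'"
      using main[OF S] residual_Hm1p unfolding AG_dual_def galerkin_eq[OF S] synth_def
      by (auto intro!: bdd_aboveI2)
    show "AG_dual_norm \<eta>' t' (residual \<nu> \<sigma> f (galerkin \<nu> \<sigma> f S)) \<le> K * AG_norm \<eta> t u"
      unfolding AG_dual_norm_def by (rule cSUP_least) (use main[OF S] in auto)
  qed
  moreover have "0 < \<eta>'" using \<eta> b' omega_pos[where 'd='d] by (simp add: \<eta>'_def)
  moreover have "0 < t'" "t' \<le> t" using t by (simp_all add: t'_def divide_le_eq)
  moreover have "\<eta>' \<le> \<eta>" by (simp add: \<eta>'_def)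
  ultimately show ?thesis by blast
qed

end

context adfour_run
begin

text \<open>With \<open>\<epsilon>\<close> proportional to the norm of the previous residual, the
  active set is no larger than the number of indices needed to approximate \<open>u\<close> up to
  \<open>\<delta>\<close>, the slack of the coarsening. As the new error is at most \<open>D *
  \<delta>\<close>, this number is expressed by the new error. If the previous residual vanishes, so
  does the new error.\<close>

lemma active_set_card:
  fixes \<eta> t
  defines "D \<equiv> max 1 (4 * sqrt (\<alpha>\<^sub>u / \<alpha>\<^sub>l) / marking_gap \<theta>)"
  assumes \<eta>: "0 < \<eta>" and t: "0 < t" "t \<le> real CARD('d)" and u: "u \<in> AG \<eta> t"
    and n: "n \<le> N" and e: "H1_norm (\<lambda>x. u x - U n x) \<noteq> 0"
    and C: "D * exp (growth TYPE('d) \<eta> t) \<le> C"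
  shows "real (card (\<Lambda> n)) \<le> omega TYPE('d) / \<eta> powr (real CARD('d) / t) *
    (ln (AG_norm \<eta> t u / H1_norm (\<lambda>x. u x - U n x)) + ln C) powr (real CARD('d) / t)"
proof (cases n)
  case 0
  then show ?thesis using omega_pos[where 'd='d] by (simp add: run_0)
next
  case (Suc m)
  define W where "W = AG_norm \<eta> t u"
  define b where "b = growth TYPE('d) \<eta> t"
  define s where "s = t / real CARD('d)"
  define r where "r = T (uvec - gvec (\<Lambda> m))"
  define \<epsilon> where "\<epsilon> = 1 / \<alpha>\<^sub>l * sqrt (1 - \<theta>\<^sup>2) * norm r"
  define err where "err = norm (uvec - gvec (\<Lambda> n))"
  define \<delta> where "\<delta> = marking_gap \<theta> * \<epsilon>"
  have g: "0 < marking_gap \<theta>" by (rule marking_gap(1)[OF theta])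
  have s: "0 < s" "s \<le> 1" using t by (simp_all add: s_def)
  have b: "0 < b" unfolding b_def by (rule growth_pos[OF \<eta>])
  have inv: "finite (\<Lambda> n)" "U n = synth (\<Lambda> n) (gvec (\<Lambda> n))" using run_invariant[OF n] by auto
  have err: "H1_norm (\<lambda>x. u x - U n x) = err" by (simp add: inv H1_norm_galerkin_error err_def)
  have errp: "0 < err" using e unfolding err by (simp add: err_def)
  obtain D0 where st: "\<And>Z. finite Z \<Longrightarrow> norm (uvec - restr Z uvec) \<le> marking_gap \<theta> * \<epsilon> \<Longrightarrow> card (\<Lambda> (m + 1)) \<le> card Z"
    "norm (uvec - gvec (\<Lambda> (m + 1))) \<le> 4 * sqrt (\<alpha>\<^sub>u / \<alpha>\<^sub>l) * \<epsilon>"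
    using run_step[of m] n Suc unfolding \<epsilon>_def r_def by (metis Suc_le_eq)
  have nm: "m + 1 = n" using Suc by simp
  have "err \<le> D * \<delta>"
  proof -
    have "0 \<le> \<epsilon>" using lower_pos theta by (simp add: \<epsilon>_def power_le_one)
    then have "4 * sqrt (\<alpha>\<^sub>u / \<alpha>\<^sub>l) / marking_gap \<theta> * \<delta> \<le> D * \<delta>"
      using g by (intro mult_right_mono) (auto simp: D_def \<delta>_def)
    then show ?thesis using st(2) g by (simp add: err_def nm[symmetric] \<delta>_def)
  qed
  then have \<delta>: "0 < \<delta>" using errp by (smt (verit) D_def max.cobounded1 mult_nonneg_nonpos)
  obtain k where k: "best_l2_err k uvec < \<delta>" "k = 0 \<or> \<delta> \<le> W \<and> real k \<le> 1 + (ln (W / \<delta>) / b) powr (1 / s)"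
    using exists_small_error_index[of "\<lambda>k. best_l2_err k uvec" b s W \<delta>] AG_bound[OF u] b s \<delta>
    unfolding b_def s_def W_def by blast
  obtain Z where Z: "finite Z" "card Z = k" "norm (uvec - restr Z uvec) < \<delta>"
    using best_l2_err_less_obtain[OF infinite_lattice k(1)] by blast
  have "card (\<Lambda> n) \<le> k" using st(1)[of Z] Z unfolding nm \<delta>_def by simp
  then have m: "card (\<Lambda> n) = 0 \<or> \<delta> \<le> W \<and> real (card (\<Lambda> n)) \<le> 1 + (ln (W / \<delta>) / b) powr (1 / s)"
    using k(2) by auto
  have "card (\<Lambda> n) = 0 \<or> 0 \<le> ln (W / err) + ln C \<and> real (card (\<Lambda> n)) \<le> ((ln (W / err) + ln C) / b) powr (1 / s)"
    by (rule absorb_additive_terms[OF b s _ errp \<open>err \<le> D * \<delta>\<close> m]) (use C in \<open>auto simp: D_def b_def\<close>)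
  then show ?thesis
  proof
    assume "card (\<Lambda> n) = 0"
    then show ?thesis using omega_pos[where 'd='d] by simp
  next
    assume "0 \<le> ln (W / err) + ln C \<and> real (card (\<Lambda> n)) \<le> ((ln (W / err) + ln C) / b) powr (1 / s)"
    then show ?thesis using growth_powr[OF \<eta> t(1), of "ln (W / err) + ln C", where 'd='d]
      unfolding err W_def b_def s_def by simp
  qed
qed

text \<open>A set captures the fraction \<open>\<theta>\<close> of the residual if the remainder is
  at most \<open>sqrt (1 - \<theta>^2)\<close> times its norm; the sparsity of the residual bounds
  the size of such a set. The residual norm dominates \<open>\<alpha>\<^sub>l\<close> times the
  error. The enrichment replaces each marked index by a ball with at most \<open>(2 * J + 1) ^ d
  \<le> (3 * J) ^ d\<close> lattice points.\<close>

lemma predicted_set_card: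
  fixes \<eta>' t' K W
  defines "D \<equiv> max 1 (1 / \<alpha>\<^sub>l)"
  assumes J: "1 \<le> J" and \<eta>': "0 < \<eta>'" and t': "0 < t'" "t' \<le> real CARD('d)"
    and W: "0 \<le> W" and K: "1 \<le> K"
    and sparse: "\<And>S n. finite S \<Longrightarrow>
      best_l2_err n (T (uvec - gvec S)) * exp (growth TYPE('d) \<eta>' t' * real n powr (t' / real CARD('d))) \<le> K * W"
    and n: "n < N" and e: "H1_norm (\<lambda>x. u x - U n x) \<noteq> 0"
    and C: "K * D * exp (growth TYPE('d) \<eta>' t') \<le> C"
  shows "real (card (\<Lambda>h (n + 1))) \<le> real (card (\<Lambda> n)) +
    3 ^ CARD('d) * real J ^ CARD('d) * (omega TYPE('d) / \<eta>' powr (real CARD('d) / t') *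
    (ln (W / H1_norm (\<lambda>x. u x - U n x)) + \<bar>ln (sqrt (1 - \<theta>\<^sup>2))\<bar> + ln C) powr (real CARD('d) / t'))"
proof -
  define b where "b = growth TYPE('d) \<eta>' t'"
  define s where "s = t' / real CARD('d)"
  define r where "r = T (uvec - gvec (\<Lambda> n))"
  define c where "c = sqrt (1 - \<theta>\<^sup>2)"
  define err where "err = norm (uvec - gvec (\<Lambda> n))"
  define \<delta> where "\<delta> = c * norm r"
  have c: "0 < c" "c < 1" using theta by (simp_all add: c_def power_less_one_iff)
  have s: "0 < s" "s \<le> 1" using t' by (simp_all add: s_def)
  have b: "0 < b" unfolding b_def by (rule growth_pos[OF \<eta>'])
  have inv: "finite (\<Lambda> n)" "U n = synth (\<Lambda> n) (gvec (\<Lambda> n))" using run_invariant[of n] n by auto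
  have err: "H1_norm (\<lambda>x. u x - U n x) = err" by (simp add: inv H1_norm_galerkin_error err_def)
  have errp: "0 < err" using e unfolding err by (simp add: err_def)
  have err_r: "\<alpha>\<^sub>l * err \<le> norm r" unfolding err_def r_def by (rule norm_le_norm_T)
  then have \<delta>: "0 < \<delta>" using errp lower_pos c unfolding \<delta>_def
    by (smt (verit) mult_pos_pos)
  obtain M where M: "finite M" "\<Lambda>h (n + 1) = \<Lambda> n \<union> enrich M J"
    "\<And>Z. finite Z \<Longrightarrow> norm (r - restr Z r) \<le> sqrt (1 - \<theta>\<^sup>2) * norm r \<Longrightarrow> card M \<le> card Z"
    using run_step[OF n] unfolding r_def by metis
  obtain k where k: "best_l2_err k r < \<delta>" "k = 0 \<or> \<delta> \<le> K * W \<and> real k \<le> 1 + (ln (K * W / \<delta>) / b) powr (1 / s)"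
    using exists_small_error_index[of "\<lambda>k. best_l2_err k r" b s "K * W" \<delta>] sparse[OF inv(1)] b s \<delta>
    unfolding b_def s_def r_def by blast
  obtain Z where Z: "finite Z" "card Z = k" "norm (r - restr Z r) < \<delta>"
    using best_l2_err_less_obtain[OF infinite_lattice k(1)] by blast
  have "card M \<le> k" using M(3)[of Z] Z unfolding \<delta>_def c_def by simp
  then have m: "card M = 0 \<or> \<delta> \<le> K * W \<and> real (card M) \<le> 1 + (ln (K * W / \<delta>) / b) powr (1 / s)"
    using k(2) by auto
  have e1: "0 < err * c" using errp c by simp
  \<comment> \<open>Using \<open>err * c\<close> as the error produces the term with the logarithm of \<open>sqrt (1 - \<theta>^2)\<close>.\<close>
  have e2: "err * c \<le> D * \<delta>"
  proof -
    have "err * c \<le> (norm r / \<alpha>\<^sub>l) * c"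
      using err_r lower_pos c by (intro mult_right_mono) (auto simp: field_simps)
    also have "\<dots> = 1 / \<alpha>\<^sub>l * \<delta>" by (simp add: \<delta>_def)
    also have "\<dots> \<le> D * \<delta>" using \<delta> by (intro mult_right_mono) (auto simp: D_def)
    finally show ?thesis .
  qed
  have C': "D * exp b \<le> C / K" using C K by (simp add: b_def field_simps)
  have D1: "1 \<le> D" by (simp add: D_def)
  define L where "L = ln (W / err) + \<bar>ln c\<bar> + ln C"
  have "card M = 0 \<or> 0 \<le> L \<and> real (card M) \<le> (L / b) powr (1 / s)"
  proof (cases "card M = 0")
    case False
    then have KW: "0 < K * W" using m \<delta> by auto
    then have Wp: "0 < W" using K W by (smt (verit) mult_nonneg_nonpos)
    have Cp: "0 < C"
    proof -
      have "0 < D * exp b" using D1 by simp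
      then have "0 < C / K" using C' by linarith
      then show ?thesis using K by (simp add: zero_less_divide_iff)
    qed
    have "ln (K * W / (err * c)) + ln (C / K) = L"
      using Wp K c errp Cp by (simp add: L_def ln_div ln_mult)
    then show ?thesis
      using absorb_additive_terms[OF b s D1 e1 e2 m C'] by simp
  qed simp
  then have cM: "real (card M) \<le> omega TYPE('d) / \<eta>' powr (real CARD('d) / t') * L powr (real CARD('d) / t')"
    using growth_powr[OF \<eta>' t'(1), of L, where 'd='d] omega_pos[where 'd='d]
    unfolding b_def s_def by auto
  have "card (\<Lambda>h (n + 1)) \<le> card (\<Lambda> n) + card M * (2 * J + 1) ^ CARD('d)"
    unfolding M(2) using card_Un_le[of "\<Lambda> n" "enrich M J"] card_enrich[OF M(1), of J] by linarith
  also have "\<dots> \<le> card (\<Lambda> n) + card M * (3 * J) ^ CARD('d)"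
    using J by (intro add_left_mono mult_left_mono power_mono) auto
  finally have "real (card (\<Lambda>h (n + 1))) \<le> real (card (\<Lambda> n) + card M * (3 * J) ^ CARD('d))"
    by (simp only: of_nat_le_iff)
  also have "\<dots> = real (card (\<Lambda> n)) + 3 ^ CARD('d) * real J ^ CARD('d) * real (card M)"
    by (simp add: power_mult_distrib)
  also have "\<dots> \<le> real (card (\<Lambda> n)) + 3 ^ CARD('d) * real J ^ CARD('d) *
      (omega TYPE('d) / \<eta>' powr (real CARD('d) / t') * L powr (real CARD('d) / t'))"
    using cM by (intro add_left_mono mult_left_mono) auto
  finally show ?thesis unfolding err L_def c_def .
qed

end

theorem theorem8p2:
  "\<exists>\<kappa>>1. \<forall>(\<nu> :: real ^ 'd::finite \<Rightarrow> real) \<sigma> \<nu>\<^sub>l \<nu>\<^sub>u \<sigma>\<^sub>l \<sigma>\<^sub>u \<alpha>\<^sub>l \<alpha>\<^sub>u f u \<eta>\<^sub>L \<eta>\<^sub>L' C\<^sub>A \<psi> \<theta> J \<eta> t.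
     elliptic_coeffs \<nu> \<sigma> \<nu>\<^sub>l \<nu>\<^sub>u \<sigma>\<^sub>l \<sigma>\<^sub>u \<and>
     \<alpha>\<^sub>l = min \<nu>\<^sub>l \<sigma>\<^sub>l \<and> \<alpha>\<^sub>u = max \<nu>\<^sub>u \<sigma>\<^sub>u \<and>
     f \<in> Hm1p \<and> weak_solution \<nu> \<sigma> f u \<and>
     decay_assumption (stiffness \<nu> \<sigma>) \<eta>\<^sub>L \<eta>\<^sub>L' C\<^sub>A \<psi> \<and>
     0 < \<theta> \<and> \<theta> < 1 \<and>
     is_arg_min id (\<lambda>j::nat. 1 \<le> j \<and> \<psi> j \<le> sqrt ((1 - \<theta>\<^sup>2) / (\<alpha>\<^sub>l * \<alpha>\<^sub>u))) J \<and>
     0 < \<eta> \<and> 0 < t \<and> t \<le> real CARD('d) \<and> u \<in> AG \<eta> t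
   \<longrightarrow>
     (\<exists>C>1. \<forall>tol N \<Lambda> \<Lambda>h U R.
        0 \<le> tol \<and> tol < 1 \<and> pc_adfour_run \<nu> \<sigma> \<alpha>\<^sub>l f \<theta> tol J N \<Lambda> \<Lambda>h U R \<longrightarrow>
        (\<forall>n\<le>N. H1_norm (\<lambda>x. u x - U n x) \<noteq> 0 \<longrightarrow>
           real (card (\<Lambda> n)) \<le>
             \<kappa> * (omega TYPE('d) / \<eta> powr (real CARD('d) / t)) *
             (ln (AG_norm \<eta> t u / H1_norm (\<lambda>x. u x - U n x)) + ln C) powr (real CARD('d) / t)))
     \<and>
     (\<forall>\<mu>\<^sub>L \<mu>\<^sub>L'.
        0 < \<mu>\<^sub>L \<and> 0 < \<mu>\<^sub>L' \<and> \<mu>\<^sub>L' \<le> \<mu>\<^sub>L \<and>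
        stiffness \<nu> \<sigma> \<in> exp_decay \<mu>\<^sub>L \<and> mat_inverse (stiffness \<nu> \<sigma>) \<in> exp_decay \<mu>\<^sub>L' \<and>
        CARD('d) \<le> 10 \<and>
        \<eta> < omega TYPE('d) powr (t / (real CARD('d) * (1 + 2 * t))) * \<mu>\<^sub>L'
      \<longrightarrow>
        (\<exists>\<eta>' t'. 0 < \<eta>' \<and> \<eta>' \<le> \<eta> \<and> 0 < t' \<and> t' \<le> t \<and> residual_sparsity \<nu> \<sigma> f u \<eta> t \<eta>' t') \<and>
        (\<forall>\<eta>' t'. 0 < \<eta>' \<and> \<eta>' \<le> \<eta> \<and> 0 < t' \<and> t' \<le> t \<and> residual_sparsity \<nu> \<sigma> f u \<eta> t \<eta>' t' \<longrightarrow>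
           (\<exists>C>1. \<forall>tol N \<Lambda> \<Lambda>h U R.
              0 \<le> tol \<and> tol < 1 \<and> pc_adfour_run \<nu> \<sigma> \<alpha>\<^sub>l f \<theta> tol J N \<Lambda> \<Lambda>h U R \<longrightarrow>
              (\<forall>n\<le>N. H1_norm (\<lambda>x. u x - U n x) \<noteq> 0 \<longrightarrow>
                 real (card (\<Lambda> n)) \<le>
                   \<kappa> * (omega TYPE('d) / \<eta> powr (real CARD('d) / t)) *
                   (ln (AG_norm \<eta> t u / H1_norm (\<lambda>x. u x - U n x)) + ln C) powr (real CARD('d) / t)) \<and>
              (\<forall>n<N. H1_norm (\<lambda>x. u x - U n x) \<noteq> 0 \<longrightarrow>
                 real (card (\<Lambda>h (n + 1))) \<le> real (card (\<Lambda> n)) +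
                   \<kappa> * real J ^ CARD('d) * ((omega TYPE('d))\<^sup>2 / \<eta>' powr (real CARD('d) / t')) *
                   (ln (AG_norm \<eta> t u / H1_norm (\<lambda>x. u x - U n x))
                      + \<bar>ln (sqrt (1 - \<theta>\<^sup>2))\<bar> + ln C) powr (real CARD('d) / t')))))"
proof -
  \<comment> \<open>The second entry compares the lattice points of a ball, at most \<open>3 ^ d * J ^ d\<close>, with \<open>omega * J ^ d\<close>.\<close>
  define \<kappa> where "\<kappa> = max 2 (3 ^ CARD('d) / omega TYPE('d))"
  have \<kappa>: "1 < \<kappa>" "1 \<le> \<kappa>" by (simp_all add: \<kappa>_def)
  have \<kappa>3: "3 ^ CARD('d) \<le> \<kappa> * omega TYPE('d)"
  proof -
    have "3 ^ CARD('d) = 3 ^ CARD('d) / omega TYPE('d) * omega TYPE('d)"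
      using omega_pos[where 'd='d] by simp
    also have "\<dots> \<le> \<kappa> * omega TYPE('d)"
      using omega_pos[where 'd='d] by (intro mult_right_mono) (auto simp: \<kappa>_def)
    finally show ?thesis .
  qed
  show ?thesis
  proof (rule exI[of _ \<kappa>], rule conjI[OF \<kappa>(1)], intro allI, rule impI, elim conjE, goal_cases)
    case (1 \<nu> \<sigma> \<nu>\<^sub>l \<nu>\<^sub>u \<sigma>\<^sub>l \<sigma>\<^sub>u \<alpha>\<^sub>l \<alpha>\<^sub>u f u \<eta>\<^sub>L \<eta>\<^sub>L' C\<^sub>A \<psi> \<theta> J \<eta> t)
    note coeffs = 1(1) and \<alpha> = 1(2,3) and f = 1(4) and sol = 1(5) and decay = 1(6) and \<theta> = 1(7,8)
      and J_min = 1(9) and \<eta> = 1(10) and t = 1(11,12) and u = 1(13)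
    have J: "1 \<le> J" "\<psi> J \<le> sqrt ((1 - \<theta>\<^sup>2) / (\<alpha>\<^sub>l * \<alpha>\<^sub>u))" using J_min by (auto simp: is_arg_min_def)
    interpret elliptic_problem \<nu> \<sigma> \<nu>\<^sub>l \<nu>\<^sub>u \<sigma>\<^sub>l \<sigma>\<^sub>u \<alpha>\<^sub>l \<alpha>\<^sub>u f u
      by unfold_locales (fact coeffs \<alpha> f sol)+
    have adfour: "adfour_run \<nu> \<sigma> \<nu>\<^sub>l \<nu>\<^sub>u \<sigma>\<^sub>l \<sigma>\<^sub>u \<alpha>\<^sub>l \<alpha>\<^sub>u f u \<psi> \<theta> tol J N \<Lambda> \<Lambda>h U R"
      if "pc_adfour_run \<nu> \<sigma> \<alpha>\<^sub>l f \<theta> tol J N \<Lambda> \<Lambda>h U R" for tol N \<Lambda> \<Lambda>h U R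
      by unfold_locales (use decay J(2) \<theta> that in \<open>auto simp: decay_assumption_def\<close>)
    define C1 where "C1 = 2 + max 1 (4 * sqrt (\<alpha>\<^sub>u / \<alpha>\<^sub>l) / marking_gap \<theta>) * exp (growth TYPE('d) \<eta> t)"
    have C1: "1 < C1"
    proof -
      have "0 \<le> max 1 (4 * sqrt (\<alpha>\<^sub>u / \<alpha>\<^sub>l) / marking_gap \<theta>) * exp (growth TYPE('d) \<eta> t)"
        by (intro mult_nonneg_nonneg) auto
      then show ?thesis unfolding C1_def by linarith
    qed
    have active: "real (card (\<Lambda> n)) \<le> \<kappa> * (omega TYPE('d) / \<eta> powr (real CARD('d) / t)) *
        (ln (AG_norm \<eta> t u / H1_norm (\<lambda>x. u x - U n x)) + ln C) powr (real CARD('d) / t)"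
      if run: "pc_adfour_run \<nu> \<sigma> \<alpha>\<^sub>l f \<theta> tol J N \<Lambda> \<Lambda>h U R" and n: "n \<le> N"
        and e: "H1_norm (\<lambda>x. u x - U n x) \<noteq> 0" and C: "C1 \<le> C" for C tol N \<Lambda> \<Lambda>h U R n
    proof -
      have "real (card (\<Lambda> n)) \<le> 1 * (omega TYPE('d) / \<eta> powr (real CARD('d) / t) *
          (ln (AG_norm \<eta> t u / H1_norm (\<lambda>x. u x - U n x)) + ln C) powr (real CARD('d) / t))"
        using adfour_run.active_set_card[OF adfour[OF run] \<eta> t u n e, of C] C by (simp add: C1_def)
      also have "\<dots> \<le> \<kappa> * (omega TYPE('d) / \<eta> powr (real CARD('d) / t) *
          (ln (AG_norm \<eta> t u / H1_norm (\<lambda>x. u x - U n x)) + ln C) powr (real CARD('d) / t))"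
        using \<kappa> omega_pos[where 'd='d] by (intro mult_right_mono) auto
      finally show ?thesis by (simp only: mult.assoc)
    qed
    show ?case
    proof (intro conjI allI impI, goal_cases)
      case 1
      show ?case using C1 active by blast
    next
      case (2 \<mu>\<^sub>L \<mu>\<^sub>L')
      then show ?case by (intro residual_sparsity_exists[OF _ _ \<eta> t u, of \<mu>\<^sub>L]) auto
    next
      case S: (3 \<mu>\<^sub>L \<mu>\<^sub>L' \<eta>' t')
      then have \<eta>': "0 < \<eta>'" and t': "0 < t'" "t' \<le> real CARD('d)" using t by auto
      have W: "0 \<le> AG_norm \<eta> t u" by (rule AG_norm_nonneg[OF u t(1)])
      obtain K where K: "1 \<le> K" and sparse: "\<And>S n. finite S \<Longrightarrow>
          best_l2_err n (T (uvec - gvec S)) * exp (growth TYPE('d) \<eta>' t' * real n powr (t' / real CARD('d))) \<le> K * AG_norm \<eta> t u"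
        using residual_sparsityD[OF _ W, of \<eta>' t'] S by blast
      define C where "C = max C1 (K * max 1 (1 / \<alpha>\<^sub>l) * exp (growth TYPE('d) \<eta>' t'))"
      have C: "1 < C" "C1 \<le> C" "K * max 1 (1 / \<alpha>\<^sub>l) * exp (growth TYPE('d) \<eta>' t') \<le> C"
        using C1 by (auto simp: C_def)
      have predicted: "real (card (\<Lambda>h (n + 1))) \<le> real (card (\<Lambda> n)) +
          \<kappa> * real J ^ CARD('d) * ((omega TYPE('d))\<^sup>2 / \<eta>' powr (real CARD('d) / t')) *
          (ln (AG_norm \<eta> t u / H1_norm (\<lambda>x. u x - U n x)) + \<bar>ln (sqrt (1 - \<theta>\<^sup>2))\<bar> + ln C) powr (real CARD('d) / t')"
        if run: "pc_adfour_run \<nu> \<sigma> \<alpha>\<^sub>l f \<theta> tol J N \<Lambda> \<Lambda>h U R" and n: "n < N"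
          and e: "H1_norm (\<lambda>x. u x - U n x) \<noteq> 0" for tol N \<Lambda> \<Lambda>h U R n
      proof -
        define X where "X = (ln (AG_norm \<eta> t u / H1_norm (\<lambda>x. u x - U n x)) + \<bar>ln (sqrt (1 - \<theta>\<^sup>2))\<bar> + ln C) powr (real CARD('d) / t')"
        have "real (card (\<Lambda>h (n + 1))) \<le> real (card (\<Lambda> n)) +
            3 ^ CARD('d) * real J ^ CARD('d) * (omega TYPE('d) / \<eta>' powr (real CARD('d) / t') * X)"
          unfolding X_def by (rule adfour_run.predicted_set_card[OF adfour[OF run] J(1) \<eta>' t' W K sparse n e C(3)])
        also have "3 ^ CARD('d) * real J ^ CARD('d) * (omega TYPE('d) / \<eta>' powr (real CARD('d) / t') * X)
            \<le> (\<kappa> * omega TYPE('d)) * real J ^ CARD('d) * (omega TYPE('d) / \<eta>' powr (real CARD('d) / t') * X)"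
          using \<kappa>3 omega_pos[where 'd='d] by (intro mult_right_mono) (auto simp: X_def)
        finally show ?thesis by (simp add: X_def power2_eq_square mult_ac)
      qed
      show ?case using C(1) active[OF _ _ _ C(2)] predicted by blast
    qed
  qed
qed

end
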